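(* Consider the fully discrete dG pressure correction scheme described in the context (with any $\epsilon\in\{-1,0,1\}$), with $\mathbf u^0\in L^2(\mathcal O)^d$, and assume (A1). Then, for $\tau>0$ small enough, the discrete solution satisfies for all $1\le m\le N$ $$\|\mathbf u_h^m\|^2+\frac{\omega\mu}{2}\tau\sum_{n=1}^m\|\widetilde{\mathbf u}_h^n\|_{\rm dG}^2+\frac12\tau^2|\xi_h^m|_{\rm dG}^2+\frac{1}{\delta\mu}\tau\|S_h^m\|^2\le\tilde C_T\Big(\|\mathbf u^0\|^2+\frac{4C_2^2}{\omega\mu}\tau\sum_{n=1}^m\|\mathbf f^n\|^2\Big),$$ where $\tilde C_T>0$ depends on $\mu,\gamma,\eta,T$ but not on $h$ and $\tau$.
   Context: Setting: $\mathcal O\subset\mathbb R^d$, $d\in\{2,3\}$, bounded open convex polyhedral domain; $T>0$; $\mu,\gamma,\eta>0$, $\beta(t)=\gamma e^{-\eta t}$; forcing $\mathbf f$ with $\mathbf f^n=\mathbf f(t_n)\in L^2(\mathcal O)^d$. $\tau=T/N$, $t_n=n\tau$; for a sequence $(\boldsymbol\varphi^j)_{j\ge1}$, $q_r^n(\boldsymbol\varphi)=\tau\sum_{j=1}^n\beta(t_n-t_j)\boldsymbol\varphi^j$. Mesh: $\mathcal K_h$ shape-regular uniform family of partitions of $\mathcal O$, mesh size $h$; $\mathcal F_h$, $\mathcal F_h^i$, $\mathcal F_h^b$ all/interior/boundary faces, $h_F=|F|^{1/(d-1)}$. On an interior face $F=\partial K^1\cap\partial K^2$: $\mathbf n_F$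 points from $K^1$ to $K^2$, $\{w\}=\frac12(w|_{K^1}+w|_{K^2})$, $[w]=w|_{K^1}-w|_{K^2}$; on a boundary face $\mathbf n_F$ is outward and $\{w\}=[w]=w|_F$. $\mathbf n_K$ outward normal of $K$; $w^{\rm int},w^{\rm ext}$ traces on $\partial K$ from inside/outside, $w^{\rm ext}=0$ on $\partial\mathcal O$. $\nabla_h,\nabla_h\cdot$ broken gradient/divergence. $(\cdot,\cdot)$, $\|\cdot\|$: $L^2(\mathcal O)$. Spaces: $\mathbf M=\{\boldsymbol\varphi\in L^2(\mathcal O)^d:\boldsymbol\varphi|_K\in W^{2,2d/(d+1)}(K)^d\ \forall K\}$; for integers $r_1\ge1,r_2\ge0$ with $r_1-1\le r_2\le r_1+1$: $\mathbf M_h$ = piecewise polynomial vector fields of degree $\le r_1$, $P_h$ = piecewise polynomials of degree $\le r_2$, $P_h^0=\{g\in P_h:\int_{\mathcal O}g=0\}$. Forms: $\mathcal A_c(\boldsymbol\theta;\mathbf z,\boldsymbol\varphi,\mathbf w)=\sum_K\big(\int_K(\mathbf z\cdot\nabla\boldsymbol\varphi)\cdot\mathbf w+\frac12\int_K(\nabla\cdot\mathbf z)\boldsymbol\varphi\cdot\mathbf w\big)-\frac12\sum_{F\in\mathcal F_h}\int_F[\mathbf z]\cdot\mathbf n_F\{\boldsymbol\varphi\cdot\mathbf w\}+\sum_K\int_{\partial K_-^{\boldsymbol\theta}}|\{\mathbf z\}\cdot\mathbf n_K|(\boldsymbol\varphi^{\rm int}-\boldsymbol\varphi^{\rm ext})\cdot\mathbf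 w^{\rm int}$, $\partial K_-^{\boldsymbol\theta}=\{x\in\partial K:\{\boldsymbol\theta(x)\}\cdot\mathbf n_K<0\}$. For $\epsilon\in\{-1,0,1\}$, $\sigma>0$: $\mathcal A_\epsilon(\mathbf u,\mathbf w)=\sum_K\int_K\nabla\mathbf u:\nabla\mathbf w-\sum_{F\in\mathcal F_h}\int_F\{\nabla\mathbf u\}\mathbf n_F\cdot[\mathbf w]+\epsilon\sum_{F\in\mathcal F_h}\int_F\{\nabla\mathbf w\}\mathbf n_F\cdot[\mathbf u]+\sum_{F\in\mathcal F_h}\frac{\sigma}{h_F}\int_F[\mathbf u]\cdot[\mathbf w]$. $b(\mathbf w,g)=-\sum_K\int_K\mathbf w\cdot\nabla g+\sum_{F\in\mathcal F_h^i}\int_F\{\mathbf w\}\cdot\mathbf n_F[g]$. With $\tilde\sigma>0$: $\mathcal A_{\rm sip}(v,g)=\sum_K\int_K\nabla v\cdot\nabla g-\sum_{F\in\mathcal F_h^i}\int_F(\{\nabla v\}\cdot\mathbf n_F[g]+\{\nabla g\}\cdot\mathbf n_F[v])+\sum_{F\in\mathcal F_h^i}\frac{\tilde\sigma}{h_F}\int_F[v][g]$. Norms: $\|\mathbf w\|_{\rm dG}^2=\sum_K\|\nabla\mathbf w\|_{L^2(K)}^2+\sum_{F\in\mathcal F_h}\frac{\sigma}{h_F}\|[\mathbf w]\|_{L^2(F)}^2$, $|g|_{\rm dG}^2=\sum_K\|\nabla g\|_{L^2(K)}^2+\sum_{F\in\mathcal F_h^i}\frac{\tilde\sigma}{h_F}\|[g]\|_{L^2(F)}^2$.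 $C_2$ is a constant independent of $h$ with $\|\mathbf w\|\le C_2\|\mathbf w\|_{\rm dG}$ for all $\mathbf w\in\mathbf M$. Lifts: for $F\in\mathcal F_h$, $r_F(\boldsymbol\varsigma)\in P_h$ with $\int_{\mathcal O}r_F(\boldsymbol\varsigma)g_h=\int_F\{g_h\}\boldsymbol\varsigma\cdot\mathbf n_F$ $\forall g_h\in P_h$, and $R_h([\mathbf w_h])=\sum_{F\in\mathcal F_h}r_F([\mathbf w_h])$; for $F\in\mathcal F_h^i$, $\mathbf g_F(\varsigma)\in\mathbf M_h$ with $\int_{\mathcal O}\mathbf g_F(\varsigma)\cdot\mathbf w_h=\int_F\{\mathbf w_h\}\cdot\mathbf n_F\varsigma$ $\forall\mathbf w_h\in\mathbf M_h$, and $\mathbf G_h([g_h])=\sum_{F\in\mathcal F_h^i}\mathbf g_F([g_h])$. $B_{r_2},\tilde B_{r_1}>0$ are constants (depending only on the degrees and mesh regularity) with $\|R_h([\mathbf w_h])\|^2\le B_{r_2}^2\sum_{F\in\mathcal F_h}h_F^{-1}\|[\mathbf w_h]\|_{L^2(F)}^2$ and $\|\mathbf G_h([g_h])\|^2\le\tilde B_{r_1}^2\sum_{F\in\mathcal F_h^i}h_F^{-1}\|[g_h]\|_{L^2(F)}^2$. Standing assumption: $\sigma,\tilde\sigma$ large enough that $\mathcal A_\epsilon(\mathbf w_h,\mathbf w_h)\ge\omega\|\mathbf w_h\|_{\rm dG}^2$ $\forall\mathbf w_h\in\mathbf M_h$ ($\omega=1$ if $\epsilon=1$, $\omega=\frac12$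 if $\epsilon\in\{-1,0\}$) and $\mathcal A_{\rm sip}(g_h,g_h)\ge\frac12|g_h|_{\rm dG}^2$ $\forall g_h\in P_h$. Scheme (parameter $\delta>0$): $p_h^0=v_h^0=0$, $\mathbf u_h^0$ the local $L^2$ projection of $\mathbf u^0$ onto $\mathbf M_h$; for $n=1,\dots,N$: (i) $\widetilde{\mathbf u}_h^n\in\mathbf M_h$: $(\widetilde{\mathbf u}_h^n,\mathbf w_h)+\tau\mathcal A_c(\mathbf u_h^{n-1};\mathbf u_h^{n-1},\widetilde{\mathbf u}_h^n,\mathbf w_h)+\tau\mu\mathcal A_\epsilon(\widetilde{\mathbf u}_h^n,\mathbf w_h)+\tau\mathcal A_\epsilon(q_r^n(\widetilde{\mathbf u}_h),\mathbf w_h)=(\mathbf u_h^{n-1},\mathbf w_h)+\tau b(\mathbf w_h,p_h^{n-1})+\tau(\mathbf f^n,\mathbf w_h)$ $\forall\mathbf w_h\in\mathbf M_h$; (ii) $v_h^n\in P_h^0$: $\mathcal A_{\rm sip}(v_h^n,g_h)=-\frac1\tau b(\widetilde{\mathbf u}_h^n,g_h)$ $\forall g_h\in P_h^0$; (iii) $p_h^n\in P_h$: $(p_h^n,g_h)=(p_h^{n-1},g_h)+(v_h^n,g_h)-\delta\mu b(\widetilde{\mathbf u}_h^n,g_h)-\delta b(q_r^n(\widetilde{\mathbf u}_h),g_h)$ $\forall g_h\in P_h$; (iv) $\mathbf u_h^n\in\mathbf M_h$: $(\mathbf u_h^n,\mathbf w_h)=(\widetilde{\mathbf u}_h^n,\mathbf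 w_h)+\tau b(\mathbf w_h,v_h^n)$ $\forall\mathbf w_h\in\mathbf M_h$. Auxiliary quantities: $S_h^0=0$, $S_h^n=\delta\mu\sum_{i=1}^n(\nabla_h\cdot\widetilde{\mathbf u}_h^i-R_h([\widetilde{\mathbf u}_h^i]))+\delta\tau\sum_{i=1}^n\sum_{j=1}^i\beta(t_i-t_j)(\nabla_h\cdot\widetilde{\mathbf u}_h^j-R_h([\widetilde{\mathbf u}_h^j]))$ for $n\ge1$; $\xi_h^0=0$, $\xi_h^n=p_h^n+S_h^n$. (A1): $\sigma\ge B_{r_2}^2/d$, $\tilde\sigma\ge4\tilde B_{r_1}^2$, and $\delta\le\min\big(\frac{\omega}{8d},\frac{\omega\mu^2}{16\gamma^2d}\big)$. *)

theory Defs
  imports "HOL-Analysis.Analysis"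
begin

text \<open>Discrete (broken) functions are represented as families indexed by the mesh
elements: w K is the polynomial that w restricts to on element K (defined on all of
the space, so that interior traces on the boundary of K are just point evaluations).
Outside the mesh the family is zero.\<close>

type_synonym 'n vfam = "(real^'n) set \<Rightarrow> real^'n \<Rightarrow> real^'n"
type_synonym 'n sfam = "(real^'n) set \<Rightarrow> real^'n \<Rightarrow> real"

definition polyfun :: "nat \<Rightarrow> (real^'n \<Rightarrow> real) \<Rightarrow> bool" where
  "polyfun r p \<longleftrightarrow> (\<exists>c::('n \<Rightarrow> nat) \<Rightarrow> real. \<forall>x.
     p x = (\<Sum>\<alpha>\<in>{\<alpha>. sum \<alpha> UNIV \<le> r}. c \<alpha> * (\<Prod>i\<in>UNIV. (x$i) ^ (\<alpha> i))))"

definition vpolyfun :: "nat \<Rightarrow> (real^'n \<Rightarrow> real^'n) \<Rightarrow> bool" where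
  "vpolyfun r p \<longleftrightarrow> (\<forall>i. polyfun r (\<lambda>x. p x $ i))"

definition dg_domain :: "(real^'n) set \<Rightarrow> bool" where
  "dg_domain Om \<longleftrightarrow> open Om \<and> convex Om \<and> bounded Om \<and> Om \<noteq> {} \<and> polytope (closure Om)"

definition dg_mesh :: "(real^'n) set \<Rightarrow> (real^'n) set set \<Rightarrow> bool" where
  "dg_mesh Om \<K> \<longleftrightarrow> finite \<K>
     \<and> (\<forall>K\<in>\<K>. K \<noteq> {} \<and> K \<subseteq> Om \<and> polytope (closure K) \<and> K = interior (closure K))
     \<and> (\<forall>K\<in>\<K>. \<forall>K'\<in>\<K>. K \<noteq> K' \<longrightarrow> K \<inter> K' = {})
     \<and> \<Union>(closure ` \<K>) = closure Om"

definition fc :: "(real^'n) set \<Rightarrow> (real^'n) set \<Rightarrow> (real^'n) set" where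
  "fc K1 K2 = closure K1 \<inter> closure K2"

text \<open>Interior faces, as ordered pairs (K1,K2) of neighbouring elements; every
geometric interior face F = dK1 /\ dK2 appears twice (as (K1,K2) and (K2,K1)), so
sums over interior faces are written as one half of sums over these pairs.\<close>
definition int_faces :: "(real^'n) set set \<Rightarrow> ((real^'n) set \<times> (real^'n) set) set" where
  "int_faces \<K> = {(K1,K2). K1 \<in> \<K> \<and> K2 \<in> \<K> \<and> K1 \<noteq> K2
                      \<and> aff_dim (fc K1 K2) = int CARD('n) - 1}"

definition bnd_faces :: "(real^'n) set \<Rightarrow> (real^'n) set set \<Rightarrow> ((real^'n) set \<times> (real^'n) set) set" where
  "bnd_faces Om \<K> = {(K,F). K \<in> \<K> \<and> (\<exists>G. G facet_of closure Om \<and> F = closure K \<inter> G)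
                        \<and> aff_dim F = int CARD('n) - 1}"

definition onormal :: "(real^'n) set \<Rightarrow> (real^'n) set \<Rightarrow> real^'n" where
  "onormal K F = (THE \<nu>. norm \<nu> = 1 \<and> (\<forall>y\<in>F. \<forall>z\<in>F. \<nu> \<bullet> (y - z) = 0)
                        \<and> (\<forall>x\<in>closure K. \<forall>y\<in>F. \<nu> \<bullet> (x - y) \<le> 0))"

definition hnormal :: "(real^'n) set \<Rightarrow> real^'n" where
  "hnormal F = (SOME \<nu>. norm \<nu> = 1 \<and> (\<forall>y\<in>F. \<forall>z\<in>F. \<nu> \<bullet> (y - z) = 0))"

text \<open>The face lies in the hyperplane nu . x = c; writing it as a graph over the
coordinate hyperplane orthogonal to e_k (with nu_k \<noteq> 0), the surface element is
dy / |nu_k|.\<close>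
definition surf_int :: "(real^'n) set \<Rightarrow> (real^'n \<Rightarrow> real) \<Rightarrow> real" where
  "surf_int F g = (let \<nu> = hnormal F; k = (SOME k. \<nu>$k \<noteq> 0); c = \<nu> \<bullet> (SOME y. y \<in> F);
       emb = (\<lambda>y::'n \<Rightarrow> real. (\<chi> i. if i = k then (c - (\<Sum>j\<in>UNIV-{k}. \<nu>$j * y j)) / \<nu>$k else y i))
     in LINT y | (\<Pi>\<^sub>M j\<in>UNIV-{k}. lborel). indicator {y. emb y \<in> F} y * g (emb y) / \<bar>\<nu>$k\<bar>)"

definition hF :: "(real^'n) set \<Rightarrow> real" where
  "hF F = surf_int F (\<lambda>_. 1) powr (1 / (real CARD('n) - 1))"

definition pd :: "(real^'n \<Rightarrow> 'b::real_normed_vector) \<Rightarrow> 'n \<Rightarrow> real^'n \<Rightarrow> 'b" where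
  "pd f j x = frechet_derivative f (at x) (axis j 1)"

text \<open>(grad u) n, with (grad u)_{ij} = d_j u_i\<close>
definition gradn :: "(real^'n \<Rightarrow> real^'n) \<Rightarrow> real^'n \<Rightarrow> real^'n \<Rightarrow> real^'n" where
  "gradn u n x = (\<Sum>j\<in>UNIV. (n$j) *\<^sub>R pd u j x)"

definition vdiv :: "(real^'n \<Rightarrow> real^'n) \<Rightarrow> real^'n \<Rightarrow> real" where
  "vdiv u x = (\<Sum>j\<in>UNIV. pd u j x $ j)"

definition sgrad :: "(real^'n \<Rightarrow> real) \<Rightarrow> real^'n \<Rightarrow> real^'n" where
  "sgrad g x = (\<chi> j. pd g j x)"

definition gradip :: "(real^'n \<Rightarrow> real^'n) \<Rightarrow> (real^'n \<Rightarrow> real^'n) \<Rightarrow> real^'n \<Rightarrow> real" where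
  "gradip u w x = (\<Sum>j\<in>UNIV. pd u j x \<bullet> pd w j x)"

definition convd :: "(real^'n \<Rightarrow> real^'n) \<Rightarrow> (real^'n \<Rightarrow> real^'n) \<Rightarrow> real^'n \<Rightarrow> real^'n" where
  "convd z \<phi> x = (\<Sum>j\<in>UNIV. (z x $ j) *\<^sub>R pd \<phi> j x)"

definition Mh :: "(real^'n) set set \<Rightarrow> nat \<Rightarrow> 'n vfam set" where
  "Mh \<K> r1 = {w. (\<forall>K\<in>\<K>. vpolyfun r1 (w K)) \<and> (\<forall>K. K \<notin> \<K> \<longrightarrow> w K = (\<lambda>_. 0))}"

definition Ph :: "(real^'n) set set \<Rightarrow> nat \<Rightarrow> 'n sfam set" where
  "Ph \<K> r2 = {g. (\<forall>K\<in>\<K>. polyfun r2 (g K)) \<and> (\<forall>K. K \<notin> \<K> \<longrightarrow> g K = (\<lambda>_. 0))}"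

definition Ph0 :: "(real^'n) set set \<Rightarrow> nat \<Rightarrow> 'n sfam set" where
  "Ph0 \<K> r2 = {g \<in> Ph \<K> r2. (\<Sum>K\<in>\<K>. integral K (g K)) = 0}"

definition vip :: "(real^'n) set set \<Rightarrow> 'n vfam \<Rightarrow> 'n vfam \<Rightarrow> real" where
  "vip \<K> u w = (\<Sum>K\<in>\<K>. integral K (\<lambda>x. u K x \<bullet> w K x))"

definition sip :: "(real^'n) set set \<Rightarrow> 'n sfam \<Rightarrow> 'n sfam \<Rightarrow> real" where
  "sip \<K> g q = (\<Sum>K\<in>\<K>. integral K (\<lambda>x. g K x * q K x))"

definition fip :: "(real^'n) set set \<Rightarrow> (real^'n \<Rightarrow> real^'n) \<Rightarrow> 'n vfam \<Rightarrow> real" where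
  "fip \<K> f w = (\<Sum>K\<in>\<K>. integral K (\<lambda>x. f x \<bullet> w K x))"

definition L2sq :: "(real^'n) set \<Rightarrow> (real^'n \<Rightarrow> real^'n) \<Rightarrow> real" where
  "L2sq Om f = integral Om (\<lambda>x. (norm (f x))\<^sup>2)"

definition in_L2 :: "(real^'n) set \<Rightarrow> (real^'n \<Rightarrow> real^'n) \<Rightarrow> bool" where
  "in_L2 Om f \<longleftrightarrow> f measurable_on Om \<and> (\<lambda>x. (norm (f x))\<^sup>2) integrable_on Om"

definition Aeps :: "(real^'n) set \<Rightarrow> (real^'n) set set \<Rightarrow> real \<Rightarrow> real \<Rightarrow> 'n vfam \<Rightarrow> 'n vfam \<Rightarrow> real" where
  "Aeps Om \<K> \<sigma> \<epsilon> u w =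
     (\<Sum>K\<in>\<K>. integral K (gradip (u K) (w K)))
   + (1/2) * (\<Sum>(K1,K2)\<in>int_faces \<K>. (let F = fc K1 K2; n = onormal K1 F in
        surf_int F (\<lambda>x. - (((1/2) *\<^sub>R (gradn (u K1) n x + gradn (u K2) n x)) \<bullet> (w K1 x - w K2 x))
                      + \<epsilon> * (((1/2) *\<^sub>R (gradn (w K1) n x + gradn (w K2) n x)) \<bullet> (u K1 x - u K2 x))
                      + \<sigma> / hF F * ((u K1 x - u K2 x) \<bullet> (w K1 x - w K2 x)))))
   + (\<Sum>(K,F)\<in>bnd_faces Om \<K>. (let n = onormal K F in
        surf_int F (\<lambda>x. - (gradn (u K) n x \<bullet> w K x) + \<epsilon> * (gradn (w K) n x \<bullet> u K x)
                      + \<sigma> / hF F * (u K x \<bullet> w K x))))"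

definition dGsq :: "(real^'n) set \<Rightarrow> (real^'n) set set \<Rightarrow> real \<Rightarrow> 'n vfam \<Rightarrow> real" where
  "dGsq Om \<K> \<sigma> w =
     (\<Sum>K\<in>\<K>. integral K (gradip (w K) (w K)))
   + (1/2) * (\<Sum>(K1,K2)\<in>int_faces \<K>. (let F = fc K1 K2 in
        \<sigma> / hF F * surf_int F (\<lambda>x. (norm (w K1 x - w K2 x))\<^sup>2)))
   + (\<Sum>(K,F)\<in>bnd_faces Om \<K>. \<sigma> / hF F * surf_int F (\<lambda>x. (norm (w K x))\<^sup>2))"

definition bform :: "(real^'n) set set \<Rightarrow> 'n vfam \<Rightarrow> 'n sfam \<Rightarrow> real" where
  "bform \<K> w g =
     - (\<Sum>K\<in>\<K>. integral K (\<lambda>x. w K x \<bullet> sgrad (g K) x))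
   + (1/2) * (\<Sum>(K1,K2)\<in>int_faces \<K>. (let F = fc K1 K2; n = onormal K1 F in
        surf_int F (\<lambda>x. (((1/2) *\<^sub>R (w K1 x + w K2 x)) \<bullet> n) * (g K1 x - g K2 x))))"

definition Asip :: "(real^'n) set set \<Rightarrow> real \<Rightarrow> 'n sfam \<Rightarrow> 'n sfam \<Rightarrow> real" where
  "Asip \<K> \<sigma>t v g =
     (\<Sum>K\<in>\<K>. integral K (\<lambda>x. sgrad (v K) x \<bullet> sgrad (g K) x))
   - (1/2) * (\<Sum>(K1,K2)\<in>int_faces \<K>. (let F = fc K1 K2; n = onormal K1 F in
        surf_int F (\<lambda>x. (((1/2) *\<^sub>R (sgrad (v K1) x + sgrad (v K2) x)) \<bullet> n) * (g K1 x - g K2 x)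
                      + (((1/2) *\<^sub>R (sgrad (g K1) x + sgrad (g K2) x)) \<bullet> n) * (v K1 x - v K2 x))))
   + (1/2) * (\<Sum>(K1,K2)\<in>int_faces \<K>. (let F = fc K1 K2 in
        \<sigma>t / hF F * surf_int F (\<lambda>x. (v K1 x - v K2 x) * (g K1 x - g K2 x))))"

definition sdGsq :: "(real^'n) set set \<Rightarrow> real \<Rightarrow> 'n sfam \<Rightarrow> real" where
  "sdGsq \<K> \<sigma>t g =
     (\<Sum>K\<in>\<K>. integral K (\<lambda>x. (norm (sgrad (g K) x))\<^sup>2))
   + (1/2) * (\<Sum>(K1,K2)\<in>int_faces \<K>. (let F = fc K1 K2 in
        \<sigma>t / hF F * surf_int F (\<lambda>x. (g K1 x - g K2 x)\<^sup>2)))"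

text \<open>Convective form A_c(theta; z, phi, w). The upwind term over the inflow part of
the boundary of each element K is the sum over the faces of K: interior faces
(K,K') (with n_K = n_F, exterior trace from K') and boundary faces (exterior trace 0).\<close>
definition Ac :: "(real^'n) set \<Rightarrow> (real^'n) set set \<Rightarrow> 'n vfam \<Rightarrow> 'n vfam \<Rightarrow> 'n vfam \<Rightarrow> 'n vfam \<Rightarrow> real" where
  "Ac Om \<K> \<theta> z \<phi> w =
     (\<Sum>K\<in>\<K>. integral K (\<lambda>x. convd (z K) (\<phi> K) x \<bullet> w K x + (1/2) * vdiv (z K) x * (\<phi> K x \<bullet> w K x)))
   - (1/2) * ( (1/2) * (\<Sum>(K1,K2)\<in>int_faces \<K>. (let F = fc K1 K2; n = onormal K1 F in
        surf_int F (\<lambda>x. ((z K1 x - z K2 x) \<bullet> n) * ((1/2) * (\<phi> K1 x \<bullet> w K1 x + \<phi> K2 x \<bullet> w K2 x)))))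
     + (\<Sum>(K,F)\<in>bnd_faces Om \<K>. (let n = onormal K F in
        surf_int F (\<lambda>x. (z K x \<bullet> n) * (\<phi> K x \<bullet> w K x)))) )
   + (\<Sum>(K1,K2)\<in>int_faces \<K>. (let F = fc K1 K2; n = onormal K1 F in
        surf_int F (\<lambda>x. if ((1/2) *\<^sub>R (\<theta> K1 x + \<theta> K2 x)) \<bullet> n < 0
                        then \<bar>((1/2) *\<^sub>R (z K1 x + z K2 x)) \<bullet> n\<bar> * ((\<phi> K1 x - \<phi> K2 x) \<bullet> w K1 x)
                        else 0)))
   + (\<Sum>(K,F)\<in>bnd_faces Om \<K>. (let n = onormal K F in
        surf_int F (\<lambda>x. if \<theta> K x \<bullet> n < 0 then \<bar>z K x \<bullet> n\<bar> * (\<phi> K x \<bullet> w K x) else 0)))"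

definition liftR_rhs :: "(real^'n) set \<Rightarrow> (real^'n) set set \<Rightarrow> 'n vfam \<Rightarrow> 'n sfam \<Rightarrow> real" where
  "liftR_rhs Om \<K> w g =
     (1/2) * (\<Sum>(K1,K2)\<in>int_faces \<K>. (let F = fc K1 K2; n = onormal K1 F in
        surf_int F (\<lambda>x. ((1/2) * (g K1 x + g K2 x)) * ((w K1 x - w K2 x) \<bullet> n))))
   + (\<Sum>(K,F)\<in>bnd_faces Om \<K>. (let n = onormal K F in
        surf_int F (\<lambda>x. g K x * (w K x \<bullet> n))))"

definition liftG_rhs :: "(real^'n) set set \<Rightarrow> 'n sfam \<Rightarrow> 'n vfam \<Rightarrow> real" where
  "liftG_rhs \<K> g w =
     (1/2) * (\<Sum>(K1,K2)\<in>int_faces \<K>. (let F = fc K1 K2; n = onormal K1 F in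
        surf_int F (\<lambda>x. (((1/2) *\<^sub>R (w K1 x + w K2 x)) \<bullet> n) * (g K1 x - g K2 x))))"

text \<open>R_h([w]) (resp. G_h([g])) is the unique element of P_h (resp. M_h) representing
the above functional; this characterises Rh = sum of r_F and Gh = sum of g_F.\<close>
definition is_Rh :: "(real^'n) set \<Rightarrow> (real^'n) set set \<Rightarrow> nat \<Rightarrow> nat \<Rightarrow> ('n vfam \<Rightarrow> 'n sfam) \<Rightarrow> bool" where
  "is_Rh Om \<K> r1 r2 Rh \<longleftrightarrow> (\<forall>w\<in>Mh \<K> r1. Rh w \<in> Ph \<K> r2 \<and>
       (\<forall>g\<in>Ph \<K> r2. sip \<K> (Rh w) g = liftR_rhs Om \<K> w g))"

definition is_Gh :: "(real^'n) set set \<Rightarrow> nat \<Rightarrow> nat \<Rightarrow> ('n sfam \<Rightarrow> 'n vfam) \<Rightarrow> bool" where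
  "is_Gh \<K> r1 r2 Gh \<longleftrightarrow> (\<forall>g\<in>Ph \<K> r2. Gh g \<in> Mh \<K> r1 \<and>
       (\<forall>w\<in>Mh \<K> r1. vip \<K> (Gh g) w = liftG_rhs \<K> g w))"

definition vjump_h :: "(real^'n) set \<Rightarrow> (real^'n) set set \<Rightarrow> 'n vfam \<Rightarrow> real" where
  "vjump_h Om \<K> w =
     (1/2) * (\<Sum>(K1,K2)\<in>int_faces \<K>. (let F = fc K1 K2 in
        1 / hF F * surf_int F (\<lambda>x. (norm (w K1 x - w K2 x))\<^sup>2)))
   + (\<Sum>(K,F)\<in>bnd_faces Om \<K>. 1 / hF F * surf_int F (\<lambda>x. (norm (w K x))\<^sup>2))"

definition sjump_h :: "(real^'n) set set \<Rightarrow> 'n sfam \<Rightarrow> real" where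
  "sjump_h \<K> g =
     (1/2) * (\<Sum>(K1,K2)\<in>int_faces \<K>. (let F = fc K1 K2 in
        1 / hF F * surf_int F (\<lambda>x. (g K1 x - g K2 x)\<^sup>2)))"

definition beta :: "real \<Rightarrow> real \<Rightarrow> real \<Rightarrow> real" where
  "beta \<gamma> \<eta> t = \<gamma> * exp (- \<eta> * t)"

definition qr :: "real \<Rightarrow> real \<Rightarrow> real \<Rightarrow> nat \<Rightarrow> (nat \<Rightarrow> ('n::finite) vfam) \<Rightarrow> 'n vfam" where
  "qr \<tau> \<gamma> \<eta> n \<phi> = (\<lambda>K x. \<tau> *\<^sub>R (\<Sum>j=1..n. beta \<gamma> \<eta> (real n * \<tau> - real j * \<tau>) *\<^sub>R \<phi> j K x))"

definition omega :: "real \<Rightarrow> real" where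
  "omega \<epsilon> = (if \<epsilon> = 1 then 1 else 1/2)"

definition Sh :: "real \<Rightarrow> real \<Rightarrow> real \<Rightarrow> real \<Rightarrow> real \<Rightarrow> ('n vfam \<Rightarrow> 'n sfam) \<Rightarrow> (nat \<Rightarrow> ('n::finite) vfam) \<Rightarrow> nat \<Rightarrow> 'n sfam" where
  "Sh \<delta> \<mu> \<tau> \<gamma> \<eta> Rh ut m = (\<lambda>K x.
      \<delta> * \<mu> * (\<Sum>i=1..m. vdiv (ut i K) x - Rh (ut i) K x)
    + \<delta> * \<tau> * (\<Sum>i=1..m. \<Sum>j=1..i. beta \<gamma> \<eta> (real i * \<tau> - real j * \<tau>) * (vdiv (ut j K) x - Rh (ut j) K x)))"

definition \<xi>h :: "real \<Rightarrow> real \<Rightarrow> real \<Rightarrow> real \<Rightarrow> real \<Rightarrow> ('n vfam \<Rightarrow> 'n sfam) \<Rightarrow> (nat \<Rightarrow> ('n::finite) vfam) \<Rightarrow> (nat \<Rightarrow> 'n sfam) \<Rightarrow> nat \<Rightarrow> 'n sfam" where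
  "\<xi>h \<delta> \<mu> \<tau> \<gamma> \<eta> Rh ut p m = (\<lambda>K x. p m K x + Sh \<delta> \<mu> \<tau> \<gamma> \<eta> Rh ut m K x)"

definition dg_scheme ::
  "(real^'n) set \<Rightarrow> (real^'n) set set \<Rightarrow> nat \<Rightarrow> nat \<Rightarrow> real \<Rightarrow> real \<Rightarrow> real \<Rightarrow> real
   \<Rightarrow> real \<Rightarrow> real \<Rightarrow> real \<Rightarrow> real \<Rightarrow> nat \<Rightarrow> (real^'n \<Rightarrow> real^'n) \<Rightarrow> (nat \<Rightarrow> real^'n \<Rightarrow> real^'n)
   \<Rightarrow> (nat \<Rightarrow> ('n::finite) vfam) \<Rightarrow> (nat \<Rightarrow> 'n vfam) \<Rightarrow> (nat \<Rightarrow> 'n sfam) \<Rightarrow> (nat \<Rightarrow> 'n sfam) \<Rightarrow> bool" where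
  "dg_scheme Om \<K> r1 r2 \<epsilon> \<sigma> \<sigma>t \<delta> \<mu> \<gamma> \<eta> T N u0 f ut u v p \<longleftrightarrow>
    (let \<tau> = T / real N in
      p 0 = (\<lambda>K x. 0) \<and> v 0 = (\<lambda>K x. 0)
    \<and> u 0 \<in> Mh \<K> r1
    \<and> (\<forall>K\<in>\<K>. \<forall>q. vpolyfun r1 q \<longrightarrow> integral K (\<lambda>x. u0 x \<bullet> q x) = integral K (\<lambda>x. u 0 K x \<bullet> q x))
    \<and> (\<forall>n\<in>{1..N}.
         ut n \<in> Mh \<K> r1 \<and> v n \<in> Ph0 \<K> r2 \<and> p n \<in> Ph \<K> r2 \<and> u n \<in> Mh \<K> r1
       \<and> (\<forall>w\<in>Mh \<K> r1.
            vip \<K> (ut n) w + \<tau> * Ac Om \<K> (u (n-1)) (u (n-1)) (ut n) w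
            + \<tau> * \<mu> * Aeps Om \<K> \<sigma> \<epsilon> (ut n) w + \<tau> * Aeps Om \<K> \<sigma> \<epsilon> (qr \<tau> \<gamma> \<eta> n ut) w
          = vip \<K> (u (n-1)) w + \<tau> * bform \<K> w (p (n-1)) + \<tau> * fip \<K> (f n) w)
       \<and> (\<forall>g\<in>Ph0 \<K> r2. Asip \<K> \<sigma>t (v n) g = - (1/\<tau>) * bform \<K> (ut n) g)
       \<and> (\<forall>g\<in>Ph \<K> r2. sip \<K> (p n) g = sip \<K> (p (n-1)) g + sip \<K> (v n) g
            - \<delta> * \<mu> * bform \<K> (ut n) g - \<delta> * bform \<K> (qr \<tau> \<gamma> \<eta> n ut) g)
       \<and> (\<forall>w\<in>Mh \<K> r1. vip \<K> (u n) w = vip \<K> (ut n) w + \<tau> * bform \<K> w (v n))))"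

end

theory Submission
  imports Defs "HOL-Library.Function_Algebras"
begin

text \<open>
  Testing the momentum step with \<open>ut n\<close> and the correction step with \<open>u n\<close>, \<open>ut n\<close> and the
  discrete gradient of \<open>v n\<close> gives an energy identity in which the increment \<open>\<xi>\<^sup>n - \<xi>\<^sup>n\<^sup>-\<^sup>1 = v\<^sup>n\<close> telescopes
  the pressure contribution. The convective form is nonnegative and \<open>b\<close> is represented by
  \<open>D = div - R\<close>, both by the divergence theorem on each convex polyhedral element; that theorem is
  obtained by Fubini along a coordinate direction, because almost every line in this direction avoids
  the intersections of the finitely many bounding hyperplanes, so that at each end point of its chord
  the mesh looks like two half balls glued along exactly one face.

  The memory term needs continuity of the viscous form with a constant depending on the dimension only.
  It holds since the consistency terms are lifts \<open>R\<close> of componentwise jumps, and (A1) bounds the norm of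
  \<open>R\<close> by the penalty. The cross term between \<open>S\<close> and the memory part \<open>Q\<close> of its increment is of the right
  order because, for the exponential kernel, \<open>Q\<close> is \<open>\<tau>\<close> times a combination of accumulated sums
  controlled by \<open>S\<close>. A discrete Gronwall inequality finishes the proof.\<close>

section \<open>Function spaces and semi-inner products\<close>

text \<open>The two witnesses of the claim are fixed before the mesh, the degrees, the penalties,
  the lift bounds and \<open>\<delta>\<close>, so no estimate may deteriorate with any of these. The
  energy sees \<open>S\<close> only through \<open>\<tau> / (\<delta> * \<mu>)\<close> times its
  squared norm. A direct Cauchy-Schwarz estimate of the cross term against the dissipation therefore
  lacks one factor \<open>\<tau>\<close>, and summation over N steps would not close; the rewriting
  of \<open>Q\<close> supplies this factor together with the matching \<open>1 / \<delta>\<close>.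
  The viscous form is measured in the dG norm, which already contains the penalty, so that
  \<open>\<sigma>\<close> enters only through its lower bound. On the geometric side, surface
  integrals are defined by an arbitrarily chosen chart and interior faces are plain intersections of
  closures, possibly parts of larger facets. This is why the divergence theorem works with the local
  picture at almost every boundary point and not with the facial structure of the elements.\<close>

instantiation "fun" :: (type, real_vector) real_vector
begin

definition scaleR_fun :: "real \<Rightarrow> ('a \<Rightarrow> 'b) \<Rightarrow> 'a \<Rightarrow> 'b" where
  "scaleR_fun c f = (\<lambda>x. c *\<^sub>R f x)"

instance
  by standard (auto simp: scaleR_fun_def plus_fun_def scaleR_add_right scaleR_add_left)

end

lemma scaleR_fun_apply [simp]: "(c *\<^sub>R f) x = c *\<^sub>R f x"
  by (simp add: scaleR_fun_def)

lemma sum_fun_apply: "(\<Sum>i\<in>I. f i) x = (\<Sum>i\<in>I. f i x)"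
  by (induction I rule: infinite_finite_induct) auto

text \<open>Semidefiniteness is the right level: the gradient part and the jump part of the dG
  product have kernels of their own. The laws are confined to a subspace because additivity of the
  integrals rests on the regularity of the integrands. Instances are the velocity and pressure
  products, the two parts of the dG product, their sum, and \<open>Asip\<close>.\<close>

locale semi_inner =
  fixes V :: "'a::real_vector set" and ip :: "'a \<Rightarrow> 'a \<Rightarrow> real"
  assumes subspace: "subspace V"
    and add_left: "x \<in> V \<Longrightarrow> y \<in> V \<Longrightarrow> z \<in> V \<Longrightarrow> ip (x + y) z = ip x z + ip y z"
    and scale_left: "x \<in> V \<Longrightarrow> z \<in> V \<Longrightarrow> ip (c *\<^sub>R x) z = c * ip x z"
    and commute: "x \<in> V \<Longrightarrow> y \<in> V \<Longrightarrow> ip x y = ip y x"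
    and nonneg: "x \<in> V \<Longrightarrow> 0 \<le> ip x x"
begin

definition nrm :: "'a \<Rightarrow> real" where "nrm x = sqrt (ip x x)"

lemma nrm_sq: "x \<in> V \<Longrightarrow> (nrm x)\<^sup>2 = ip x x"
  by (simp add: nrm_def nonneg)

lemma nrm_nonneg: "x \<in> V \<Longrightarrow> 0 \<le> nrm x"
  by (simp add: nrm_def nonneg)

lemmas closed = subspace_add[OF subspace] subspace_scale[OF subspace] subspace_0[OF subspace]
  subspace_diff[OF subspace] subspace_sum[OF subspace]

lemma add_right: "x \<in> V \<Longrightarrow> y \<in> V \<Longrightarrow> z \<in> V \<Longrightarrow> ip x (y + z) = ip x y + ip x z"
  using add_left commute closed by metis

lemma scale_right: "x \<in> V \<Longrightarrow> z \<in> V \<Longrightarrow> ip x (c *\<^sub>R z) = c * ip x z"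
  using scale_left commute closed by metis

lemma diff_left: "x \<in> V \<Longrightarrow> y \<in> V \<Longrightarrow> z \<in> V \<Longrightarrow> ip (x - y) z = ip x z - ip y z"
  using add_left[of x "(-1) *\<^sub>R y" z] scale_left[of y z "-1"] closed(2)[of y "-1"] by simp

lemma diff_right: "x \<in> V \<Longrightarrow> y \<in> V \<Longrightarrow> z \<in> V \<Longrightarrow> ip x (y - z) = ip x y - ip x z"
  using diff_left commute closed by metis

lemma zero_left: "z \<in> V \<Longrightarrow> ip 0 z = 0"
  using scale_left[of 0 z 0] closed(3) by simp

lemma sum_left:
  assumes "z \<in> V" "\<And>i. i \<in> I \<Longrightarrow> x i \<in> V"
  shows "ip (\<Sum>i\<in>I. x i) z = (\<Sum>i\<in>I. ip (x i) z)"
  using assms(2)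
proof (induction I rule: infinite_finite_induct)
  case (insert i I)
  then show ?case using assms(1) closed(5)[of I x] by (simp add: add_left)
qed (use assms(1) zero_left in auto)

lemma ip_add_self: "x \<in> V \<Longrightarrow> y \<in> V \<Longrightarrow> ip (x + y) (x + y) = ip x x + 2 * ip x y + ip y y"
  by (simp add: add_left add_right closed commute[of y x])

lemma ip_diff_self: "x \<in> V \<Longrightarrow> y \<in> V \<Longrightarrow> ip (x - y) (x - y) = ip x x - 2 * ip x y + ip y y"
  by (simp add: diff_left diff_right closed commute[of y x])

text \<open>The usual projection argument divides by \<open>ip y y\<close>. If this vanishes,
  \<open>ip (x + t *\<^sub>R y) (x + t *\<^sub>R y)\<close> is affine in t and would reach -1 unless
  its slope is zero.\<close>

lemma Cauchy_Schwarz_sq: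
  assumes "x \<in> V" "y \<in> V"
  shows "(ip x y)\<^sup>2 \<le> ip x x * ip y y"
proof (cases "ip y y = 0")
  case True
  have "ip x y = 0"
  proof (rule ccontr)
    assume n: "ip x y \<noteq> 0"
    define t where "t = - (ip x x + 1) / (2 * ip x y)"
    have "0 \<le> ip (x + t *\<^sub>R y) (x + t *\<^sub>R y)"
      using assms by (intro nonneg closed)
    also have "\<dots> = ip x x + 2 * t * ip x y"
      using assms True by (simp add: ip_add_self closed scale_left scale_right)
    also have "\<dots> = -1" using n by (simp add: t_def field_simps)
    finally show False by simp
  qed
  then show ?thesis using True by simp
next
  case False
  define c where "c = ip y y"
  define a where "a = ip x y"
  have c: "c > 0" using nonneg[OF assms(2)] False by (simp add: c_def)
  have "0 \<le> ip (x - (a / c) *\<^sub>R y) (x - (a / c) *\<^sub>R y)"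
    using assms by (intro nonneg closed)
  also have "\<dots> = ip x x - 2 * (a / c) * a + (a / c)\<^sup>2 * c"
    using assms by (simp add: ip_diff_self closed scale_left scale_right a_def c_def power2_eq_square)
  also have "\<dots> = ip x x - a\<^sup>2 / c" using c by (simp add: power2_eq_square field_simps)
  finally have "a\<^sup>2 / c \<le> ip x x" by simp
  then show ?thesis using c by (simp add: field_simps a_def c_def)
qed

lemma Cauchy_Schwarz:
  assumes "x \<in> V" "y \<in> V"
  shows "\<bar>ip x y\<bar> \<le> nrm x * nrm y"
proof -
  have "sqrt ((ip x y)\<^sup>2) \<le> sqrt (ip x x * ip y y)"
    using Cauchy_Schwarz_sq[OF assms] real_sqrt_le_mono by blast
  then show ?thesis by (simp add: nrm_def real_sqrt_mult)
qed

lemma nrm_triangle: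
  assumes "x \<in> V" "y \<in> V"
  shows "nrm (x + y) \<le> nrm x + nrm y"
proof -
  have "(nrm (x + y))\<^sup>2 \<le> (nrm x + nrm y)\<^sup>2"
    using assms Cauchy_Schwarz[OF assms] by (simp add: nrm_sq closed ip_add_self power2_sum)
  then show ?thesis using assms by (meson add_nonneg_nonneg nrm_nonneg power2_le_imp_le)
qed

lemma nrm_scale: "x \<in> V \<Longrightarrow> nrm (c *\<^sub>R x) = \<bar>c\<bar> * nrm x"
proof -
  assume x: "x \<in> V"
  have "ip (c *\<^sub>R x) (c *\<^sub>R x) = c\<^sup>2 * ip x x"
    using x by (simp add: scale_left scale_right closed power2_eq_square)
  then show ?thesis by (simp add: nrm_def real_sqrt_mult)
qed

lemma nrm_zero: "nrm 0 = 0"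
  using zero_left[OF closed(3)] by (simp add: nrm_def)

lemma nrm_sum:
  assumes "\<And>i. i \<in> I \<Longrightarrow> x i \<in> V"
  shows "nrm (\<Sum>i\<in>I. x i) \<le> (\<Sum>i\<in>I. nrm (x i))"
  using assms
proof (induction I rule: infinite_finite_induct)
  case (insert i I)
  have "nrm (x i + sum x I) \<le> nrm (x i) + nrm (sum x I)"
    using insert by (intro nrm_triangle closed) auto
  then show ?case using insert by simp
qed (use nrm_zero in auto)

text \<open>Parallelogram law with the square of the difference dropped.\<close>

lemma ip_add_self_le: "x \<in> V \<Longrightarrow> y \<in> V \<Longrightarrow> ip (x + y) (x + y) \<le> 2 * ip x x + 2 * ip y y"
  using nonneg[OF closed(4)[of x y]] by (simp add: ip_add_self ip_diff_self)

lemma ip_diff_self_le: "x \<in> V \<Longrightarrow> y \<in> V \<Longrightarrow> ip (x - y) (x - y) \<le> 2 * ip x x + 2 * ip y y"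
  using nonneg[OF closed(1)[of x y]] by (simp add: ip_add_self ip_diff_self)

end

section \<open>Polynomials\<close>

definition monom_fun :: "('n::finite \<Rightarrow> nat) \<Rightarrow> real^'n \<Rightarrow> real" where
  "monom_fun \<alpha> x = (\<Prod>i\<in>UNIV. (x$i) ^ (\<alpha> i))"

lemma finite_multiindices: "finite {\<alpha>::'n::finite \<Rightarrow> nat. sum \<alpha> UNIV \<le> r}"
proof (rule finite_subset)
  show "{\<alpha>::'n \<Rightarrow> nat. sum \<alpha> UNIV \<le> r} \<subseteq> Pi\<^sub>E UNIV (\<lambda>_. {..r})"
  proof (clarsimp simp: PiE_def)
    fix \<alpha> :: "'n \<Rightarrow> nat" and i assume "sum \<alpha> UNIV \<le> r"
    moreover have "\<alpha> i \<le> sum \<alpha> UNIV" by (rule member_le_sum) auto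
    ultimately show "\<alpha> i \<le> r" by simp
  qed
qed (auto intro: finite_PiE)

lemma polyfun_iff: "polyfun r p \<longleftrightarrow> (\<exists>c. p = (\<lambda>x. \<Sum>\<alpha>\<in>{\<alpha>. sum \<alpha> UNIV \<le> r}. c \<alpha> * monom_fun \<alpha> x))"
  by (auto simp: polyfun_def monom_fun_def fun_eq_iff)

lemma polyfun_zero [simp]: "polyfun r (\<lambda>x. 0)"
  unfolding polyfun_iff by (rule exI[of _ "\<lambda>_. 0"]) simp

lemma polyfun_add:
  assumes "polyfun r p" "polyfun r q" shows "polyfun r (\<lambda>x. p x + q x)"
proof -
  obtain c c' where "p = (\<lambda>x. \<Sum>\<alpha>\<in>{\<alpha>. sum \<alpha> UNIV \<le> r}. c \<alpha> * monom_fun \<alpha> x)"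
    "q = (\<lambda>x. \<Sum>\<alpha>\<in>{\<alpha>. sum \<alpha> UNIV \<le> r}. c' \<alpha> * monom_fun \<alpha> x)"
    using assms unfolding polyfun_iff by blast
  then show ?thesis unfolding polyfun_iff
    by (intro exI[of _ "\<lambda>\<alpha>. c \<alpha> + c' \<alpha>"]) (simp add: sum.distrib distrib_right)
qed

lemma polyfun_cmult:
  assumes "polyfun r p" shows "polyfun r (\<lambda>x. a * p x)"
proof -
  obtain c where "p = (\<lambda>x. \<Sum>\<alpha>\<in>{\<alpha>. sum \<alpha> UNIV \<le> r}. c \<alpha> * monom_fun \<alpha> x)"
    using assms unfolding polyfun_iff by blast
  then show ?thesis unfolding polyfun_iff
    by (intro exI[of _ "\<lambda>\<alpha>. a * c \<alpha>"]) (simp add: sum_distrib_left mult.assoc)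
qed

lemma polyfun_sum:
  "(\<And>i. i \<in> I \<Longrightarrow> polyfun r (p i)) \<Longrightarrow> polyfun r (\<lambda>x. \<Sum>i\<in>I. p i x)"
  by (induction I rule: infinite_finite_induct) (auto intro: polyfun_add)

lemma polyfun_monom:
  assumes "sum \<alpha> UNIV \<le> r" shows "polyfun r (monom_fun \<alpha>)"
  unfolding polyfun_iff
proof (intro exI[of _ "\<lambda>\<beta>. if \<beta> = \<alpha> then 1 else 0"] ext)
  fix x
  have "(\<Sum>\<beta>\<in>{\<beta>. sum \<beta> UNIV \<le> r}. (if \<beta> = \<alpha> then 1 else 0) * monom_fun \<beta> x)
    = (\<Sum>\<beta>\<in>{\<beta>. sum \<beta> UNIV \<le> r}. if \<beta> = \<alpha> then monom_fun \<beta> x else 0)"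
    by (rule sum.cong) auto
  also have "\<dots> = monom_fun \<alpha> x" using assms by (subst sum.delta[OF finite_multiindices]) simp
  finally show "monom_fun \<alpha> x = (\<Sum>\<beta>\<in>{\<beta>. sum \<beta> UNIV \<le> r}. (if \<beta> = \<alpha> then 1 else 0) * monom_fun \<beta> x)"
    by simp
qed

lemma polyfun_mono:
  assumes "polyfun r p" "r \<le> s" shows "polyfun s p"
proof -
  obtain c where p: "p = (\<lambda>x. \<Sum>\<alpha>\<in>{\<alpha>. sum \<alpha> UNIV \<le> r}. c \<alpha> * monom_fun \<alpha> x)"
    using assms unfolding polyfun_iff by blast
  show ?thesis unfolding p
    using assms(2) by (intro polyfun_sum polyfun_cmult polyfun_monom) auto
qed

text \<open>For \<open>\<alpha> i = 0\<close> the truncated exponent is not meaningful, but the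
  factor \<open>real (\<alpha> i)\<close> removes that term.\<close>

lemma monom_fun_has_derivative:
  "(monom_fun \<alpha> has_derivative
     (\<lambda>h. \<Sum>i\<in>UNIV. h$i * (real (\<alpha> i) * monom_fun (\<alpha>(i := \<alpha> i - 1)) x))) (at (x::real^'n::finite))"
proof -
  have "((\<lambda>x::real^'n. \<Prod>i\<in>UNIV. (x$i) ^ (\<alpha> i)) has_derivative
     (\<lambda>h. \<Sum>i\<in>UNIV. (real (\<alpha> i) * (h$i * (x$i) ^ (\<alpha> i - 1))) * (\<Prod>j\<in>UNIV - {i}. (x$j) ^ (\<alpha> j)))) (at x)"
    by (auto intro!: derivative_eq_intros has_derivative_prod bounded_linear_vec_nth
          bounded_linear.has_derivative[OF bounded_linear_vec_nth] simp: mult_ac)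
  moreover have "monom_fun (\<alpha>(i := \<alpha> i - 1)) x = (x$i) ^ (\<alpha> i - 1) * (\<Prod>j\<in>UNIV - {i}. (x$j) ^ (\<alpha> j))" for i
    by (simp add: monom_fun_def prod.remove[of UNIV i])
  moreover have "monom_fun \<alpha> = (\<lambda>x. \<Prod>i\<in>UNIV. (x$i) ^ (\<alpha> i))"
    by (simp add: monom_fun_def fun_eq_iff)
  ultimately show ?thesis by (simp add: mult_ac)
qed

text \<open>The coefficient functions are constructed explicitly to see the degree drop;
  \<open>polyfun_pd\<close> then identifies them with \<open>pd\<close>.\<close>

lemma polyfun_has_derivative:
  assumes "polyfun r (p :: real^'n::finite \<Rightarrow> real)"
  obtains p' where "\<And>i. polyfun (r - 1) (p' i)"
    "\<And>x. (p has_derivative (\<lambda>h. \<Sum>i\<in>UNIV. h$i * p' i x)) (at x)"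
proof -
  let ?A = "{\<alpha>. sum \<alpha> (UNIV::'n set) \<le> r}"
  obtain c where p: "p = (\<lambda>x. \<Sum>\<alpha>\<in>?A. c \<alpha> * monom_fun \<alpha> x)"
    using assms unfolding polyfun_iff by blast
  let ?p' = "\<lambda>i x. \<Sum>\<alpha>\<in>?A. c \<alpha> * (real (\<alpha> i) * monom_fun (\<alpha>(i := \<alpha> i - 1)) x)"
  show thesis
  proof (rule that[of ?p'])
    fix i
    show "polyfun (r - 1) (?p' i)"
    proof (rule polyfun_sum, rule polyfun_cmult)
      fix \<alpha> assume a: "\<alpha> \<in> ?A"
      show "polyfun (r - 1) (\<lambda>x. real (\<alpha> i) * monom_fun (\<alpha>(i := \<alpha> i - 1)) x)"
      proof (cases "\<alpha> i = 0")
        case False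
        have "sum (\<alpha>(i := \<alpha> i - 1)) UNIV = (\<alpha> i - 1) + sum \<alpha> (UNIV - {i})"
          by (simp add: sum.remove[of UNIV i])
        also have "\<dots> \<le> r - 1" using a False by (simp add: sum.remove[of UNIV i])
        finally show ?thesis by (intro polyfun_cmult polyfun_monom)
      qed simp
    qed
  next
    fix x
    have "(p has_derivative (\<lambda>h. \<Sum>\<alpha>\<in>?A. c \<alpha> *
        (\<Sum>i\<in>UNIV. h$i * (real (\<alpha> i) * monom_fun (\<alpha>(i := \<alpha> i - 1)) x)))) (at x)"
      unfolding p
      by (intro has_derivative_sum has_derivative_mult_right monom_fun_has_derivative)
    moreover have "(\<lambda>h::real^'n. \<Sum>\<alpha>\<in>?A. c \<alpha> * (\<Sum>i\<in>UNIV. h$i * (real (\<alpha> i) * monom_fun (\<alpha>(i := \<alpha> i - 1)) x)))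
      = (\<lambda>h. \<Sum>i\<in>UNIV. h$i * ?p' i x)"
      by (rule ext, simp add: sum_distrib_left, subst sum.swap) (simp add: mult_ac)
    ultimately show "(p has_derivative (\<lambda>h. \<Sum>i\<in>UNIV. h$i * ?p' i x)) (at x)" by simp
  qed
qed

lemma sum_axis_mult: "(\<Sum>i\<in>UNIV. axis j (1::real) $ i * f i) = f (j::'n::finite)"
proof -
  have "(\<Sum>i\<in>UNIV. axis j (1::real) $ i * f i) = (\<Sum>i\<in>UNIV. if i = j then f i else 0)"
    by (rule sum.cong) (auto simp: axis_def)
  then show ?thesis by simp
qed

lemma polyfun_pd:
  assumes "polyfun r (p :: real^'n::finite \<Rightarrow> real)"
  shows "polyfun (r - 1) (pd p j)"
    and "(p has_derivative (\<lambda>h. \<Sum>i\<in>UNIV. h$i * pd p i x)) (at x)"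
proof -
  obtain p' where p': "\<And>i. polyfun (r - 1) (p' i)"
    "\<And>x. (p has_derivative (\<lambda>h. \<Sum>i\<in>UNIV. h$i * p' i x)) (at x)"
    using polyfun_has_derivative[OF assms] by blast
  have pd: "pd p j x = p' j x" for j x
  proof -
    have "frechet_derivative p (at x) = (\<lambda>h. \<Sum>i\<in>UNIV. h$i * p' i x)"
      using frechet_derivative_at[OF p'(2)] by simp
    then show ?thesis unfolding pd_def by (simp add: sum_axis_mult)
  qed
  then have "pd p j = p' j" by (simp add: fun_eq_iff)
  then show "polyfun (r - 1) (pd p j)" using p'(1) by simp
  show "(p has_derivative (\<lambda>h. \<Sum>i\<in>UNIV. h$i * pd p i x)) (at x)"
    using p'(2) pd by simp
qed

lemma polyfun_continuous: "polyfun r p \<Longrightarrow> continuous_on S p"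
  by (meson continuous_at_imp_continuous_on has_derivative_continuous polyfun_pd(2))

lemma polyfun_real_polynomial_function:
  assumes "polyfun r (p :: real^'n::finite \<Rightarrow> real)" shows "real_polynomial_function p"
proof -
  obtain c where p: "p = (\<lambda>x. \<Sum>\<alpha>\<in>{\<alpha>. sum \<alpha> UNIV \<le> r}. c \<alpha> * monom_fun \<alpha> x)"
    using assms unfolding polyfun_iff by blast
  show ?thesis unfolding p monom_fun_def
    by (intro real_polynomial_function_sum finite_multiindices real_polynomial_function.intros(2,4)
        real_polynomial_function_prod real_polynomial_function_power
        real_polynomial_function.intros(1) bounded_linear_vec_nth finite_class.finite_UNIV)
qed

text \<open>On each line through a point of S the polynomial becomes univariate with infinitely many
  zeros. Members of the broken spaces are polynomials on the whole space, so vanishing on an element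
  has to be extended beyond it.\<close>

lemma polyfun_eq_0_if_open:
  assumes p: "polyfun r (p :: real^'n::finite \<Rightarrow> real)" and S: "open S" "S \<noteq> {}"
    and zero: "\<And>x. x \<in> S \<Longrightarrow> p x = 0"
  shows "p = (\<lambda>x. 0)"
proof
  fix z
  obtain x0 where x0: "x0 \<in> S" using S by blast
  define l where "l t = x0 + t *\<^sub>R (z - x0)" for t :: real
  have "polynomial_function l"
    unfolding l_def
    by (intro polynomial_function_add polynomial_function_const polynomial_function_mult
        polynomial_function_id[unfolded id_def])
  then have "real_polynomial_function (p \<circ> l)"
    using polyfun_real_polynomial_function[OF p] real_polynomial_function_compose by blast
  then obtain a n where a: "p \<circ> l = (\<lambda>t. \<Sum>i\<le>n. a i * t ^ i)"
    unfolding real_polynomial_function_iff_sum by blast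
  have "continuous_on UNIV l" unfolding l_def by (intro continuous_intros)
  then have "open (l -` S)" using S(1) by (simp add: open_vimage)
  moreover have "0 \<in> l -` S" using x0 by (simp add: l_def)
  ultimately obtain e where e: "e > 0" "ball 0 e \<subseteq> l -` S"
    unfolding open_contains_ball by blast
  have "{0<..<e} \<subseteq> {t. (\<Sum>i\<le>n. a i * t ^ i) = 0}"
  proof
    fix t assume "t \<in> {0<..<e}"
    then have "l t \<in> S" using e(2) by (auto simp: dist_real_def subset_iff)
    then have "(p \<circ> l) t = 0" using zero by simp
    then show "t \<in> {t. (\<Sum>i\<le>n. a i * t ^ i) = 0}" using a by simp
  qed
  then have "infinite {t. (\<Sum>i\<le>n. a i * t ^ i) = 0}"
    using e(1) infinite_Ioo[of 0 e] finite_subset by blast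
  then have "\<forall>i\<le>n. a i = 0"
    using polyfun_finite_roots[of a n] by blast
  then have "(p \<circ> l) 1 = 0" using a by simp
  then show "p z = 0" by (simp add: l_def)
qed

section \<open>Surface integrals in coordinate charts\<close>

lemma product_sigma_finite_lborel: "product_sigma_finite (\<lambda>_::'i. lborel :: real measure)"
  by (simp add: product_sigma_finite_def sigma_finite_lborel)

text \<open>Both measures agree on open boxes. The product form gives access to Fubini with one
  coordinate singled out.\<close>

lemma lborel_vec_eq:
  "(lborel :: (real^'n::finite) measure) = distr (\<Pi>\<^sub>M i\<in>UNIV. lborel) borel (\<lambda>f. \<chi> i. f i)"
proof (rule lborel_eqI)
  interpret product_sigma_finite "\<lambda>_::'n. lborel :: real measure" by (rule product_sigma_finite_lborel)
  have meas: "(\<lambda>f. \<chi> i. f i) \<in> borel_measurable (\<Pi>\<^sub>M i\<in>(UNIV::'n set). (lborel::real measure))"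
    by (subst borel_measurable_euclidean_space)
       (auto simp: Basis_vec_def inner_axis intro!: borel_measurable_scaleR)
  fix l u :: "real^'n" assume lu: "\<And>b. b \<in> Basis \<Longrightarrow> l \<bullet> b \<le> u \<bullet> b"
  then have lu': "l $ i \<le> u $ i" for i using lu[of "axis i 1"] by (auto simp: Basis_vec_def inner_axis)
  have "emeasure (distr (\<Pi>\<^sub>M i\<in>UNIV. lborel) borel (\<lambda>f. \<chi> i. f i)) (box l u)
     = emeasure (\<Pi>\<^sub>M i\<in>(UNIV::'n set). lborel) (Pi\<^sub>E UNIV (\<lambda>i. {l$i<..<u$i}))"
    by (subst emeasure_distr[OF meas])
       (auto intro!: arg_cong[where f="emeasure _"] simp: space_PiM mem_box_cart PiE_def Pi_iff)
  also have "\<dots> = (\<Prod>i\<in>UNIV. emeasure lborel {l$i<..<u$i})"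
    by (rule emeasure_PiM) auto
  also have "\<dots> = (\<Prod>i\<in>UNIV. ennreal (u$i - l$i))"
    using lu' by simp
  also have "\<dots> = ennreal (\<Prod>i\<in>UNIV. (u$i - l$i))"
    using lu' by (simp add: prod_ennreal)
  also have "(\<Prod>i\<in>UNIV. (u$i - l$i)) = (\<Prod>b\<in>Basis. (u - l) \<bullet> b)"
  proof -
    have B: "(Basis :: (real^'n) set) = range (\<lambda>i. axis i 1)" by (auto simp: Basis_vec_def)
    have "inj (\<lambda>i::'n. axis i (1::real))" by (auto simp: inj_on_def axis_eq_axis)
    then show ?thesis unfolding B by (simp add: prod.reindex inner_axis)
  qed
  finally show "emeasure (distr (\<Pi>\<^sub>M i\<in>UNIV. lborel) borel (\<lambda>f. \<chi> i. f i)) (box l u) =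
    ennreal (\<Prod>b\<in>Basis. (u - l) \<bullet> b)" .
qed simp

lemma vec_lambda_measurable_PiM:
  "(\<lambda>f. \<chi> i. f i) \<in> borel_measurable (\<Pi>\<^sub>M i\<in>(UNIV::'n::finite set). (lborel::real measure))"
  by (subst borel_measurable_euclidean_space) (auto simp: Basis_vec_def inner_axis)

lemma integrable_PiM_lborel_bounded:
  fixes h :: "('i \<Rightarrow> real) \<Rightarrow> real"
  assumes I: "finite I" and h: "h \<in> borel_measurable (\<Pi>\<^sub>M i\<in>I. lborel)"
    and B: "\<And>y. \<bar>h y\<bar> \<le> B" and supp: "\<And>y i. i \<in> I \<Longrightarrow> h y \<noteq> 0 \<Longrightarrow> \<bar>y i\<bar> \<le> R"
  shows "integrable (\<Pi>\<^sub>M i\<in>I. lborel) h"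
proof (rule integrableI_bounded_set[where A="Pi\<^sub>E I (\<lambda>_. {-R..R})" and B=B])
  interpret product_sigma_finite "\<lambda>_::'i. lborel :: real measure" by (rule product_sigma_finite_lborel)
  show "Pi\<^sub>E I (\<lambda>_. {-R..R}) \<in> sets (\<Pi>\<^sub>M i\<in>I. lborel)"
    using I by (intro sets_PiM_I_finite) auto
  have "emeasure (\<Pi>\<^sub>M i\<in>I. lborel) (Pi\<^sub>E I (\<lambda>_. {-R..R})) = (\<Prod>i\<in>I. emeasure lborel {-R..R})"
    using I by (intro emeasure_PiM) auto
  also have "\<dots> < \<infinity>"
    using I by (simp add: emeasure_lborel_Icc_eq power_less_top_ennreal less_top[symmetric] ennreal_power)
  finally show "emeasure (\<Pi>\<^sub>M i\<in>I. lborel) (Pi\<^sub>E I (\<lambda>_. {-R..R})) < \<infinity>" .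
  show "AE y in \<Pi>\<^sub>M i\<in>I. lborel. y \<in> Pi\<^sub>E I (\<lambda>_. {-R..R}) \<longrightarrow> norm (h y) \<le> B"
    using B by simp
  show "AE y in \<Pi>\<^sub>M i\<in>I. lborel. y \<notin> Pi\<^sub>E I (\<lambda>_. {-R..R}) \<longrightarrow> h y = 0"
  proof (rule AE_I2, intro impI)
    fix y :: "'i \<Rightarrow> real" assume y: "y \<in> space (\<Pi>\<^sub>M i\<in>I. lborel)" "y \<notin> Pi\<^sub>E I (\<lambda>_. {-R..R})"
    then obtain i where "i \<in> I" "y i \<notin> {-R..R}" unfolding space_PiM PiE_def Pi_def by blast
    then show "h y = 0" using supp[of i y] by fastforce
  qed
qed (use h in auto)

text \<open>A line in direction i meets the hyperplane in at most one point, so Tonelli makes the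
  hyperplane a null set.\<close>

lemma AE_PiM_lborel_hyperplane:
  assumes I: "finite (I::'i set)" and a: "i \<in> I" "a i \<noteq> 0"
  shows "AE y in \<Pi>\<^sub>M i\<in>I. (lborel::real measure). (\<Sum>i\<in>I. a i * y i) \<noteq> b"
proof -
  interpret product_sigma_finite "\<lambda>_::'i. lborel :: real measure" by (rule product_sigma_finite_lborel)
  let ?J = "I - {i}"
  have ins: "insert i ?J = I" using a by blast
  let ?M = "\<Pi>\<^sub>M i\<in>I. (lborel::real measure)"
  let ?N = "{y \<in> space ?M. (\<Sum>i\<in>I. a i * y i) = b}"
  have N: "?N \<in> sets ?M" by measurable
  have "emeasure ?M ?N = (\<integral>\<^sup>+y. indicator ?N y \<partial>?M)" using N by simp
  also have "\<dots> = (\<integral>\<^sup>+y. (\<integral>\<^sup>+t. indicator ?N (y(i := t)) \<partial>lborel) \<partial>(\<Pi>\<^sub>M i\<in>?J. lborel))"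
    using product_nn_integral_insert[of ?J i "indicator ?N"] I N unfolding ins by simp
  also have "\<dots> = (\<integral>\<^sup>+y. 0 \<partial>(\<Pi>\<^sub>M i\<in>?J. (lborel::real measure)))"
  proof (rule nn_integral_cong)
    fix y :: "'i \<Rightarrow> real"
    let ?t = "(b - (\<Sum>i\<in>?J. a i * y i)) / a i"
    have "(\<integral>\<^sup>+t. indicator ?N (y(i := t)) \<partial>lborel) \<le> (\<integral>\<^sup>+t. indicator {?t} t \<partial>(lborel::real measure))"
    proof (rule nn_integral_mono)
      fix t :: real
      have "(\<Sum>l\<in>I. a l * (y(i := t)) l) = a i * t + (\<Sum>l\<in>?J. a l * y l)"
        using I a by (simp add: sum.remove[of I i])
      then have "(\<Sum>l\<in>I. a l * (y(i := t)) l) = b \<Longrightarrow> t = ?t" using a by (simp add: field_simps)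
      then show "indicator ?N (y(i := t)) \<le> (indicator {?t} t :: ennreal)"
        by (auto simp: indicator_def)
    qed
    also have "\<dots> = 0" by simp
    finally show "(\<integral>\<^sup>+t. indicator ?N (y(i := t)) \<partial>lborel) = 0" by simp
  qed
  finally have "emeasure ?M ?N = 0" by simp
  then have "?N \<in> null_sets ?M" using N by auto
  then have "AE y in ?M. y \<notin> ?N" by (rule AE_not_in)
  then show ?thesis using AE_space by eventually_elim auto
qed

text \<open>The graph parametrisation hidden inside \<open>surf_int\<close>, with coordinate, normal
  and offset as parameters so that different charts can be compared.\<close>

definition emb :: "'n::finite \<Rightarrow> real^'n \<Rightarrow> real \<Rightarrow> ('n \<Rightarrow> real) \<Rightarrow> real^'n" where
  "emb k \<nu> c y = (\<chi> i. if i = k then (c - (\<Sum>j\<in>UNIV-{k}. \<nu>$j * y j)) / \<nu>$k else y i)"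

definition chart_int :: "'n::finite \<Rightarrow> real^'n \<Rightarrow> real \<Rightarrow> (real^'n) set \<Rightarrow> (real^'n \<Rightarrow> real) \<Rightarrow> real" where
  "chart_int k \<nu> c F g =
     (LINT y | (\<Pi>\<^sub>M j\<in>UNIV-{k}. lborel). indicator F (emb k \<nu> c y) * g (emb k \<nu> c y) / \<bar>\<nu>$k\<bar>)"

lemma emb_measurable: "emb k \<nu> c \<in> borel_measurable (\<Pi>\<^sub>M j\<in>UNIV-{k}. (lborel::real measure))"
proof (subst borel_measurable_euclidean_space, clarsimp simp: Basis_vec_def inner_axis emb_def)
  fix i :: 'a
  show "(\<lambda>y. if i = k then (c - (\<Sum>j\<in>UNIV - {k}. \<nu> $ j * y j)) / \<nu> $ k else y i)
    \<in> borel_measurable (Pi\<^sub>M (UNIV - {k}) (\<lambda>j. lborel))"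
    by (cases "i = k") auto
qed

text \<open>The upwind integrand of \<open>Ac\<close> is defined by cases; these two properties can
  be checked for it directly and suffice for integrability in every chart.\<close>

definition bddmeas :: "(real^'n::finite) set \<Rightarrow> (real^'n \<Rightarrow> real) \<Rightarrow> bool" where
  "bddmeas F g \<longleftrightarrow> g \<in> borel_measurable borel \<and> bounded (g ` F)"

lemma integrable_chart:
  assumes F: "compact F" and g: "bddmeas F g"
  shows "integrable (\<Pi>\<^sub>M j\<in>UNIV-{k}. lborel) (\<lambda>y. indicator F (emb k \<nu> c y) * g (emb k \<nu> c y) / b)"
proof -
  obtain B where B: "\<And>x. x \<in> F \<Longrightarrow> \<bar>g x\<bar> \<le> B"
    using g unfolding bddmeas_def bounded_iff by auto
  obtain R where R: "\<And>x. x \<in> F \<Longrightarrow> norm x \<le> R"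
    using compact_imp_bounded[OF F] unfolding bounded_iff by auto
  have Fb: "F \<in> sets borel" using F by (simp add: borel_compact)
  have "integrable (\<Pi>\<^sub>M j\<in>UNIV-{k}. lborel) (\<lambda>y. indicator F (emb k \<nu> c y) * g (emb k \<nu> c y))"
  proof (rule integrable_PiM_lborel_bounded[where B="\<bar>B\<bar>" and R=R])
    have "(\<lambda>x. indicator F x * g x) \<in> borel_measurable borel"
      using g Fb unfolding bddmeas_def by (intro borel_measurable_times borel_measurable_indicator) auto
    from measurable_compose[OF emb_measurable this]
    show "(\<lambda>y. indicator F (emb k \<nu> c y) * g (emb k \<nu> c y)) \<in> borel_measurable (\<Pi>\<^sub>M j\<in>UNIV-{k}. lborel)" .
    show "\<bar>indicator F (emb k \<nu> c y) * g (emb k \<nu> c y)\<bar> \<le> \<bar>B\<bar>" for y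
      using B[of "emb k \<nu> c y"] by (auto simp: indicator_def)
    fix y i assume i: "i \<in> UNIV - {k}" "indicator F (emb k \<nu> c y) * g (emb k \<nu> c y) \<noteq> 0"
    then have "norm (emb k \<nu> c y) \<le> R" using R by (auto simp: indicator_def split: if_splits)
    moreover have "\<bar>emb k \<nu> c y $ i\<bar> \<le> norm (emb k \<nu> c y)" by (rule component_le_norm_cart)
    ultimately show "\<bar>y i\<bar> \<le> R" using i by (simp add: emb_def)
  qed auto
  then show ?thesis by (rule integrable_divide)
qed

text \<open>\<open>surf_int\<close> selects its coordinate arbitrarily, whereas the divergence
  theorem in direction j needs the chart over the hyperplane orthogonal to that direction. With the
  remaining coordinates fixed by Fubini, the two charts differ by an affine substitution on the
  line.\<close>

lemma chart_int_change:
  assumes F: "compact F" and g: "bddmeas F g" and nz: "\<nu>$k \<noteq> 0" "\<nu>$j \<noteq> 0"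
  shows "chart_int k \<nu> c F g = chart_int j \<nu> c F g"
proof (cases "j = k")
  case False
  interpret product_sigma_finite "\<lambda>_::'a. lborel :: real measure" by (rule product_sigma_finite_lborel)
  let ?I = "UNIV - {j, k}"
  have ins: "insert j ?I = UNIV - {k}" "insert k ?I = UNIV - {j}" using False by auto
  define G where "G x = indicator F x * g x" for x
  have sumk: "(\<Sum>l\<in>UNIV-{k}. \<nu>$l * (y(j := s)) l) = \<nu>$j * s + (\<Sum>l\<in>?I. \<nu>$l * y l)" for y s
    using False unfolding ins(1)[symmetric] by simp
  have sumj: "(\<Sum>l\<in>UNIV-{j}. \<nu>$l * (y(k := s)) l) = \<nu>$k * s + (\<Sum>l\<in>?I. \<nu>$l * y l)" for y s
    using False unfolding ins(2)[symmetric] by simp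
  \<comment> \<open>Both parameters describe the point of the hyperplane whose k-th coordinate is t.
    The slope \<open>- \<nu>$k / \<nu>$j\<close> of the substitution turns the weight
    \<open>1 / \<bar>\<nu>$k\<bar>\<close> into \<open>1 / \<bar>\<nu>$j\<bar>\<close>.\<close>
  have *: "emb k \<nu> c (y(j := (c - (\<Sum>l\<in>?I. \<nu>$l * y l)) / \<nu>$j + (- \<nu>$k / \<nu>$j) * t)) = emb j \<nu> c (y(k := t))" for y t
    unfolding emb_def sumk sumj vec_eq_iff using nz False by (auto simp: field_simps)
  have intk: "integrable (\<Pi>\<^sub>M i\<in>insert j ?I. lborel) (\<lambda>y. G (emb k \<nu> c y) / \<bar>\<nu>$k\<bar>)"
    unfolding ins G_def by (rule integrable_chart[OF F g])
  have intj: "integrable (\<Pi>\<^sub>M i\<in>insert k ?I. lborel) (\<lambda>y. G (emb j \<nu> c y) / \<bar>\<nu>$j\<bar>)"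
    unfolding ins G_def by (rule integrable_chart[OF F g])
  have "chart_int k \<nu> c F g = (LINT y | (\<Pi>\<^sub>M i\<in>insert j ?I. lborel). G (emb k \<nu> c y) / \<bar>\<nu>$k\<bar>)"
    unfolding ins chart_int_def G_def ..
  also have "\<dots> = (LINT y | (\<Pi>\<^sub>M i\<in>?I. lborel). LINT s | lborel. G (emb k \<nu> c (y(j := s))) / \<bar>\<nu>$k\<bar>)"
    by (rule product_integral_insert[OF _ _ intk]) auto
  also have "\<dots> = (LINT y | (\<Pi>\<^sub>M i\<in>?I. lborel). LINT t | lborel. G (emb j \<nu> c (y(k := t))) / \<bar>\<nu>$j\<bar>)"
  proof (rule Bochner_Integration.integral_cong[OF refl])
    fix y :: "'a \<Rightarrow> real"
    have "(LINT s | lborel. G (emb k \<nu> c (y(j := s))) / \<bar>\<nu>$k\<bar>)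
      = \<bar>- \<nu>$k / \<nu>$j\<bar> *\<^sub>R (LINT t | lborel. G (emb k \<nu> c (y(j := (c - (\<Sum>l\<in>?I. \<nu>$l * y l)) / \<nu>$j + (- \<nu>$k / \<nu>$j) * t))) / \<bar>\<nu>$k\<bar>)"
      using nz by (intro lborel_integral_real_affine) simp
    also have "\<dots> = (LINT t | lborel. G (emb j \<nu> c (y(k := t))) / \<bar>\<nu>$j\<bar>)"
      unfolding * using nz by (simp add: abs_divide)
    finally show "(LINT s | lborel. G (emb k \<nu> c (y(j := s))) / \<bar>\<nu>$k\<bar>)
      = (LINT t | lborel. G (emb j \<nu> c (y(k := t))) / \<bar>\<nu>$j\<bar>)" .
  qed
  also have "\<dots> = (LINT y | (\<Pi>\<^sub>M i\<in>insert k ?I. lborel). G (emb j \<nu> c y) / \<bar>\<nu>$j\<bar>)"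
    by (rule product_integral_insert[OF _ _ intj, symmetric]) auto
  also have "\<dots> = chart_int j \<nu> c F g"
    unfolding ins chart_int_def G_def ..
  finally show ?thesis .
qed simp

text \<open>The measurability claim serves the divergence theorem, where fibre integrals are
  replaced almost everywhere by sums over faces.\<close>

lemma lborel_integral_fiber:
  fixes H :: "real^'n::finite \<Rightarrow> real"
  assumes "integrable lborel H"
  shows "(LINT x | lborel. H x) =
    (LINT y | (\<Pi>\<^sub>M i\<in>UNIV-{j}. lborel). LINT t | lborel. H (\<chi> i. (y(j := t)) i))"
    and "(\<lambda>y. LINT t | lborel. H (\<chi> i. (y(j := t)) i)) \<in> borel_measurable (\<Pi>\<^sub>M i\<in>UNIV-{j}. lborel)"
proof -
  interpret product_sigma_finite "\<lambda>_::'n. lborel :: real measure" by (rule product_sigma_finite_lborel)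
  have ins: "insert j (UNIV - {j}) = UNIV" by auto
  have H: "H \<in> borel_measurable borel" using assms by simp
  have int: "integrable (\<Pi>\<^sub>M i\<in>UNIV. lborel) (\<lambda>f. H (\<chi> i. f i))"
    using assms unfolding lborel_vec_eq by (subst (asm) integrable_distr_eq[OF vec_lambda_measurable_PiM H])
  have "(LINT x | lborel. H x) = (LINT f | (\<Pi>\<^sub>M i\<in>UNIV. lborel). H (\<chi> i. f i))"
    by (subst lborel_vec_eq, rule integral_distr[OF vec_lambda_measurable_PiM H])
  also have "\<dots> = (LINT y | (\<Pi>\<^sub>M i\<in>UNIV-{j}. lborel). LINT t | lborel. H (\<chi> i. (y(j := t)) i))"
    using product_integral_insert[of "UNIV - {j}" j "\<lambda>f. H (\<chi> i. f i)"] int unfolding ins by simp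
  finally show "(LINT x | lborel. H x) =
    (LINT y | (\<Pi>\<^sub>M i\<in>UNIV-{j}. lborel). LINT t | lborel. H (\<chi> i. (y(j := t)) i))" .
  have "(\<lambda>p. H (\<chi> i. (case p of (y, t) \<Rightarrow> y(j := t)) i)) \<in> borel_measurable ((\<Pi>\<^sub>M i\<in>UNIV-{j}. lborel) \<Otimes>\<^sub>M lborel)"
    using measurable_compose[OF measurable_add_dim[of j "UNIV - {j}" "\<lambda>_. lborel", unfolded ins]
        measurable_compose[OF vec_lambda_measurable_PiM H]] .
  then show "(\<lambda>y. LINT t | lborel. H (\<chi> i. (y(j := t)) i)) \<in> borel_measurable (\<Pi>\<^sub>M i\<in>UNIV-{j}. lborel)"
    by (intro lborel.borel_measurable_lebesgue_integral) (simp add: split_def)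
qed

section \<open>Local structure of polyhedral partitions\<close>

text \<open>As the half spaces are finitely many, their strict versions cut out an open subset of
  the closure, and each half space has its strict version as interior.\<close>

lemma interior_polytope_halfspaces:
  fixes C :: "'a::euclidean_space set"
  assumes "polytope (closure C)" "C = interior (closure C)"
  shows "\<exists>H. finite H \<and> (\<forall>(a,b)\<in>H. a \<noteq> 0) \<and> closure C = {x. \<forall>(a,b)\<in>H. a \<bullet> x \<le> b}
           \<and> C = {x. \<forall>(a,b)\<in>H. a \<bullet> x < b}"
proof -
  obtain F where F: "finite F" "closure C = \<Inter>F" "\<forall>h\<in>F. \<exists>a b. a \<noteq> 0 \<and> h = {x. a \<bullet> x \<le> b}"
    using polytope_imp_polyhedron[OF assms(1)] unfolding polyhedron_def by blast
  from F(3) obtain a b where ab: "\<And>h. h \<in> F \<Longrightarrow> a h \<noteq> 0 \<and> h = {x. a h \<bullet> x \<le> b h}"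
    by metis
  let ?H = "(\<lambda>h. (a h, b h)) ` F"
  have cl: "closure C = {x. \<forall>(a,b)\<in>?H. a \<bullet> x \<le> b}" using F(2) ab by auto
  have "C = {x. \<forall>(a,b)\<in>?H. a \<bullet> x < b}"
  proof (intro equalityI subsetI)
    fix x assume x: "x \<in> C"
    have "a h \<bullet> x < b h" if h: "h \<in> F" for h
    proof -
      have "C \<subseteq> interior {x. a h \<bullet> x \<le> b h}"
        using F(2) ab[OF h] h assms(2) interior_mono[of "closure C" h] by (metis Inf_lower)
      also have "\<dots> = {x. a h \<bullet> x < b h}" using ab[OF h] interior_halfspace_le[of "a h" "b h"] by blast
      finally show ?thesis using x by blast
    qed
    then show "x \<in> {x. \<forall>(a,b)\<in>?H. a \<bullet> x < b}" by auto
  next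
    fix x assume x: "x \<in> {x. \<forall>(a,b)\<in>?H. a \<bullet> x < b}"
    have eq: "{x. \<forall>(a,b)\<in>?H. a \<bullet> x < b} = (\<Inter>h\<in>F. {x. a h \<bullet> x < b h})" by auto
    have "open {x. \<forall>(a,b)\<in>?H. a \<bullet> x < b}"
      unfolding eq using F(1) by (intro open_INT ballI open_halfspace_lt)
    moreover have "{x. \<forall>(a,b)\<in>?H. a \<bullet> x < b} \<subseteq> closure C" unfolding cl by force
    ultimately have "{x. \<forall>(a,b)\<in>?H. a \<bullet> x < b} \<subseteq> interior (closure C)" by (rule interior_maximal[rotated])
    then show "x \<in> C" using x assms(2) by blast
  qed
  then show ?thesis using F(1) ab cl by (intro exI[of _ ?H]) auto
qed

text \<open>Local model of a smooth boundary point x with outer normal \<open>a\<close>, which is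
  not normalised. The last clause is global: the same hyperplane supports the whole closure.\<close>

definition half_ball :: "'a::euclidean_space set \<Rightarrow> 'a \<Rightarrow> 'a \<Rightarrow> real \<Rightarrow> bool" where
  "half_ball C x a e \<longleftrightarrow> e > 0 \<and> a \<noteq> 0 \<and> (\<forall>z\<in>ball x e. z \<in> C \<longleftrightarrow> a \<bullet> (z - x) < 0)
     \<and> (\<forall>z\<in>ball x e. z \<in> closure C \<longleftrightarrow> a \<bullet> (z - x) \<le> 0) \<and> (\<forall>z\<in>closure C. a \<bullet> (z - x) \<le> 0)"

text \<open>Constraints inactive at x stay strict near x, and the active ones are multiples of
  \<open>a0\<close>. A point of C satisfies all active constraints strictly, so the multiples share
  one sign and a single half space remains.\<close>

lemma half_ball_exists:
  fixes C :: "'a::euclidean_space set"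
  assumes H: "finite H" "C = {x. \<forall>(a,b)\<in>H. a \<bullet> x < b}" "closure C = {x. \<forall>(a,b)\<in>H. a \<bullet> x \<le> b}"
    and C: "C \<noteq> {}" and x: "x \<in> closure C" "x \<notin> C"
    and par: "\<And>a b. (a, b) \<in> H \<Longrightarrow> a \<bullet> x = b \<Longrightarrow> \<exists>c. a = c *\<^sub>R a0"
  shows "\<exists>s e. s \<in> {1, -1} \<and> half_ball C x (s *\<^sub>R a0) e"
proof -
  obtain z0 where z0: "z0 \<in> C" using C by blast
  define t where "t = a0 \<bullet> (z0 - x)"
  have act: "\<exists>c. a = c *\<^sub>R a0 \<and> c * t < 0" if "(a, b) \<in> H" "a \<bullet> x = b" for a b
  proof -
    from par[OF that] obtain c where c: "a = c *\<^sub>R a0" by blast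
    have "a \<bullet> z0 < b" using z0 that(1) H(2) by auto
    then have "a \<bullet> (z0 - x) < 0" using that(2) by (simp add: inner_diff_right)
    then show ?thesis using c by (auto simp: t_def)
  qed
  obtain a1 b1 where ab1: "(a1, b1) \<in> H" "a1 \<bullet> x = b1"
    using x H(2,3) by fastforce
  have t0: "t \<noteq> 0" using act[OF ab1] by auto
  have a0: "a0 \<noteq> 0" using t0 by (auto simp: t_def)
  define s where "s = - sgn t"
  have s: "s \<in> {1, -1}" using t0 by (auto simp: s_def sgn_real_def)
  have sact: "\<exists>c>0. a = c *\<^sub>R (s *\<^sub>R a0)" if ab: "(a, b) \<in> H" "a \<bullet> x = b" for a b
  proof -
    obtain c where c: "a = c *\<^sub>R a0" "c * t < 0" using act[OF ab] by blast
    have "a = \<bar>c\<bar> *\<^sub>R (s *\<^sub>R a0)" using c by (auto simp: s_def sgn_real_def mult_less_0_iff)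
    moreover have "\<bar>c\<bar> > 0" using c by auto
    ultimately show ?thesis by blast
  qed
  define U where "U = (\<Inter>h\<in>{h\<in>H. fst h \<bullet> x < snd h}. {z. fst h \<bullet> z < snd h})"
  have "open U" unfolding U_def using H(1) by (intro open_INT ballI open_halfspace_lt) auto
  moreover have "x \<in> U" by (auto simp: U_def)
  ultimately obtain e where e: "e > 0" "ball x e \<subseteq> U" unfolding open_contains_ball by blast
  have le: "s *\<^sub>R a0 \<bullet> (z - x) \<le> 0" if "z \<in> closure C" for z
  proof -
    obtain c where c: "c > 0" "a1 = c *\<^sub>R (s *\<^sub>R a0)" using sact[OF ab1] by blast
    have "a1 \<bullet> z \<le> b1" using that ab1 H(3) by auto
    then have "a1 \<bullet> (z - x) \<le> 0" using ab1 by (simp add: inner_diff_right)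
    then have "c * (s *\<^sub>R a0 \<bullet> (z - x)) \<le> 0" unfolding c(2) inner_scaleR_left[of c] .
    then show ?thesis using c(1) by (simp only: mult_le_0_iff) auto
  qed
  have lt: "s *\<^sub>R a0 \<bullet> (z - x) < 0" if "z \<in> C" for z
  proof -
    obtain c where c: "c > 0" "a1 = c *\<^sub>R (s *\<^sub>R a0)" using sact[OF ab1] by blast
    have "a1 \<bullet> z < b1" using that ab1 H(2) by auto
    then have "a1 \<bullet> (z - x) < 0" using ab1 by (simp add: inner_diff_right)
    then have "c * (s *\<^sub>R a0 \<bullet> (z - x)) < 0" unfolding c(2) inner_scaleR_left[of c] .
    then show ?thesis using c(1) by (simp only: mult_less_0_iff) auto
  qed
  have C1: "z \<in> C" if "z \<in> ball x e" "s *\<^sub>R a0 \<bullet> (z - x) < 0" for z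
  proof -
    have "a \<bullet> z < b" if ab: "(a, b) \<in> H" for a b
    proof (cases "a \<bullet> x = b")
      case True
      obtain c where c: "c > 0" "a = c *\<^sub>R (s *\<^sub>R a0)" using sact[OF ab True] by blast
      have "a \<bullet> (z - x) < 0"
        unfolding c(2) inner_scaleR_left[of c] using \<open>s *\<^sub>R a0 \<bullet> (z - x) < 0\<close> c(1) by (rule mult_pos_neg[rotated])
      then show ?thesis using True by (simp add: inner_diff_right)
    next
      case False
      then have "a \<bullet> x < b" using x(1) ab H(3) by force
      then show ?thesis using e(2) that \<open>z \<in> ball x e\<close> by (force simp: U_def)
    qed
    then show ?thesis using H(2) by auto
  qed
  have C2: "z \<in> closure C" if "z \<in> ball x e" "s *\<^sub>R a0 \<bullet> (z - x) \<le> 0" for z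
  proof -
    have "a \<bullet> z \<le> b" if ab: "(a, b) \<in> H" for a b
    proof (cases "a \<bullet> x = b")
      case True
      obtain c where c: "c > 0" "a = c *\<^sub>R (s *\<^sub>R a0)" using sact[OF ab True] by blast
      have "a \<bullet> (z - x) \<le> 0"
        unfolding c(2) inner_scaleR_left[of c] using \<open>s *\<^sub>R a0 \<bullet> (z - x) \<le> 0\<close> c(1) by (intro mult_nonneg_nonpos) auto
      then show ?thesis using True by (simp add: inner_diff_right)
    next
      case False
      then have "a \<bullet> x < b" using x(1) ab H(3) by force
      then show ?thesis using e(2) that \<open>z \<in> ball x e\<close> by (force simp: U_def)
    qed
    then show ?thesis using H(3) by auto
  qed
  have "half_ball C x (s *\<^sub>R a0) e"
    unfolding half_ball_def using e(1) a0 s le lt C1 C2 by auto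
  then show ?thesis using s by blast
qed

lemma inner_orth_imp_scaleR:
  fixes a \<nu> :: "'a::real_inner"
  assumes "a \<noteq> 0" "\<And>w. a \<bullet> w = 0 \<Longrightarrow> \<nu> \<bullet> w = 0"
  shows "\<nu> = ((\<nu> \<bullet> a) / (a \<bullet> a)) *\<^sub>R a"
proof -
  define w where "w = \<nu> - ((\<nu> \<bullet> a) / (a \<bullet> a)) *\<^sub>R a"
  have aw: "a \<bullet> w = 0" using assms(1) by (simp add: w_def inner_diff_right inner_commute)
  then have "\<nu> \<bullet> w = 0" by (rule assms(2))
  then have "w \<bullet> w = 0" using aw by (simp add: w_def inner_diff_left)
  then show ?thesis by (simp add: w_def)
qed

text \<open>Near x the closure contains all small displacements w with
  \<open>a \<bullet> w \<le> 0\<close>. A supporting functional is nonpositive on this half space,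
  hence vanishes on its boundary. This identifies the normals of faces and facets through x with the
  local normal.\<close>

lemma half_ball_supporting:
  assumes hb: "half_ball C x a e" and le: "\<And>z. z \<in> closure C \<Longrightarrow> \<nu> \<bullet> (z - x) \<le> 0"
  shows "\<exists>c\<ge>0. \<nu> = c *\<^sub>R a"
proof -
  have e: "e > 0" and a: "a \<noteq> 0" using hb by (auto simp: half_ball_def)
  have small: "\<nu> \<bullet> w \<le> 0" if "a \<bullet> w \<le> 0" for w
  proof -
    define r where "r = e / (2 * (norm w + 1))"
    have nw: "norm w + 1 > 0" by (simp add: add_nonneg_pos)
    have r: "r > 0" using e nw by (simp add: r_def)
    have "r * norm w < e"
    proof -
      have "r * norm w \<le> r * (norm w + 1)" using r by simp
      also have "\<dots> = e / 2" using nw by (simp add: r_def field_simps)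
      finally show ?thesis using e by simp
    qed
    then have "x + r *\<^sub>R w \<in> ball x e" using r by (simp add: dist_norm)
    moreover have "a \<bullet> (x + r *\<^sub>R w - x) \<le> 0" using that r by (simp add: mult_nonneg_nonpos)
    ultimately have "x + r *\<^sub>R w \<in> closure C" using hb unfolding half_ball_def by blast
    from le[OF this] show ?thesis using r by (simp add: mult_le_0_iff)
  qed
  have "\<nu> \<bullet> w = 0" if "a \<bullet> w = 0" for w
    using small[of w] small[of "- w"] that by simp
  from inner_orth_imp_scaleR[OF a this]
  have "\<nu> = ((\<nu> \<bullet> a) / (a \<bullet> a)) *\<^sub>R a" by blast
  moreover have "\<nu> \<bullet> a \<ge> 0" using small[of "- a"] by simp
  ultimately show ?thesis by (intro exI[of _ "(\<nu> \<bullet> a) / (a \<bullet> a)"]) auto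
qed

text \<open>Consequently disjoint elements touch a common smooth boundary point from opposite
  sides.\<close>

lemma half_ball_same_side:
  assumes "half_ball C x a e" "half_ball C' x (c *\<^sub>R a) e'" "c > 0"
  shows "C \<inter> C' \<noteq> {}"
proof -
  define r where "r = min e e' / (2 * norm a)"
  have a: "a \<noteq> 0" and e: "e > 0" "e' > 0" using assms by (auto simp: half_ball_def)
  have r: "r > 0" using a e by (simp add: r_def)
  have "r * norm a = min e e' / 2" using a by (simp add: r_def)
  then have "r * norm a < min e e'" using e by linarith
  then have z: "x - r *\<^sub>R a \<in> ball x e" "x - r *\<^sub>R a \<in> ball x e'" using r by (auto simp: dist_norm)
  have "a \<bullet> (x - r *\<^sub>R a - x) < 0" using r a by simp
  then have "x - r *\<^sub>R a \<in> C" "x - r *\<^sub>R a \<in> C'"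
    using assms z unfolding half_ball_def by (auto simp: mult_pos_neg)
  then show ?thesis by blast
qed

text \<open>A relatively open piece of a hyperplane already has full dimension, so contact along a
  half ball produces a genuine face.\<close>

lemma half_ball_aff_dim:
  fixes F :: "'a::euclidean_space set"
  assumes e: "e > 0" and a: "a \<noteq> 0" and sub: "F \<subseteq> {z. a \<bullet> (z - x) = 0}"
    and sup: "\<And>z. z \<in> ball x e \<Longrightarrow> a \<bullet> (z - x) = 0 \<Longrightarrow> z \<in> F"
  shows "aff_dim F = int DIM('a) - 1"
proof (rule antisym)
  have eq: "{z. a \<bullet> (z - x) = 0} = {z. a \<bullet> z = a \<bullet> x}" by (auto simp: inner_diff_right)
  have hyp: "aff_dim {z. a \<bullet> z = a \<bullet> x} = int DIM('a) - 1" using a by simp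
  show "aff_dim F \<le> int DIM('a) - 1" using aff_dim_subset[OF sub] hyp eq by simp
  have "aff_dim ({z. a \<bullet> z = a \<bullet> x} \<inter> ball x e) = aff_dim {z. a \<bullet> z = a \<bullet> x}"
    using e by (intro aff_dim_convex_Int_open convex_hyperplane) auto
  moreover have "{z. a \<bullet> z = a \<bullet> x} \<inter> ball x e \<subseteq> F"
    using sup by (auto simp: inner_diff_right)
  ultimately show "int DIM('a) - 1 \<le> aff_dim F" using aff_dim_subset hyp by metis
qed

text \<open>A set of codimension one has a hyperplane as affine hull, so it lies in no other
  hyperplane.\<close>

lemma hyperplane_normals_parallel:
  fixes F :: "'a::euclidean_space set"
  assumes F: "aff_dim F = int DIM('a) - 1" and a: "a \<noteq> 0" "F \<subseteq> {x. a \<bullet> x = b}" and \<nu>: "F \<subseteq> {x. \<nu> \<bullet> x = c}"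
  shows "\<exists>r. \<nu> = r *\<^sub>R a"
proof -
  obtain \<alpha> \<beta> where ab: "\<alpha> \<noteq> 0" "affine hull F = {x. \<alpha> \<bullet> x = \<beta>}"
    using F aff_dim_eq_hyperplane[of F] by auto
  have par: "\<exists>r. \<nu> = r *\<^sub>R \<alpha>" if "F \<subseteq> {x. \<nu> \<bullet> x = c}" for \<nu> c
  proof -
    have sub: "{x. \<alpha> \<bullet> x = \<beta>} \<subseteq> {x. \<nu> \<bullet> x = c}"
      using hull_minimal[of F "{x. \<nu> \<bullet> x = c}" affine] that affine_hyperplane ab(2) by blast
    define p where "p = (\<beta> / (\<alpha> \<bullet> \<alpha>)) *\<^sub>R \<alpha>"
    have p: "\<alpha> \<bullet> p = \<beta>" using ab(1) by (simp add: p_def)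
    have "\<nu> \<bullet> w = 0" if "\<alpha> \<bullet> w = 0" for w
    proof -
      have "p \<in> {x. \<alpha> \<bullet> x = \<beta>}" "p + w \<in> {x. \<alpha> \<bullet> x = \<beta>}" using p that by (auto simp: inner_add_right)
      then have "\<nu> \<bullet> p = c" "\<nu> \<bullet> (p + w) = c" using sub by blast+
      then show ?thesis by (simp add: inner_add_right)
    qed
    from inner_orth_imp_scaleR[OF ab(1) this] show ?thesis by blast
  qed
  obtain r where r: "a = r *\<^sub>R \<alpha>" using par[OF a(2)] by blast
  obtain r' where r': "\<nu> = r' *\<^sub>R \<alpha>" using par[OF \<nu>] by blast
  have "r \<noteq> 0" using r a(1) by auto
  then have "\<nu> = (r' / r) *\<^sub>R a" using r r' by simp
  then show ?thesis by blast
qed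

text \<open>Evaluates the definite description in \<open>onormal\<close>: the dimension of F fixes
  the normal up to a factor, a point of K strictly inside the half space fixes the sign, and the
  norm fixes the length.\<close>

lemma onormal_eqI:
  fixes K F :: "(real^'n::finite) set"
  assumes F: "aff_dim F = int CARD('n) - 1" "F \<noteq> {}" and a: "a \<noteq> 0"
    and K: "closure K \<subseteq> {x. a \<bullet> x \<le> b}" and Fa: "F \<subseteq> {x. a \<bullet> x = b}"
    and open_K: "open K" "K \<noteq> {}"
  shows "onormal K F = a /\<^sub>R norm a"
  unfolding onormal_def
proof (rule the_equality)
  have na: "norm a > 0" using a by simp
  have 1: "(a /\<^sub>R norm a) \<bullet> (y - z) = 0" if "y \<in> F" "z \<in> F" for y z
  proof -
    have "a \<bullet> y = b" "a \<bullet> z = b" using subsetD[OF Fa that(1)] subsetD[OF Fa that(2)] by auto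
    then show ?thesis by (simp add: inner_diff_right)
  qed
  have 2: "(a /\<^sub>R norm a) \<bullet> (x - y) \<le> 0" if "x \<in> closure K" "y \<in> F" for x y
  proof -
    have "a \<bullet> x \<le> b" "a \<bullet> y = b" using subsetD[OF K that(1)] subsetD[OF Fa that(2)] by auto
    then have "a \<bullet> (x - y) \<le> 0" by (simp add: inner_diff_right)
    then show ?thesis using na by (simp add: mult_nonneg_nonpos)
  qed
  show "norm (a /\<^sub>R norm a) = 1 \<and> (\<forall>y\<in>F. \<forall>z\<in>F. (a /\<^sub>R norm a) \<bullet> (y - z) = 0)
      \<and> (\<forall>x\<in>closure K. \<forall>y\<in>F. (a /\<^sub>R norm a) \<bullet> (x - y) \<le> 0)"
    using 1 2 a by simp
next
  fix \<nu> assume \<nu>: "norm \<nu> = 1 \<and> (\<forall>y\<in>F. \<forall>z\<in>F. \<nu> \<bullet> (y - z) = 0) \<and> (\<forall>x\<in>closure K. \<forall>y\<in>F. \<nu> \<bullet> (x - y) \<le> 0)"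
  obtain y0 where y0: "y0 \<in> F" using F(2) by blast
  have "F \<subseteq> {x. \<nu> \<bullet> x = \<nu> \<bullet> y0}"
  proof
    fix y assume "y \<in> F"
    then have "\<nu> \<bullet> (y - y0) = 0" using \<nu> y0 by blast
    then show "y \<in> {x. \<nu> \<bullet> x = \<nu> \<bullet> y0}" by (simp add: inner_diff_right)
  qed
  then obtain r where r: "\<nu> = r *\<^sub>R a"
    using hyperplane_normals_parallel[of F a b \<nu>] F(1) a Fa by auto
  have "K \<subseteq> {x. a \<bullet> x < b}"
  proof -
    have "K \<subseteq> interior {x. a \<bullet> x \<le> b}"
      using K closure_subset open_K(1) by (intro interior_maximal) auto
    then show ?thesis using a by (simp add: interior_halfspace_le)
  qed
  then obtain z where z: "z \<in> K" "a \<bullet> z < b" using open_K(2) by blast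
  have "\<nu> \<bullet> (z - y0) \<le> 0" using \<nu> subsetD[OF closure_subset z(1)] y0 by simp
  moreover have "a \<bullet> (z - y0) < 0" using z(2) subsetD[OF Fa y0] by (simp add: inner_diff_right)
  ultimately have "r \<ge> 0" using r by (simp add: mult_le_0_iff)
  moreover have "norm (r *\<^sub>R a) = 1" using \<nu> r by blast
  then have "\<bar>r\<bar> * norm a = 1" by simp
  ultimately have "r * norm a = 1" by simp
  then have "r = inverse (norm a)" using a by (metis inverse_unique mult.commute)
  then show "\<nu> = a /\<^sub>R norm a" using r by simp
qed

section \<open>Generic lines in a coordinate direction\<close>

definition pt :: "'n::finite \<Rightarrow> ('n \<Rightarrow> real) \<Rightarrow> real \<Rightarrow> real^'n" where
  "pt j y t = (\<chi> i. (y(j := t)) i)"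

lemma pt_diff: "pt j y s - pt j y t = (s - t) *\<^sub>R axis j 1"
  by (auto simp: pt_def vec_eq_iff axis_def)

lemma inner_pt: "a \<bullet> pt j y t = a$j * t + (\<Sum>i\<in>UNIV-{j}. a$i * y i)"
proof -
  have "a \<bullet> pt j y t = (\<Sum>i\<in>UNIV. a$i * (y(j := t)) i)" by (simp add: inner_vec_def pt_def)
  then show ?thesis by (simp add: sum.remove[of UNIV j])
qed

text \<open>Several bounding hyperplanes may pass through x, since adjacent elements share them, but
  they have to be parallel and the coordinate line has to cross them transversally.\<close>

definition generic :: "((real^'n::finite) \<times> real) set \<Rightarrow> 'n \<Rightarrow> real^'n \<Rightarrow> bool" where
  "generic H j x \<longleftrightarrow> (\<forall>(a,b)\<in>H. a \<bullet> x = b \<longrightarrow> a$j \<noteq> 0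
      \<and> (\<forall>(a',b')\<in>H. a' \<bullet> x = b' \<longrightarrow> (\<exists>c. a' = c *\<^sub>R a)))"

text \<open>With \<open>a$j = 0\<close> the equation does not involve t and describes a hyperplane
  in the remaining coordinates.\<close>

lemma AE_line_avoids_parallel_hyperplane:
  fixes a :: "real^'n::finite"
  assumes "a \<noteq> 0" "a$j = 0"
  shows "AE y in \<Pi>\<^sub>M i\<in>UNIV-{j}. lborel. \<forall>t. a \<bullet> pt j y t \<noteq> b"
proof -
  obtain i where "a$i \<noteq> 0" using assms(1) by (auto simp: vec_eq_iff)
  then have i: "i \<in> UNIV - {j}" "a$i \<noteq> 0" using assms(2) by auto
  have "AE y in \<Pi>\<^sub>M i\<in>UNIV-{j}. lborel. (\<Sum>i\<in>UNIV-{j}. a$i * y i) \<noteq> b"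
    by (rule AE_PiM_lborel_hyperplane[OF _ i(1), of "\<lambda>i. a$i"]) (use i in auto)
  then show ?thesis by (simp add: inner_pt assms(2))
qed

text \<open>Finitely many null sets of lines are discarded: those inside a bounding hyperplane
  parallel to the direction, and those through the intersection of two non-parallel
  hyperplanes.\<close>

lemma AE_generic:
  fixes H :: "((real^'n::finite) \<times> real) set"
  assumes H: "finite H" "\<forall>(a,b)\<in>H. a \<noteq> 0"
  shows "AE y in \<Pi>\<^sub>M i\<in>UNIV-{j}. lborel. \<forall>t. generic H j (pt j y t)"
proof -
  let ?M = "\<Pi>\<^sub>M i\<in>UNIV-{j}. (lborel::real measure)"
  have 1: "AE y in ?M. \<forall>h\<in>H. \<forall>t. fst h \<bullet> pt j y t = snd h \<longrightarrow> fst h $ j \<noteq> 0"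
  proof (rule AE_finite_allI[OF H(1)])
    fix h assume h: "h \<in> H"
    show "AE y in ?M. \<forall>t. fst h \<bullet> pt j y t = snd h \<longrightarrow> fst h $ j \<noteq> 0"
    proof (cases "fst h $ j = 0")
      case True
      have "AE y in ?M. \<forall>t. fst h \<bullet> pt j y t \<noteq> snd h"
        using H(2) h True by (intro AE_line_avoids_parallel_hyperplane) auto
      then show ?thesis by eventually_elim auto
    qed auto
  qed
  have 2: "AE y in ?M. \<forall>p\<in>H \<times> H. \<forall>t. fst (fst p) $ j \<noteq> 0 \<longrightarrow> fst (fst p) \<bullet> pt j y t = snd (fst p) \<longrightarrow>
      fst (snd p) \<bullet> pt j y t = snd (snd p) \<longrightarrow> (\<exists>c. fst (snd p) = c *\<^sub>R fst (fst p))"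
  proof (rule AE_finite_allI)
    show "finite (H \<times> H)" using H(1) by simp
    fix p assume "p \<in> H \<times> H"
    obtain a b a' b' where p: "p = ((a, b), (a', b'))" by (metis prod.exhaust)
    \<comment> \<open>Elimination of the j-th coordinate: \<open>d\<close> has j-th entry zero, and
      every common point x of the two hyperplanes satisfies
      \<open>d \<bullet> x = b' - c * b\<close>, an equation free of t along the line.\<close>
    define c where "c = a'$j / a$j"
    define d where "d = a' - c *\<^sub>R a"
    show "AE y in ?M. \<forall>t. fst (fst p) $ j \<noteq> 0 \<longrightarrow> fst (fst p) \<bullet> pt j y t = snd (fst p) \<longrightarrow>
      fst (snd p) \<bullet> pt j y t = snd (snd p) \<longrightarrow> (\<exists>c. fst (snd p) = c *\<^sub>R fst (fst p))"
    proof (cases "a$j = 0 \<or> d = 0")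
      case True
      then show ?thesis unfolding p d_def by auto
    next
      case False
      have "AE y in ?M. \<forall>t. d \<bullet> pt j y t \<noteq> b' - c * b"
        using False by (intro AE_line_avoids_parallel_hyperplane) (auto simp: d_def c_def)
      then show ?thesis
      proof eventually_elim
        case (elim y)
        have "a \<bullet> pt j y t = b \<Longrightarrow> a' \<bullet> pt j y t = b' \<Longrightarrow> False" for t
          using elim[rule_format, of t] by (simp add: d_def inner_diff_left)
        then show ?case unfolding p by auto
      qed
    qed
  qed
  from 1 2 show ?thesis
  proof eventually_elim
    case (elim y)
    show ?case unfolding generic_def
    proof (intro allI ballI)
      fix t h assume h: "h \<in> H"
      obtain a b where ab: "h = (a, b)" by (metis prod.exhaust)
      have "a$j \<noteq> 0 \<and> (\<forall>(a',b')\<in>H. a' \<bullet> pt j y t = b' \<longrightarrow> (\<exists>c. a' = c *\<^sub>R a))" if eq: "a \<bullet> pt j y t = b"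
      proof
        show aj: "a$j \<noteq> 0" using elim(1)[rule_format, OF h, of t] eq ab by simp
        show "\<forall>(a',b')\<in>H. a' \<bullet> pt j y t = b' \<longrightarrow> (\<exists>c. a' = c *\<^sub>R a)"
        proof clarify
          fix a' assume "(a', a' \<bullet> pt j y t) \<in> H"
          then show "\<exists>c. a' = c *\<^sub>R a"
            using elim(2)[rule_format, of "(h, (a', a' \<bullet> pt j y t))" t] h ab eq aj by simp
        qed
      qed
      then show "case h of (a, b) \<Rightarrow> a \<bullet> pt j y t = b \<longrightarrow> a$j \<noteq> 0
        \<and> (\<forall>(a',b')\<in>H. a' \<bullet> pt j y t = b' \<longrightarrow> (\<exists>c. a' = c *\<^sub>R a))"
        unfolding ab by blast
    qed
  qed
qed

text \<open>\<open>surf_int\<close> chooses normal, coordinate and base point. The normal is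
  determined up to sign by the dimension of F, the offset is the same for all base points of F, and
  \<open>chart_int_change\<close> exchanges the coordinate.\<close>

lemma surf_int_eq_chart:
  fixes F :: "(real^'n::finite) set"
  assumes F: "compact F" "aff_dim F = int CARD('n) - 1" and y0: "y0 \<in> F"
    and n: "norm n = 1" "\<forall>y\<in>F. \<forall>z\<in>F. n \<bullet> (y - z) = 0" and j: "n$j \<noteq> 0"
    and g: "bddmeas F g"
  shows "surf_int F g = chart_int j n (n \<bullet> y0) F g"
proof -
  define \<nu> where "\<nu> = hnormal F"
  have \<nu>: "norm \<nu> = 1" "\<forall>y\<in>F. \<forall>z\<in>F. \<nu> \<bullet> (y - z) = 0"
    using someI[of "\<lambda>\<nu>. norm \<nu> = 1 \<and> (\<forall>y\<in>F. \<forall>z\<in>F. \<nu> \<bullet> (y - z) = 0)" n] n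
    unfolding \<nu>_def hnormal_def by auto
  define k where "k = (SOME k. \<nu>$k \<noteq> 0)"
  have "\<nu> \<noteq> 0" using \<nu>(1) by auto
  then have "\<exists>k. \<nu>$k \<noteq> 0" by (simp add: vec_eq_iff)
  then have k: "\<nu>$k \<noteq> 0" unfolding k_def by (rule someI_ex)
  define y1 where "y1 = (SOME y. y \<in> F)"
  have y1: "y1 \<in> F" unfolding y1_def using y0 by (rule someI)
  have "\<nu> \<bullet> (y1 - y0) = 0" using \<nu>(2) y0 y1 by blast
  then have cst: "\<nu> \<bullet> y1 = \<nu> \<bullet> y0" by (simp add: inner_diff_right)
  have on: "F \<subseteq> {x. m \<bullet> x = m \<bullet> y0}" if "\<forall>y\<in>F. \<forall>z\<in>F. m \<bullet> (y - z) = 0" for m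
  proof
    fix y assume "y \<in> F"
    then have "m \<bullet> (y - y0) = 0" using that y0 by blast
    then show "y \<in> {x. m \<bullet> x = m \<bullet> y0}" by (simp add: inner_diff_right)
  qed
  have "n \<noteq> 0" using n by auto
  then obtain r where r: "\<nu> = r *\<^sub>R n"
    using hyperplane_normals_parallel[OF _ _ on[OF n(2)] on[OF \<nu>(2)]] F(2) by auto
  have "\<bar>r\<bar> = 1" using \<nu>(1) n(1) r by simp
  then have r1: "r = 1 \<or> r = -1" by auto
  have "surf_int F g = chart_int k \<nu> (\<nu> \<bullet> y0) F g"
  proof -
    have "indicator {y. emb k \<nu> (\<nu> \<bullet> y0) y \<in> F} y = (indicator F (emb k \<nu> (\<nu> \<bullet> y0) y) :: real)" for y
      by (simp add: indicator_def)
    then show ?thesis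
      unfolding surf_int_def chart_int_def Let_def \<nu>_def[symmetric] k_def[symmetric] y1_def[symmetric] cst
        emb_def[symmetric] by simp
  qed
  also have "\<dots> = chart_int j \<nu> (\<nu> \<bullet> y0) F g"
    using r1 j k r by (intro chart_int_change F(1) g) auto
  also have "\<dots> = chart_int j n (n \<bullet> y0) F g"
  proof -
    have "emb j (- n) (- (n \<bullet> y0)) y = emb j n (n \<bullet> y0) y" for y
      unfolding emb_def vec_eq_iff using j by (auto simp: sum_negf field_simps)
    then show ?thesis using r1 r unfolding chart_int_def by auto
  qed
  finally show ?thesis .
qed

definition is_face :: "(real^'n::finite) set \<Rightarrow> (real^'n) set \<Rightarrow> bool" where
  "is_face K F \<longleftrightarrow> compact F \<and> F \<noteq> {} \<and> aff_dim F = int CARD('n) - 1 \<and> F \<subseteq> closure K - K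
     \<and> norm (onormal K F) = 1 \<and> (\<forall>y\<in>F. \<forall>z\<in>F. onormal K F \<bullet> (y - z) = 0)
     \<and> (\<forall>x\<in>closure K. \<forall>y\<in>F. onormal K F \<bullet> (x - y) \<le> 0)"

lemma is_faceI:
  fixes K F :: "(real^'n::finite) set"
  assumes F: "compact F" "aff_dim F = int CARD('n) - 1" "F \<noteq> {}" "F \<subseteq> closure K" and a: "a \<noteq> 0"
    and K: "closure K \<subseteq> {x. a \<bullet> x \<le> b}" and Fa: "F \<subseteq> {x. a \<bullet> x = b}"
    and open_K: "open K" "K \<noteq> {}"
  shows "is_face K F" "onormal K F = a /\<^sub>R norm a"
proof -
  show eq: "onormal K F = a /\<^sub>R norm a"
    by (rule onormal_eqI[OF F(2,3) a K Fa open_K])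
  have na: "norm a > 0" using a by simp
  have 1: "(a /\<^sub>R norm a) \<bullet> (y - z) = 0" if "y \<in> F" "z \<in> F" for y z
  proof -
    have "a \<bullet> y = b" "a \<bullet> z = b" using subsetD[OF Fa that(1)] subsetD[OF Fa that(2)] by auto
    then show ?thesis by (simp add: inner_diff_right)
  qed
  have 2: "(a /\<^sub>R norm a) \<bullet> (x - y) \<le> 0" if "x \<in> closure K" "y \<in> F" for x y
  proof -
    have "a \<bullet> x \<le> b" "a \<bullet> y = b" using subsetD[OF K that(1)] subsetD[OF Fa that(2)] by auto
    then have "a \<bullet> (x - y) \<le> 0" by (simp add: inner_diff_right)
    then show ?thesis using na by (simp add: mult_nonneg_nonpos)
  qed
  have "K \<subseteq> interior {x. a \<bullet> x \<le> b}"
    using K closure_subset open_K(1) by (intro interior_maximal) auto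
  then have "K \<subseteq> {x. a \<bullet> x < b}" using a by (simp add: interior_halfspace_le)
  then have "F \<inter> K = {}" using Fa by force
  then show "is_face K F" unfolding is_face_def eq using F 1 2 a by auto
qed

section \<open>Elements and faces of a polyhedral mesh\<close>

locale mesh =
  fixes Om :: "(real^'n::finite) set" and \<K> :: "(real^'n) set set"
  assumes dom: "dg_domain Om" and mesh: "dg_mesh Om \<K>"
begin

lemma finite_mesh: "finite \<K>"
  using mesh by (simp add: dg_mesh_def)

lemma element:
  assumes "K \<in> \<K>"
  shows "K \<noteq> {}" "K \<subseteq> Om" "polytope (closure K)" "K = interior (closure K)"
    "open K" "convex K" "bounded K"
proof -
  show *: "K \<noteq> {}" "K \<subseteq> Om" "polytope (closure K)" "K = interior (closure K)"
    using mesh assms by (auto simp: dg_mesh_def)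
  show "open K" using *(4) by (metis open_interior)
  show "convex K" using *(3,4) by (metis convex_interior polytope_imp_convex)
  show "bounded K" using *(3) by (meson bounded_subset closure_subset polytope_imp_bounded)
qed

lemma element_disjoint: "K \<in> \<K> \<Longrightarrow> K' \<in> \<K> \<Longrightarrow> K \<noteq> K' \<Longrightarrow> K \<inter> K' = {}"
  using mesh by (simp add: dg_mesh_def)

lemma mesh_cover: "\<Union>(closure ` \<K>) = closure Om"
  using mesh by (simp add: dg_mesh_def)

lemma domain:
  shows "Om \<noteq> {}" "open Om" "convex Om" "bounded Om" "polytope (closure Om)" "Om = interior (closure Om)"
  using dom convex_interior_closure[of Om] by (auto simp: dg_domain_def interior_open)

lemma finite_faces:
  "finite (int_faces \<K>)" "finite (bnd_faces Om \<K>)"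
  "finite {K'. (K, K') \<in> int_faces \<K>}" "finite {F. (K, F) \<in> bnd_faces Om \<K>}"
proof -
  show 1: "finite (int_faces \<K>)"
    by (rule finite_subset[of _ "\<K> \<times> \<K>"]) (auto simp: int_faces_def finite_mesh)
  have "bnd_faces Om \<K> \<subseteq> (\<lambda>(K, G). (K, closure K \<inter> G)) ` (\<K> \<times> {G. G facet_of closure Om})"
    unfolding bnd_faces_def by force
  then show 2: "finite (bnd_faces Om \<K>)"
    using finite_mesh finite_polyhedron_facets[OF polytope_imp_polyhedron[OF domain(5)]]
    by (rule_tac finite_subset) auto
  show "finite {K'. (K, K') \<in> int_faces \<K>}"
    by (rule finite_subset[OF _ finite_imageI[OF 1, of snd]]) force
  show "finite {F. (K, F) \<in> bnd_faces Om \<K>}"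
    by (rule finite_subset[OF _ finite_imageI[OF 2, of snd]]) force
qed

lemma int_faces_sym: "(K, K') \<in> int_faces \<K> \<longleftrightarrow> (K', K) \<in> int_faces \<K>"
  by (auto simp: int_faces_def fc_def Int_commute)

lemma compact_closure_element: "K \<in> \<K> \<Longrightarrow> compact (closure K)"
  using element(7) by (simp add: compact_closure)

text \<open>A hyperplane separating two disjoint convex elements contains the common part of their
  closures, so one vector yields both outer normals with opposite signs. The face may be a proper
  part of a facet of either element.\<close>

lemma int_face:
  assumes "(K, K') \<in> int_faces \<K>"
  shows "is_face K (fc K K')" "onormal K' (fc K K') = - onormal K (fc K K')"
proof -
  have K: "K \<in> \<K>" "K' \<in> \<K>" "K \<noteq> K'" "aff_dim (fc K K') = int CARD('n) - 1"
    using assms by (auto simp: int_faces_def)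
  obtain a b where ab: "a \<noteq> 0" "\<forall>x\<in>K. a \<bullet> x \<le> b" "\<forall>x\<in>K'. b \<le> a \<bullet> x"
    using separating_hyperplane_sets[of K K'] element[OF K(1)] element[OF K(2)] element_disjoint[OF K(1-3)]
    by metis
  have c1: "closure K \<subseteq> {x. a \<bullet> x \<le> b}"
    using ab(2) by (intro closure_minimal closed_halfspace_le) auto
  have c2: "closure K' \<subseteq> {x. b \<le> a \<bullet> x}"
    using ab(3) by (intro closure_minimal closed_halfspace_ge) auto
  have F: "compact (fc K K')" unfolding fc_def
    using K by (intro compact_Int compact_closure_element)
  have card: "CARD('n) > 0" by simp
  have ne: "fc K K' \<noteq> {}" using K(4) card by (auto simp: aff_dim_empty)
  have on: "fc K K' \<subseteq> {x. a \<bullet> x = b}" using c1 c2 by (force simp: fc_def)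
  have "is_face K (fc K K')" "onormal K (fc K K') = a /\<^sub>R norm a"
    using is_faceI[OF F K(4) ne _ ab(1) c1 on] element[OF K(1)] by (auto simp: fc_def)
  moreover have "onormal K' (fc K K') = (- a) /\<^sub>R norm (- a)"
    using K(2,4) ne ab(1) c2 on element[OF K(2)]
    by (intro onormal_eqI[where b="- b"]) auto
  ultimately show "is_face K (fc K K')" "onormal K' (fc K K') = - onormal K (fc K K')" by auto
qed

text \<open>Faces of a polyhedron are exposed; with \<open>a = 0\<close> the facet would be empty or
  the whole closure.\<close>

lemma facet_hyperplane:
  assumes "G facet_of closure Om"
  obtains a b where "a \<noteq> 0" "closure Om \<subseteq> {x. a \<bullet> x \<le> b}" "G = closure Om \<inter> {x. a \<bullet> x = b}"
proof -
  have "G face_of closure Om" using assms by (simp add: facet_of_def)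
  then have "G exposed_face_of closure Om"
    using exposed_face_of_polyhedron polytope_imp_polyhedron[OF domain(5)] by blast
  then obtain a b where ab: "closure Om \<subseteq> {x. a \<bullet> x \<le> b}" "G = closure Om \<inter> {x. a \<bullet> x = b}"
    by (auto simp: exposed_face_of_def)
  have "G \<noteq> {}" "aff_dim G = aff_dim (closure Om) - 1" using assms by (auto simp: facet_of_def)
  then have "G \<noteq> closure Om" by auto
  then have "a \<noteq> 0" using ab \<open>G \<noteq> {}\<close> by auto
  then show thesis using that ab by blast
qed

lemma bnd_face:
  assumes "(K, F) \<in> bnd_faces Om \<K>"
  shows "is_face K F" "F \<subseteq> closure Om - Om"
proof -
  obtain G where K: "K \<in> \<K>" and G: "G facet_of closure Om" and F: "F = closure K \<inter> G"
    and dim: "aff_dim F = int CARD('n) - 1"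
    using assms by (auto simp: bnd_faces_def)
  obtain a b where ab: "a \<noteq> 0" "closure Om \<subseteq> {x. a \<bullet> x \<le> b}" "G = closure Om \<inter> {x. a \<bullet> x = b}"
    using facet_hyperplane[OF G] by blast
  have sub: "closure K \<subseteq> closure Om" using element(2)[OF K] by (rule closure_mono)
  have Feq: "F = closure K \<inter> {x. a \<bullet> x = b}" using F ab(3) sub by blast
  have "compact F" unfolding Feq
    using compact_closure_element[OF K] closed_hyperplane by blast
  moreover have "F \<noteq> {}" using dim by (auto simp: aff_dim_empty)
  ultimately show "is_face K F"
    using is_faceI(1)[of F K a b] dim ab sub element[OF K] Feq by blast
  have "Om \<subseteq> interior {x. a \<bullet> x \<le> b}"
    using ab(2) closure_subset domain(2) by (intro interior_maximal) auto
  then have "Om \<subseteq> {x. a \<bullet> x < b}" using ab(1) by (simp add: interior_halfspace_le)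
  then show "F \<subseteq> closure Om - Om" using Feq sub by force
qed

end

lemma half_ball_point: "half_ball C x a e \<Longrightarrow> \<exists>z\<in>C. a \<bullet> (z - x) < 0"
proof -
  assume hb: "half_ball C x a e"
  have a: "a \<noteq> 0" and e: "e > 0" using hb by (auto simp: half_ball_def)
  define r where "r = e / (2 * norm a)"
  have r: "r > 0" "r * norm a < e" using a e by (auto simp: r_def)
  have "x - r *\<^sub>R a \<in> ball x e" using r by (simp add: dist_norm)
  moreover have lt: "a \<bullet> (x - r *\<^sub>R a - x) < 0" using r a by simp
  ultimately have "x - r *\<^sub>R a \<in> C" using hb unfolding half_ball_def by blast
  then show ?thesis using lt by blast
qed

text \<open>The opposite normal would place points of C outside the half space that supports
  D.\<close>

lemma half_ball_subset_sign:
  assumes "C \<subseteq> D" "half_ball D x a e'" "half_ball C x (s *\<^sub>R a) e" "s \<in> {1, -1}"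
  shows "s = 1"
proof (rule ccontr)
  assume "s \<noteq> 1"
  then have "half_ball C x (- a) e" using assms(3,4) by auto
  then obtain z where z: "z \<in> C" "(- a) \<bullet> (z - x) < 0" using half_ball_point by blast
  have "z \<in> closure D" using z(1) assms(1) closure_subset by blast
  then have "a \<bullet> (z - x) \<le> 0" using assms(2) unfolding half_ball_def by blast
  then show False using z(2) by simp
qed

text \<open>As the direction is transversal, a small move against the normal enters C. Hence a line
  that misses an element cannot touch its frontier at a generic point.\<close>

lemma half_ball_line:
  assumes hb: "half_ball C (pt j y t) a e" and aj: "a$j \<noteq> 0"
  shows "\<exists>s. pt j y s \<in> C"
proof -
  have e: "e > 0" using hb by (auto simp: half_ball_def)
  define s where "s = t - e / 2 * sgn (a$j)"
  have d: "pt j y s - pt j y t = (- (e / 2 * sgn (a$j))) *\<^sub>R axis j 1"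
    by (simp add: pt_diff s_def)
  have "norm (pt j y s - pt j y t) < e" unfolding d using e aj by (simp add: abs_mult sgn_real_def)
  then have "pt j y s \<in> ball (pt j y t) e" by (simp add: dist_norm norm_minus_commute)
  moreover have "a \<bullet> (pt j y s - pt j y t) < 0"
    unfolding d using e aj by (auto simp: inner_axis sgn_real_def mult_pos_neg)
  ultimately show ?thesis using hb unfolding half_ball_def by blast
qed

context mesh
begin

definition hs :: "(real^'n) set \<Rightarrow> ((real^'n) \<times> real) set" where
  "hs C = (SOME H. finite H \<and> (\<forall>(a,b)\<in>H. a \<noteq> 0) \<and> closure C = {x. \<forall>(a,b)\<in>H. a \<bullet> x \<le> b}
           \<and> C = {x. \<forall>(a,b)\<in>H. a \<bullet> x < b})"

lemma hs:
  assumes "C \<in> insert Om \<K>"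
  shows "finite (hs C)" "\<forall>(a,b)\<in>hs C. a \<noteq> 0" "closure C = {x. \<forall>(a,b)\<in>hs C. a \<bullet> x \<le> b}"
    "C = {x. \<forall>(a,b)\<in>hs C. a \<bullet> x < b}"
proof -
  have "polytope (closure C)" "C = interior (closure C)"
    using assms element(3,4) domain(5,6) by auto
  from someI_ex[OF interior_polytope_halfspaces[OF this], folded hs_def]
  show "finite (hs C)" "\<forall>(a,b)\<in>hs C. a \<noteq> 0" "closure C = {x. \<forall>(a,b)\<in>hs C. a \<bullet> x \<le> b}"
    "C = {x. \<forall>(a,b)\<in>hs C. a \<bullet> x < b}" by blast+
qed

text \<open>Elements and domain are pooled so that one notion of generic point governs interior and
  boundary faces alike.\<close>

definition all_hs :: "((real^'n) \<times> real) set" where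
  "all_hs = (\<Union>C\<in>insert Om \<K>. hs C)"

lemma all_hs: "finite all_hs" "\<forall>(a,b)\<in>all_hs. a \<noteq> 0"
  using hs(1,2) finite_mesh unfolding all_hs_def by blast+

text \<open>All hyperplanes active at a generic point are parallel, whichever element they bound, so
  a single normal describes, up to sign, every set that has x on its frontier.\<close>

lemma half_ball_mesh:
  assumes K: "K \<in> \<K>" and x: "x \<in> closure K" "x \<notin> K" and gen: "generic all_hs j x"
  obtains a e where "a$j \<noteq> 0" "half_ball K x a e"
    "\<And>C. C \<in> insert Om \<K> \<Longrightarrow> x \<in> closure C \<Longrightarrow> x \<notin> C \<Longrightarrow> \<exists>s\<in>{1,-1}. \<exists>e. half_ball C x (s *\<^sub>R a) e"
proof -
  have Ki: "K \<in> insert Om \<K>" using K by simp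
  obtain a0 b0 where ab0: "(a0, b0) \<in> hs K" "a0 \<bullet> x = b0"
    using x hs(3,4)[OF Ki] by fastforce
  have mem: "(a0, b0) \<in> all_hs" using ab0(1) Ki by (auto simp: all_hs_def)
  have g: "a0$j \<noteq> 0" "\<And>a b. (a, b) \<in> all_hs \<Longrightarrow> a \<bullet> x = b \<Longrightarrow> \<exists>c. a = c *\<^sub>R a0"
    using gen mem ab0(2) unfolding generic_def by blast+
  have hb: "\<exists>s e. s \<in> {1, -1} \<and> half_ball C x (s *\<^sub>R a0) e"
    if C: "C \<in> insert Om \<K>" "x \<in> closure C" "x \<notin> C" for C
  proof (rule half_ball_exists[OF hs(1)[OF C(1)] hs(4)[OF C(1)] hs(3)[OF C(1)] _ C(2,3)])
    show "C \<noteq> {}" using C(1) element(1) domain(1) by blast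
    fix a b assume "(a, b) \<in> hs C" "a \<bullet> x = b"
    moreover have "(a, b) \<in> all_hs" using \<open>(a, b) \<in> hs C\<close> C(1) unfolding all_hs_def by blast
    ultimately show "\<exists>c. a = c *\<^sub>R a0" using g(2) by blast
  qed
  obtain s0 e0 where s0: "s0 \<in> {1, -1}" "half_ball K x (s0 *\<^sub>R a0) e0" using hb[OF Ki x] by blast
  show thesis
  proof (rule that[of "s0 *\<^sub>R a0" e0])
    show "(s0 *\<^sub>R a0) $ j \<noteq> 0" using g(1) s0(1) by auto
    show "half_ball K x (s0 *\<^sub>R a0) e0" by fact
    fix C assume C: "C \<in> insert Om \<K>" "x \<in> closure C" "x \<notin> C"
    obtain s e where s: "s \<in> {1, -1}" "half_ball C x (s *\<^sub>R a0) e" using hb[OF C] by blast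
    have "(s * s0) *\<^sub>R s0 *\<^sub>R a0 = s *\<^sub>R a0" using s0(1) by auto
    then have "half_ball C x ((s * s0) *\<^sub>R s0 *\<^sub>R a0) e" using s(2) by (simp only:)
    moreover have "s * s0 \<in> {1, -1}" using s(1) s0(1) by auto
    ultimately show "\<exists>s\<in>{1,-1}. \<exists>e. half_ball C x (s *\<^sub>R s0 *\<^sub>R a0) e" by blast
  qed
qed

text \<open>Interior faces are indexed by the neighbour and boundary faces by the face itself, which
  turns the faces of K into one finite sum.\<close>

definition face_idx :: "(real^'n) set \<Rightarrow> ((real^'n) set + (real^'n) set) set" where
  "face_idx K = {K'. (K, K') \<in> int_faces \<K>} <+> {F. (K, F) \<in> bnd_faces Om \<K>}"

fun face_set :: "(real^'n) set \<Rightarrow> ((real^'n) set + (real^'n) set) \<Rightarrow> (real^'n) set" where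
  "face_set K (Inl K') = fc K K'"
| "face_set K (Inr F) = F"

lemma face_idx_is_face: "i \<in> face_idx K \<Longrightarrow> is_face K (face_set K i)"
  using int_face(1) bnd_face(1) by (auto simp: face_idx_def)

lemma finite_face_idx: "finite (face_idx K)"
  using finite_faces by (simp add: face_idx_def)

text \<open>Otherwise a ball around x inside the domain avoids the finitely many other closed
  elements, and its points beyond the local hyperplane are covered by no element at all.\<close>

lemma generic_interior_neighbour:
  assumes K: "K \<in> \<K>" and x: "x \<in> closure K" "x \<notin> K" "x \<in> Om" and hb: "half_ball K x a e"
  shows "\<exists>K'\<in>\<K>. K' \<noteq> K \<and> x \<in> closure K'"
proof (rule ccontr)
  assume no: "\<not> ?thesis"
  define D where "D = \<Union>(closure ` (\<K> - {K}))"
  have "closed D" unfolding D_def using finite_mesh by (intro closed_Union) auto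
  then have "open (Om - D)" using domain(2) by (simp add: open_Diff)
  moreover have "x \<in> Om - D" using no x(3) unfolding D_def by blast
  ultimately obtain r where r: "r > 0" "ball x r \<subseteq> Om - D" unfolding open_contains_ball by blast
  have a: "a \<noteq> 0" and e: "e > 0" using hb by (auto simp: half_ball_def)
  define z where "z = x + (r / (2 * norm a)) *\<^sub>R a"
  have "dist x z < r" using a r(1) by (simp add: z_def dist_norm)
  then have z: "z \<in> Om - D" using r(2) by auto
  have "a \<bullet> (z - x) > 0" using a r(1) by (simp add: z_def)
  then have "z \<notin> closure K" using hb unfolding half_ball_def by force
  then have "z \<notin> \<Union>(closure ` \<K>)" using z unfolding D_def by blast
  then show False using mesh_cover z closure_subset by blast
qed

lemma not_in_neighbour:
  assumes "K \<in> \<K>" "K' \<in> \<K>" "K \<noteq> K'" "x \<in> closure K" shows "x \<notin> K'"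
  using assms element(5) element_disjoint open_Int_closure_eq_empty[of K' K] by blast

text \<open>Any other element touching x is disjoint from K and so lies beyond the local hyperplane;
  two such elements would overlap. Inside the domain one of them exists, and the contact set
  contains a disc of the hyperplane. On the boundary of the domain there is no room for one, and a
  facet of the domain takes its place.\<close>

lemma generic_unique_face:
  assumes K: "K \<in> \<K>" and x: "x \<in> closure K" "x \<notin> K" and gen: "generic all_hs j x"
  shows "\<exists>a e i. a$j \<noteq> 0 \<and> half_ball K x a e \<and> i \<in> face_idx K \<and> x \<in> face_set K i
    \<and> onormal K (face_set K i) = a /\<^sub>R norm a \<and> (\<forall>i'\<in>face_idx K. x \<in> face_set K i' \<longrightarrow> i' = i)"
proof -
  obtain a e where aj: "a$j \<noteq> 0" and hbK: "half_ball K x a e"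
    and hb: "\<And>C. C \<in> insert Om \<K> \<Longrightarrow> x \<in> closure C \<Longrightarrow> x \<notin> C \<Longrightarrow> \<exists>s\<in>{1,-1}. \<exists>e. half_ball C x (s *\<^sub>R a) e"
    using half_ball_mesh[OF K x gen] by blast
  have a: "a \<noteq> 0" and e: "e > 0" using hbK by (auto simp: half_ball_def)
  have other: "\<exists>e. half_ball K' x (- a) e" if K': "K' \<in> \<K>" "K' \<noteq> K" "x \<in> closure K'" for K'
  proof -
    have "x \<notin> K'" using not_in_neighbour[OF K K'(1)] K'(2) x(1) by blast
    then obtain s e' where s: "s \<in> {1, -1}" "half_ball K' x (s *\<^sub>R a) e'" using hb[of K'] K' by blast
    have "s \<noteq> 1"
    proof
      assume "s = 1"
      then have "K \<inter> K' \<noteq> {}" using half_ball_same_side[OF hbK s(2)] by simp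
      then show False using element_disjoint[OF K K'(1)] K'(2) by blast
    qed
    then show ?thesis using s by auto
  qed
  have normal: "onormal K (face_set K i') = a /\<^sub>R norm a" if i': "i' \<in> face_idx K" "x \<in> face_set K i'" for i'
  proof -
    let ?n = "onormal K (face_set K i')"
    have n: "norm ?n = 1" "\<And>z. z \<in> closure K \<Longrightarrow> ?n \<bullet> (z - x) \<le> 0"
      using face_idx_is_face[OF i'(1)] i'(2) unfolding is_face_def by blast+
    obtain c where c: "c \<ge> 0" "?n = c *\<^sub>R a" using half_ball_supporting[OF hbK n(2)] by blast
    have "norm (c *\<^sub>R a) = 1" using n(1) c(2) by simp
    then have "c * norm a = 1" using c(1) by simp
    then have "c = inverse (norm a)" using a by (metis inverse_unique mult.commute)
    then show ?thesis using c(2) by simp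
  qed
  have "\<exists>i\<in>face_idx K. x \<in> face_set K i \<and> (\<forall>i'\<in>face_idx K. x \<in> face_set K i' \<longrightarrow> i' = i)"
  proof (cases "x \<in> Om")
    case True
    obtain K' where K': "K' \<in> \<K>" "K' \<noteq> K" "x \<in> closure K'"
      using generic_interior_neighbour[OF K x True hbK] by blast
    obtain e' where hb': "half_ball K' x (- a) e'" using other[OF K'] by blast
    have e': "e' > 0" using hb' by (auto simp: half_ball_def)
    have "aff_dim (fc K K') = int DIM(real^'n) - 1"
    proof (rule half_ball_aff_dim[of "min e e'" a _ x])
      show "fc K K' \<subseteq> {z. a \<bullet> (z - x) = 0}"
        using hbK hb' unfolding half_ball_def fc_def by force
      fix z assume "z \<in> ball x (min e e')" "a \<bullet> (z - x) = 0"
      then show "z \<in> fc K K'" using hbK hb' unfolding half_ball_def fc_def by auto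
    qed (use e e' a in auto)
    then have int: "(K, K') \<in> int_faces \<K>" using K K' by (auto simp: int_faces_def)
    show ?thesis
    proof (intro bexI[of _ "Inl K'"] conjI ballI impI)
      show "x \<in> face_set K (Inl K')" using x K' by (simp add: fc_def)
      show "Inl K' \<in> face_idx K" using int by (auto simp: face_idx_def)
      fix i' assume i': "i' \<in> face_idx K" "x \<in> face_set K i'"
      show "i' = Inl K'"
      proof (cases i')
        case (Inl K'')
        have K'': "K'' \<in> \<K>" "K'' \<noteq> K" "x \<in> closure K''"
          using i' Inl by (auto simp: face_idx_def int_faces_def fc_def)
        obtain e'' where "half_ball K'' x (- a) e''" using other[OF K''] by blast
        then have "K' \<inter> K'' \<noteq> {}" using half_ball_same_side[OF hb', of K'' 1] by simp
        then show ?thesis using element_disjoint[OF K'(1) K''(1)] Inl by blast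
      next
        case (Inr F)
        then have "F \<subseteq> closure Om - Om" using i' bnd_face(2) by (auto simp: face_idx_def)
        then show ?thesis using i'(2) Inr True by auto
      qed
    qed
  next
    case False
    have xc: "x \<in> closure Om" using x(1) element(2)[OF K] closure_mono by blast
    obtain s e' where s: "s \<in> {1, -1}" "half_ball Om x (s *\<^sub>R a) e'" using hb[of Om] xc False by blast
    have "(s *\<^sub>R (s *\<^sub>R a)) = a" using s(1) by auto
    then have "half_ball K x (s *\<^sub>R (s *\<^sub>R a)) e" using hbK by simp
    then have "s = 1" using half_ball_subset_sign[OF element(2)[OF K] s(2)] s(1) by blast
    then have hbOm: "half_ball Om x a e'" using s(2) by simp
    have e': "e' > 0" using hbOm by (auto simp: half_ball_def)
    \<comment> \<open>Every facet through x has a normal parallel to \<open>a\<close>, so all of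
      them cut the same set out of the closure of K and yield the same index.\<close>
    have facet: "closure K \<inter> G = closure K \<inter> {z. a \<bullet> (z - x) = 0}" if G: "G facet_of closure Om" "x \<in> G" for G
    proof -
      obtain \<alpha> \<beta> where \<alpha>: "\<alpha> \<noteq> 0" "closure Om \<subseteq> {x. \<alpha> \<bullet> x \<le> \<beta>}" "G = closure Om \<inter> {x. \<alpha> \<bullet> x = \<beta>}"
        using facet_hyperplane[OF G(1)] by blast
      have \<beta>: "\<alpha> \<bullet> x = \<beta>" using G(2) \<alpha>(3) by blast
      have "\<alpha> \<bullet> (z - x) \<le> 0" if "z \<in> closure Om" for z
        using subsetD[OF \<alpha>(2) that] \<beta> by (simp add: inner_diff_right)
      then obtain c where c: "\<alpha> = c *\<^sub>R a" using half_ball_supporting[OF hbOm] by blast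
      have c0: "c \<noteq> 0" using c \<alpha>(1) by auto
      have "\<alpha> \<bullet> z = \<beta> \<longleftrightarrow> a \<bullet> (z - x) = 0" for z
        using \<beta>[symmetric] c c0 by (auto simp: inner_diff_right)
      then show ?thesis using \<alpha>(3) closure_mono[OF element(2)[OF K]] by auto
    qed
    have "rel_frontier (closure Om) = closure Om - Om"
      using domain rel_interior_nonempty_interior[of "closure Om"] by (simp add: rel_frontier_def)
    then have "x \<in> \<Union>{G. G facet_of closure Om}"
      using rel_frontier_of_polyhedron[OF polytope_imp_polyhedron[OF domain(5)]] xc False by blast
    then obtain G where G: "G facet_of closure Om" "x \<in> G" by blast
    let ?F = "closure K \<inter> G"
    have "aff_dim ?F = int DIM(real^'n) - 1"
    proof (rule half_ball_aff_dim[OF e a])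
      show "?F \<subseteq> {z. a \<bullet> (z - x) = 0}" unfolding facet[OF G] by blast
      fix z assume "z \<in> ball x e" "a \<bullet> (z - x) = 0"
      then show "z \<in> ?F" unfolding facet[OF G] using hbK by (auto simp: half_ball_def)
    qed
    then have bnd: "(K, ?F) \<in> bnd_faces Om \<K>" using K G by (auto simp: bnd_faces_def)
    show ?thesis
    proof (intro bexI[of _ "Inr ?F"] conjI ballI impI)
      show "x \<in> face_set K (Inr ?F)" using x G by simp
      show "Inr ?F \<in> face_idx K" using bnd by (auto simp: face_idx_def)
      fix i' assume i': "i' \<in> face_idx K" "x \<in> face_set K i'"
      show "i' = Inr ?F"
      proof (cases i')
        case (Inl K'')
        have K'': "K'' \<in> \<K>" "K'' \<noteq> K" "x \<in> closure K''"
          using i' Inl by (auto simp: face_idx_def int_faces_def fc_def)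
        obtain e'' where "half_ball K'' x (- a) e''" using other[OF K''] by blast
        then have "(-1::real) = 1" using half_ball_subset_sign[OF element(2)[OF K''(1)] hbOm, of "-1" e''] by simp
        then show ?thesis by simp
      next
        case (Inr F)
        then obtain G' where G': "G' facet_of closure Om" "F = closure K \<inter> G'"
          using i' by (auto simp: face_idx_def bnd_faces_def)
        then have "x \<in> G'" using i'(2) Inr by auto
        then show ?thesis using facet[OF G] facet[OF G'(1)] G'(2) Inr by simp
      qed
    qed
  qed
  then obtain i where i: "i \<in> face_idx K" "x \<in> face_set K i"
    "\<forall>i'\<in>face_idx K. x \<in> face_set K i' \<longrightarrow> i' = i" by (elim bexE conjE)
  show ?thesis
    by (intro exI conjI) (rule aj hbK i normal[OF i(1,2)])+
qed

end

section \<open>The divergence theorem on one element\<close>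

lemma open_convex_bounded_real:
  fixes I :: "real set"
  assumes "open I" "convex I" "bounded I" "I \<noteq> {}"
  obtains l u where "l < u" "I = {l<..<u}"
proof -
  define l u where "l = Inf I" and "u = Sup I"
  have bd: "bdd_above I" "bdd_below I" using assms(3) by (auto simp: bounded_imp_bdd_above bounded_imp_bdd_below)
  have "I = {l<..<u}"
  proof (intro equalityI subsetI)
    fix x assume x: "x \<in> I"
    obtain e where e: "e > 0" "ball x e \<subseteq> I" using assms(1) x unfolding open_contains_ball by blast
    have "x - e / 2 \<in> I" "x + e / 2 \<in> I" using e by (auto simp: subset_iff dist_real_def)
    then have "l \<le> x - e / 2" "x + e / 2 \<le> u"
      unfolding l_def u_def using bd cInf_lower cSup_upper by auto
    then show "x \<in> {l<..<u}" using e(1) by auto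
  next
    fix x assume x: "x \<in> {l<..<u}"
    obtain a where a: "a \<in> I" "a < x" using cInf_lessD[of I x] assms(4) x by (auto simp: l_def)
    obtain b where b: "b \<in> I" "x < b" using less_cSupD[of I x] assms(4) x by (auto simp: u_def)
    have "is_interval I" using assms(2) by (simp add: is_interval_convex_1)
    then show "x \<in> I" using a b mem_is_interval_1_I[of I a b x] by auto
  qed
  then show thesis using that assms(4) by (metis greaterThanLessThan_empty not_le_imp_less)
qed

lemma pt_in_hyperplane:
  assumes "n \<bullet> pt j y t = c" "n$j \<noteq> 0" shows "pt j y t = emb j n c y"
proof -
  have "t = (c - (\<Sum>i\<in>UNIV-{j}. n$i * y i)) / n$j"
    using assms by (simp add: inner_pt field_simps)
  then show ?thesis unfolding pt_def emb_def vec_eq_iff by auto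
qed

lemma emb_eq_pt: "emb j n c y = pt j y ((c - (\<Sum>i\<in>UNIV-{j}. n$i * y i)) / n$j)"
  unfolding pt_def emb_def vec_eq_iff by auto

lemma continuous_pt: "continuous_on UNIV (pt j y)"
proof -
  have "pt j y = (\<lambda>t. pt j y 0 + t *\<^sub>R axis j 1)"
    by (auto simp: pt_def vec_eq_iff axis_def fun_eq_iff)
  moreover have "continuous_on UNIV (\<lambda>t::real. pt j y 0 + t *\<^sub>R axis j 1)" by (intro continuous_intros)
  ultimately show ?thesis by metis
qed

lemma continuous_imp_bddmeas:
  assumes "continuous_on UNIV g" "compact F" shows "bddmeas F g"
  unfolding bddmeas_def
  using assms by (auto intro!: compact_imp_bounded compact_continuous_image borel_measurable_continuous_onI
      intro: continuous_on_subset)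

lemma set_integrable_continuous:
  fixes g :: "real^'n::finite \<Rightarrow> real"
  assumes "continuous_on UNIV g" "open K" "bounded K"
  shows "integrable lborel (\<lambda>x. indicator K x * g x)" "g integrable_on K"
    "integral K g = (LINT x | lborel. indicator K x * g x)"
proof -
  have "set_integrable lborel (closure K) g"
    unfolding set_integrable_def using assms
    by (intro borel_integrable_compact) (auto simp: compact_closure intro: continuous_on_subset)
  then have si: "set_integrable lborel K g"
    by (rule set_integrable_subset) (use assms closure_subset in auto)
  then show "integrable lborel (\<lambda>x. indicator K x * g x)" by (simp add: set_integrable_def)
  show "g integrable_on K" using set_borel_integral_eq_integral(1)[OF si] .
  show "integral K g = (LINT x | lborel. indicator K x * g x)"
    using set_borel_integral_eq_integral(2)[OF si] by (simp add: set_lebesgue_integral_def)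
qed

context mesh
begin

text \<open>An open segment from a point of K to a point of its closure stays in K, so a frontier
  point beyond an end of the chord would put that end into K.\<close>

lemma fiber_frontier:
  assumes K: "K \<in> \<K>" and I: "{t. pt j y t \<in> K} = {l<..<u}" "l < u"
  shows "pt j y t \<in> closure K - K \<longleftrightarrow> t = l \<or> t = u"
proof
  have m: "pt j y ((l + u) / 2) \<in> K" using I by (auto simp: set_eq_iff)
  assume t: "pt j y t \<in> closure K - K"
  have seg: "s \<in> {l<..<u}" if s_in: "s \<in> open_segment ((l + u) / 2) t" for s
  proof -
    have "open_segment (pt j y ((l + u) / 2)) (pt j y t) \<subseteq> interior K"
      using t m element(5,6)[OF K] by (intro in_interior_closure_convex_segment) (auto simp: interior_open)
    moreover have "pt j y s \<in> open_segment (pt j y ((l + u) / 2)) (pt j y t)"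
    proof -
      obtain w where w: "(l + u) / 2 \<noteq> t" "0 < w" "w < 1" "s = (1 - w) *\<^sub>R ((l + u) / 2) + w *\<^sub>R t"
        using s_in unfolding in_segment(2) by blast
      have "pt j y s = (1 - w) *\<^sub>R pt j y ((l + u) / 2) + w *\<^sub>R pt j y t"
        unfolding w(4) by (auto simp: pt_def vec_eq_iff field_simps)
      moreover have "pt j y ((l + u) / 2) \<noteq> pt j y t" using m t by auto
      ultimately show ?thesis unfolding in_segment(2) using w by blast
    qed
    ultimately have "pt j y s \<in> K" using interior_subset by blast
    then show ?thesis using I by blast
  qed
  have nt: "t \<notin> {l<..<u}" using t I by blast
  show "t = l \<or> t = u"
  proof (rule ccontr)
    assume "\<not> ?thesis"
    then consider "t < l" | "u < t" using nt by fastforce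
    then show False
    proof cases
      case 1 then show False using seg[of l] I(2) by (auto simp: open_segment_eq_real_ivl)
    next
      case 2 then show False using seg[of u] I(2) by (auto simp: open_segment_eq_real_ivl)
    qed
  qed
next
  assume t: "t = l \<or> t = u"
  have "t \<in> closure {l<..<u}" using I(2) t by (auto simp: closure_greaterThanLessThan)
  then have "pt j y t \<in> closure (pt j y ` {l<..<u})"
    using continuous_pt[of j y] image_closure_subset[of "{l<..<u}" "pt j y" "closure (pt j y ` {l<..<u})"]
    by (meson closed_closure closure_subset continuous_on_subset image_subset_iff subset_UNIV)
  moreover have "pt j y ` {l<..<u} \<subseteq> K" using I by blast
  ultimately have "pt j y t \<in> closure K" using closure_mono by blast
  moreover have "pt j y t \<notin> K" using I t by (auto simp: set_eq_iff)
  ultimately show "pt j y t \<in> closure K - K" by blast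
qed

lemma face_set_subset: "i \<in> face_idx K \<Longrightarrow> face_set K i \<subseteq> closure K - K"
  using face_idx_is_face unfolding is_face_def by blast

lemma face_emb:
  assumes i: "i \<in> face_idx K" "onormal K (face_set K i) $ j \<noteq> 0" and y0: "y0 \<in> face_set K i"
    and x: "pt j y t \<in> face_set K i"
  shows "emb j (onormal K (face_set K i)) (onormal K (face_set K i) \<bullet> y0) y = pt j y t"
proof -
  have "onormal K (face_set K i) \<bullet> (pt j y t - y0) = 0"
    using face_idx_is_face[OF i(1)] y0 x unfolding is_face_def by blast
  then show ?thesis using i(2) pt_in_hyperplane[of "onormal K (face_set K i)" j y t]
    by (simp add: inner_diff_right)
qed

lemma fiber_interval:
  assumes K: "K \<in> \<K>" and ne: "pt j y t0 \<in> K"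
  obtains l u where "l < u" "{t. pt j y t \<in> K} = {l<..<u}"
proof -
  define I where "I = pt j y -` K"
  have "open I" unfolding I_def using open_vimage[OF element(5)[OF K] continuous_pt] .
  moreover have "convex I"
  proof (rule convexI)
    fix s t w v :: real assume *: "s \<in> I" "t \<in> I" "0 \<le> w" "0 \<le> v" "w + v = 1"
    then have "w *\<^sub>R pt j y s + v *\<^sub>R pt j y t \<in> K"
      using element(6)[OF K] unfolding I_def by (simp add: convexD)
    moreover have "w *\<^sub>R pt j y s + v *\<^sub>R pt j y t = pt j y (w *\<^sub>R s + v *\<^sub>R t)"
    proof -
      have "w * z + v * z = z" for z using *(5) by (simp add: distrib_right[symmetric])
      then show ?thesis by (auto simp: pt_def vec_eq_iff)
    qed
    ultimately show "w *\<^sub>R s + v *\<^sub>R t \<in> I" by (simp add: I_def)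
  qed
  moreover have "bounded I"
  proof -
    obtain B where B: "\<And>x. x \<in> K \<Longrightarrow> norm x \<le> B" using element(7)[OF K] unfolding bounded_iff by blast
    have "\<bar>t\<bar> \<le> B" if "t \<in> I" for t
    proof -
      have "\<bar>pt j y t $ j\<bar> \<le> norm (pt j y t)" by (rule component_le_norm_cart)
      then show ?thesis using B[of "pt j y t"] that by (simp add: I_def pt_def)
    qed
    then show ?thesis unfolding bounded_iff by auto
  qed
  moreover have "I \<noteq> {}" using ne by (auto simp: I_def)
  ultimately obtain l u where lu: "l < u" "I = {l<..<u}" by (rule open_convex_bounded_real)
  then show thesis using that unfolding I_def vimage_def by blast
qed

lemma fiber_FTC:
  assumes I: "{t. pt j y t \<in> K} = {l<..<u}" "l < u"
    and g: "\<And>t. ((\<lambda>t. g (pt j y t)) has_real_derivative g' (pt j y t)) (at t)"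
    and cont: "continuous_on UNIV g'"
  shows "(LINT t | lborel. indicator K (pt j y t) * g' (pt j y t)) = g (pt j y u) - g (pt j y l)"
proof -
  have c: "continuous_on UNIV (\<lambda>t. g' (pt j y t))"
    using continuous_on_compose2[OF cont continuous_pt] by simp
  have m: "(\<lambda>t. g' (pt j y t)) \<in> borel_measurable borel" using c by (rule borel_measurable_continuous_onI)
  have ind: "indicator K (pt j y t) = (indicator {l<..<u} t :: real)" for t
    unfolding I(1)[symmetric] by (simp add: indicator_def)
  have "(LINT t | lborel. indicator K (pt j y t) * g' (pt j y t))
      = (LINT t | lborel. g' (pt j y t) * indicator {l..u} t)"
    unfolding ind
  proof (rule integral_cong_AE)
    show "(\<lambda>t. indicator {l<..<u} t * g' (pt j y t)) \<in> borel_measurable lborel"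
      using m by auto
    show "(\<lambda>t. g' (pt j y t) * indicator {l..u} t) \<in> borel_measurable lborel" using m by auto
    have "AE t in lborel. t \<noteq> l" "AE t in lborel. t \<noteq> u" by (auto simp: AE_lborel_singleton)
    then show "AE t in lborel. indicator {l<..<u} t * g' (pt j y t) = g' (pt j y t) * indicator {l..u} t"
      by eventually_elim (auto simp: indicator_def)
  qed
  also have "\<dots> = g (pt j y u) - g (pt j y l)"
    using c I(2) by (intro integral_FTC_Icc_real g) (auto simp: continuous_on_eq_continuous_at)
  finally show ?thesis .
qed

text \<open>The midpoint of the chord lies on the inner side of the face hyperplane. This decides
  the sign of the j-th entry of the outer normal: negative at the lower end, positive at the upper
  end.\<close>

lemma fiber_endpoint:
  assumes K: "K \<in> \<K>" and gen: "generic all_hs j (pt j y t)"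
    and I: "{t. pt j y t \<in> K} = {l<..<u}" "l < u" and t: "t = l \<and> s = -1 \<or> t = u \<and> s = 1"
  obtains i where "i \<in> face_idx K" "pt j y t \<in> face_set K i"
    "\<forall>i'\<in>face_idx K. pt j y t \<in> face_set K i' \<longrightarrow> i' = i"
    "sgn (onormal K (face_set K i) $ j) = s" "onormal K (face_set K i) $ j \<noteq> 0"
proof -
  have x: "pt j y t \<in> closure K" "pt j y t \<notin> K" using fiber_frontier[OF K I, of t] t by auto
  obtain a e i where a: "a$j \<noteq> 0" "half_ball K (pt j y t) a e" "i \<in> face_idx K" "pt j y t \<in> face_set K i"
    and norm: "onormal K (face_set K i) = a /\<^sub>R norm a"
    and uniq: "\<forall>i'\<in>face_idx K. pt j y t \<in> face_set K i' \<longrightarrow> i' = i"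
    using generic_unique_face[OF K x gen] by (elim exE conjE)
  have a0: "norm a > 0" using a(2) by (auto simp: half_ball_def)
  have "(l + u) / 2 \<in> {t. pt j y t \<in> K}" unfolding I(1) using I(2) by auto
  then have "pt j y ((l + u) / 2) \<in> closure K" using closure_subset by auto
  then have "a \<bullet> (pt j y ((l + u) / 2) - pt j y t) \<le> 0"
    using a(2) unfolding half_ball_def by blast
  then have le: "((l + u) / 2 - t) * a$j \<le> 0" by (simp add: pt_diff inner_axis)
  have "sgn (a$j) = s"
  proof (cases "t = l")
    case True
    then have "s = -1" using t I(2) by auto
    moreover have "(l + u) / 2 - t > 0" using True I(2) by simp
    then have "a$j \<le> 0" using le by (simp only: mult_le_0_iff) auto
    ultimately show ?thesis using a(1) by (simp add: sgn_real_def)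
  next
    case False
    then have s: "s = 1" "t = u" using t by auto
    then have "(l + u) / 2 - t < 0" using I(2) by simp
    then have "a$j \<ge> 0" using le by (simp only: mult_le_0_iff) auto
    then show ?thesis using a(1) s by (simp add: sgn_real_def)
  qed
  moreover have "onormal K (face_set K i) $ j = a$j / norm a"
    unfolding norm by (simp add: divide_inverse mult.commute)
  ultimately have n: "sgn (onormal K (face_set K i) $ j) = s" "onormal K (face_set K i) $ j \<noteq> 0"
    using a0 a(1) by (auto simp: sgn_divide)
  show thesis by (rule that[OF a(3,4) uniq n])
qed

text \<open>On a generic line each end point of the chord cut out by \<open>K\<close> lies in exactly one face, so the
  fundamental theorem of calculus on the chord is a sum over the faces of \<open>K\<close>.\<close>

lemma generic_fiber:
  assumes K: "K \<in> \<K>" and gen: "\<And>t. generic all_hs j (pt j y t)"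
    and g: "\<And>t. ((\<lambda>t. g (pt j y t)) has_real_derivative g' (pt j y t)) (at t)"
    and cont: "continuous_on UNIV g'"
    and y0: "\<And>i. i \<in> face_idx K \<Longrightarrow> y0 i \<in> face_set K i"
    and n: "\<And>i. n i = onormal K (face_set K i)" and x: "\<And>i. x i = emb j (n i) (n i \<bullet> y0 i) y"
  shows "(LINT t | lborel. indicator K (pt j y t) * g' (pt j y t)) =
    (\<Sum>i\<in>face_idx K. if n i $ j = 0 then 0 else indicator (face_set K i) (x i) * g (x i) * sgn (n i $ j))"
    (is "_ = (\<Sum>i\<in>face_idx K. ?f i)")
proof (cases "\<exists>t0. pt j y t0 \<in> K")
  case False
  \<comment> \<open>A generic frontier point on the line would let it enter K by
    \<open>half_ball_line\<close>, so no face is met and both sides vanish.\<close>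
  have "?f i = 0" if i: "i \<in> face_idx K" for i
  proof -
    have "pt j y t \<notin> face_set K i" for t
    proof
      assume "pt j y t \<in> face_set K i"
      then have x: "pt j y t \<in> closure K" "pt j y t \<notin> K"
        using face_set_subset[OF i] by auto
      obtain a e where "a$j \<noteq> 0" "half_ball K (pt j y t) a e"
        using generic_unique_face[OF K x gen] by (elim exE conjE)
      then show False using half_ball_line False by blast
    qed
    then have "x i \<notin> face_set K i" unfolding x emb_eq_pt .
    then show ?thesis by simp
  qed
  moreover have "indicator K (pt j y t) = (0::real)" for t using False by (auto simp: indicator_def)
  ultimately show ?thesis by simp
next
  case True
  then obtain t0 where "pt j y t0 \<in> K" by blast
  then obtain l u where I: "l < u" "{t. pt j y t \<in> K} = {l<..<u}" by (rule fiber_interval[OF K])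
  obtain iu where iu: "iu \<in> face_idx K" "pt j y u \<in> face_set K iu"
    "\<forall>i'\<in>face_idx K. pt j y u \<in> face_set K i' \<longrightarrow> i' = iu"
    "sgn (onormal K (face_set K iu) $ j) = 1" "onormal K (face_set K iu) $ j \<noteq> 0"
    by (rule fiber_endpoint[OF K gen I(2,1), of u 1]) blast+
  obtain il where il: "il \<in> face_idx K" "pt j y l \<in> face_set K il"
    "\<forall>i'\<in>face_idx K. pt j y l \<in> face_set K i' \<longrightarrow> i' = il"
    "sgn (onormal K (face_set K il) $ j) = -1" "onormal K (face_set K il) $ j \<noteq> 0"
    by (rule fiber_endpoint[OF K gen I(2,1), of l "-1"]) blast+
  have ne: "iu \<noteq> il" using iu(4) il(4) by auto
  have xu: "x iu = pt j y u"
    unfolding x n by (rule face_emb[OF iu(1,5) y0[OF iu(1)] iu(2)])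
  have xl: "x il = pt j y l"
    unfolding x n by (rule face_emb[OF il(1,5) y0[OF il(1)] il(2)])
  have fu: "?f iu = g (pt j y u)" using iu(2,4,5) by (simp add: xu n)
  have fl: "?f il = - g (pt j y l)" using il(2,4,5) by (simp add: xl n)
  have f0: "?f i = 0" if i: "i \<in> face_idx K" "i \<noteq> iu" "i \<noteq> il" for i
  proof -
    have "x i \<notin> face_set K i"
    proof
      assume "x i \<in> face_set K i"
      then obtain t where t: "pt j y t \<in> face_set K i" unfolding x emb_eq_pt ..
      then have "pt j y t \<in> closure K - K" using face_set_subset[OF i(1)] by auto
      then have "t = l \<or> t = u" using fiber_frontier[OF K I(2,1)] by simp
      then show False using t i bspec[OF iu(3) i(1)] bspec[OF il(3) i(1)] by blast
    qed
    then show ?thesis by simp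
  qed
  have "(\<Sum>i\<in>face_idx K. ?f i) = (\<Sum>i\<in>{iu, il}. ?f i)"
  proof (rule sum.mono_neutral_right[OF finite_face_idx])
    show "{iu, il} \<subseteq> face_idx K" using iu(1) il(1) by blast
    show "\<forall>i\<in>face_idx K - {iu, il}. ?f i = 0" using f0 by blast
  qed
  also have "\<dots> = g (pt j y u) - g (pt j y l)" using ne fu fl by simp
  finally show ?thesis using fiber_FTC[OF I(2,1) g cont] by simp
qed

text \<open>The chart weight \<open>1 / \<bar>n $ j\<bar>\<close> times \<open>n $ j\<close> is
  exactly the sign that the fundamental theorem attaches to an end point. Faces parallel to the
  direction have \<open>n $ j = 0\<close> and contribute to neither side.\<close>

lemma divergence_idx:
  assumes K: "K \<in> \<K>"
    and g: "\<And>y t. ((\<lambda>t. g (pt j y t)) has_real_derivative g' (pt j y t)) (at t)"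
    and cont: "continuous_on UNIV g" "continuous_on UNIV g'"
  shows "integral K g' = (\<Sum>i\<in>face_idx K. surf_int (face_set K i) g * onormal K (face_set K i) $ j)"
proof -
  let ?M = "\<Pi>\<^sub>M i\<in>UNIV-{j}. (lborel::real measure)"
  let ?n = "\<lambda>i. onormal K (face_set K i)"
  define y0 where "y0 i = (SOME z. z \<in> face_set K i)" for i
  have y0: "y0 i \<in> face_set K i" if "i \<in> face_idx K" for i
    using face_idx_is_face[OF that] unfolding y0_def is_face_def by (simp add: some_in_eq)
  let ?x = "\<lambda>i y. emb j (?n i) (?n i \<bullet> y0 i) y"
  let ?h = "\<lambda>i y. if ?n i $ j = 0 then 0 else indicator (face_set K i) (?x i y) * g (?x i y) * sgn (?n i $ j)"
  have Kop: "open K" "bounded K" using element[OF K] by auto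
  have bm: "bddmeas (face_set K i) g" if "i \<in> face_idx K" for i
    using face_idx_is_face[OF that] continuous_imp_bddmeas[OF cont(1)] unfolding is_face_def by blast
  have int: "integrable ?M (?h i)" if i: "i \<in> face_idx K" for i
  proof (cases "?n i $ j = 0")
    case False
    have "integrable ?M (\<lambda>y. indicator (face_set K i) (?x i y) * g (?x i y) / 1)"
      using face_idx_is_face[OF i] bm[OF i] unfolding is_face_def by (intro integrable_chart) auto
    then show ?thesis using False by simp
  qed simp
  have "integral K g' = (LINT x | lborel. indicator K x * g' x)"
    using set_integrable_continuous[OF cont(2) Kop] by simp
  also have "\<dots> = (LINT y | ?M. LINT t | lborel. indicator K (pt j y t) * g' (pt j y t))"
    unfolding pt_def by (rule lborel_integral_fiber(1)[OF set_integrable_continuous(1)[OF cont(2) Kop]])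
  also have "\<dots> = (LINT y | ?M. (\<Sum>i\<in>face_idx K. ?h i y))"
  proof (rule integral_cong_AE)
    show "(\<lambda>y. LINT t | lborel. indicator K (pt j y t) * g' (pt j y t)) \<in> borel_measurable ?M"
      unfolding pt_def by (rule lborel_integral_fiber(2)[OF set_integrable_continuous(1)[OF cont(2) Kop]])
    show "(\<lambda>y. \<Sum>i\<in>face_idx K. ?h i y) \<in> borel_measurable ?M"
      using int by (intro borel_measurable_sum borel_measurable_integrable)
    show "AE y in ?M. (LINT t | lborel. indicator K (pt j y t) * g' (pt j y t)) = (\<Sum>i\<in>face_idx K. ?h i y)"
      using AE_generic[OF all_hs]
    proof eventually_elim
      case (elim y)
      then show ?case by (intro generic_fiber[OF K _ g cont(2) y0]) auto
    qed
  qed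
  also have "\<dots> = (\<Sum>i\<in>face_idx K. LINT y | ?M. ?h i y)"
    using int by (intro Bochner_Integration.integral_sum)
  also have "\<dots> = (\<Sum>i\<in>face_idx K. surf_int (face_set K i) g * ?n i $ j)"
  proof (rule sum.cong[OF refl])
    fix i assume i: "i \<in> face_idx K"
    show "(LINT y | ?M. ?h i y) = surf_int (face_set K i) g * ?n i $ j"
    proof (cases "?n i $ j = 0")
      case False
      have "surf_int (face_set K i) g = chart_int j (?n i) (?n i \<bullet> y0 i) (face_set K i) g"
        using face_idx_is_face[OF i] unfolding is_face_def
        by (intro surf_int_eq_chart bm i y0 False) auto
      then have "surf_int (face_set K i) g * ?n i $ j
          = (LINT y | ?M. indicator (face_set K i) (?x i y) * g (?x i y) / \<bar>?n i $ j\<bar> * ?n i $ j)"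
        unfolding chart_int_def by simp
      also have "\<dots> = (LINT y | ?M. ?h i y)"
        using False by (intro Bochner_Integration.integral_cong) (auto simp: sgn_real_def)
      finally show ?thesis by simp
    qed simp
  qed
  finally show ?thesis .
qed

lemma divergence:
  assumes K: "K \<in> \<K>"
    and g: "\<And>y t. ((\<lambda>t. g (pt j y t)) has_real_derivative g' (pt j y t)) (at t)"
    and cont: "continuous_on UNIV g" "continuous_on UNIV g'"
  shows "integral K g' = (\<Sum>K'\<in>{K'. (K, K') \<in> int_faces \<K>}. surf_int (fc K K') g * onormal K (fc K K') $ j)
      + (\<Sum>F\<in>{F. (K, F) \<in> bnd_faces Om \<K>}. surf_int F g * onormal K F $ j)"
  unfolding divergence_idx[OF assms] face_idx_def
  using finite_faces by (subst sum.Plus) auto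

end

section \<open>Broken polynomial spaces and the discrete forms\<close>

lemma polyfun_DERIV_pt:
  assumes "polyfun r p"
  shows "((\<lambda>t. p (pt j y t)) has_real_derivative pd p j (pt j y t)) (at t)"
proof -
  have eq: "pt j y = (\<lambda>t. pt j y 0 + t *\<^sub>R axis j 1)"
    by (auto simp: pt_def vec_eq_iff axis_def fun_eq_iff)
  have "((\<lambda>t. pt j y 0 + t *\<^sub>R axis j 1) has_derivative (\<lambda>h. h *\<^sub>R axis j 1)) (at t)"
    by (auto intro!: derivative_eq_intros)
  then have "(pt j y has_derivative (\<lambda>h. h *\<^sub>R axis j 1)) (at t)" using eq by metis
  from diff_chain_at[OF this polyfun_pd(2)[OF assms]]
  have "((p \<circ> pt j y) has_derivative (\<lambda>h. \<Sum>i\<in>UNIV. (h *\<^sub>R axis j (1::real)) $ i * pd p i (pt j y t))) (at t)"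
    by (simp add: o_def)
  moreover have "(\<Sum>i\<in>UNIV. (h *\<^sub>R axis j (1::real)) $ i * pd p i (pt j y t)) = h * pd p j (pt j y t)" for h
  proof -
    have "(\<Sum>i\<in>UNIV. (h *\<^sub>R axis j (1::real)) $ i * pd p i (pt j y t))
      = h * (\<Sum>i\<in>UNIV. axis j (1::real) $ i * pd p i (pt j y t))"
      by (simp add: sum_distrib_left mult.assoc)
    then show ?thesis by (simp add: sum_axis_mult)
  qed
  ultimately show ?thesis
    by (simp add: has_field_derivative_def o_def mult.commute[of _ "pd p j (pt j y t)"] mult_commute_abs)
qed

lemma pd_add:
  assumes "p differentiable at x" "q differentiable at x"
  shows "pd (\<lambda>x. p x + q x) j x = pd p j x + pd q j x"
proof -
  have "((\<lambda>x. p x + q x) has_derivative (\<lambda>h. frechet_derivative p (at x) h + frechet_derivative q (at x) h)) (at x)"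
    using assms by (intro has_derivative_add) (auto simp: frechet_derivative_works[symmetric])
  from frechet_derivative_at[OF this] show ?thesis unfolding pd_def by metis
qed

lemma pd_scaleR:
  assumes "p differentiable at x"
  shows "pd (\<lambda>x. c *\<^sub>R p x) j x = c *\<^sub>R pd p j x"
proof -
  have "((\<lambda>x. c *\<^sub>R p x) has_derivative (\<lambda>h. c *\<^sub>R frechet_derivative p (at x) h)) (at x)"
    using assms by (intro has_derivative_scaleR_right) (auto simp: frechet_derivative_works[symmetric])
  from frechet_derivative_at[OF this] show ?thesis unfolding pd_def by metis
qed

lemma pd_const [simp]: "pd (\<lambda>x. c) j x = 0"
  by (simp add: pd_def frechet_derivative_const)

lemma polyfun_differentiable: "polyfun r p \<Longrightarrow> p differentiable at x"
  using polyfun_pd(2) differentiable_def by blast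

lemma vpolyfun_has_derivative:
  assumes "vpolyfun r (w :: real^'n::finite \<Rightarrow> real^'n)"
  shows "(w has_derivative (\<lambda>h. \<chi> i. \<Sum>l\<in>UNIV. h$l * pd (\<lambda>x. w x $ i) l x)) (at x)"
proof -
  have "((\<lambda>x. \<chi> i. w x $ i) has_derivative (\<lambda>h. \<chi> i. \<Sum>l\<in>UNIV. h$l * pd (\<lambda>x. w x $ i) l x)) (at x)"
    using assms polyfun_pd(2) unfolding vpolyfun_def
    by (subst has_derivative_componentwise_within)
       (auto simp: Basis_vec_def inner_axis)
  then show ?thesis by simp
qed

lemma vpolyfun_differentiable: "vpolyfun r w \<Longrightarrow> w differentiable at x"
  using vpolyfun_has_derivative differentiable_def by blast

lemma vpolyfun_pd_nth:
  assumes "vpolyfun r (w :: real^'n::finite \<Rightarrow> real^'n)"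
  shows "pd w j x $ i = pd (\<lambda>x. w x $ i) j x"
proof -
  have "frechet_derivative w (at x) = (\<lambda>h. \<chi> i. \<Sum>l\<in>UNIV. h$l * pd (\<lambda>x. w x $ i) l x)"
    using frechet_derivative_at[OF vpolyfun_has_derivative[OF assms]] by simp
  then show ?thesis by (subst pd_def) (simp add: sum_axis_mult)
qed

lemma vpolyfun_polyfun_pd:
  assumes "vpolyfun r w" shows "polyfun (r - 1) (\<lambda>x. pd w j x $ i)"
  unfolding vpolyfun_pd_nth[OF assms] using assms polyfun_pd(1) unfolding vpolyfun_def by blast

lemma vpolyfun_continuous:
  assumes "vpolyfun r w"
  shows "continuous_on S w" "continuous_on S (\<lambda>x. pd w j x)"
proof -
  have "continuous_on S (\<lambda>x. \<chi> i. w x $ i)"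
    using assms polyfun_continuous unfolding vpolyfun_def by (intro continuous_on_vec_lambda) blast
  then show "continuous_on S w" by simp
  have "continuous_on S (\<lambda>x. \<chi> i. pd w j x $ i)"
    using vpolyfun_polyfun_pd[OF assms] polyfun_continuous by (intro continuous_on_vec_lambda) blast
  then show "continuous_on S (\<lambda>x. pd w j x)" by simp
qed

lemma vpolyfun_add: "vpolyfun r w \<Longrightarrow> vpolyfun r z \<Longrightarrow> vpolyfun r (\<lambda>x. w x + z x)"
  by (simp add: vpolyfun_def polyfun_add)

lemma vpolyfun_scaleR: "vpolyfun r w \<Longrightarrow> vpolyfun r (\<lambda>x. c *\<^sub>R w x)"
  by (simp add: vpolyfun_def polyfun_cmult)

lemma vpolyfun_zero [simp]: "vpolyfun r (\<lambda>x. 0)"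
  by (simp add: vpolyfun_def)

lemma subspace_Mh: "subspace (Mh \<K> r)"
  unfolding subspace_def Mh_def
  by (auto simp: zero_fun_def plus_fun_def scaleR_fun_def vpolyfun_add vpolyfun_scaleR)

lemma subspace_Ph: "subspace (Ph \<K> r)"
  unfolding subspace_def Ph_def
  by (auto simp: zero_fun_def plus_fun_def scaleR_fun_def polyfun_add polyfun_cmult)

lemma Mh_vpolyfun: "w \<in> Mh \<K> r \<Longrightarrow> vpolyfun r (w K)"
  by (cases "K \<in> \<K>") (auto simp: Mh_def)

lemma Ph_polyfun: "g \<in> Ph \<K> r \<Longrightarrow> polyfun r (g K)"
  by (cases "K \<in> \<K>") (auto simp: Ph_def)

lemma Mh_continuous:
  assumes "w \<in> Mh \<K> r"
  shows "continuous_on S (w K)" "continuous_on S (pd (w K) j)" "continuous_on S (vdiv (w K))"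
    "continuous_on S (gradn (w K) n)"
proof -
  note [continuous_intros] = vpolyfun_continuous[OF Mh_vpolyfun[OF assms]]
  show "continuous_on S (w K)" "continuous_on S (pd (w K) j)" by (intro continuous_intros)+
  have "continuous_on S (\<lambda>x. vdiv (w K) x)" "continuous_on S (\<lambda>x. gradn (w K) n x)"
    unfolding vdiv_def gradn_def by (intro continuous_intros)+
  then show "continuous_on S (vdiv (w K))" "continuous_on S (gradn (w K) n)" .
qed

lemma Mh_continuous2:
  assumes "w \<in> Mh \<K> r" "z \<in> Mh \<K> r"
  shows "continuous_on S (gradip (w K) (z K))" "continuous_on S (convd (w K) (z K))"
proof -
  note [continuous_intros] = vpolyfun_continuous[OF Mh_vpolyfun[OF assms(1)]]
    vpolyfun_continuous[OF Mh_vpolyfun[OF assms(2)]]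
  have "continuous_on S (\<lambda>x. gradip (w K) (z K) x)" "continuous_on S (\<lambda>x. convd (w K) (z K) x)"
    unfolding gradip_def convd_def by (intro continuous_intros)+
  then show "continuous_on S (gradip (w K) (z K))" "continuous_on S (convd (w K) (z K))" .
qed

lemma Ph_continuous:
  assumes "g \<in> Ph \<K> r"
  shows "continuous_on S (g K)" "continuous_on S (pd (g K) j)" "continuous_on S (sgrad (g K))"
proof -
  show "continuous_on S (g K)" by (rule polyfun_continuous[OF Ph_polyfun[OF assms]])
  show *: "continuous_on S (pd (g K) j)" for j
    by (rule polyfun_continuous[OF polyfun_pd(1)[OF Ph_polyfun[OF assms]]])
  have "continuous_on S (\<lambda>x. sgrad (g K) x)"
    unfolding sgrad_def by (intro continuous_intros *)
  then show "continuous_on S (sgrad (g K))" .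
qed

text \<open>The chart chosen by \<open>surf_int\<close> depends on F alone, so all integrals over F
  use one product measure. Linearity and positivity follow from this, whatever the choice
  was.\<close>

lemma surf_int_chart:
  "\<exists>k \<nu> c. \<forall>g. surf_int F g = chart_int k \<nu> c F g"
proof -
  have "indicator {y. emb k \<nu> c y \<in> F} y = (indicator F (emb k \<nu> c y) :: real)" for k \<nu> c y
    by (simp add: indicator_def)
  then show ?thesis
    unfolding surf_int_def chart_int_def Let_def emb_def[symmetric] by auto
qed

lemma surf_int_add:
  assumes "compact F" "bddmeas F g" "bddmeas F h"
  shows "surf_int F (\<lambda>x. g x + h x) = surf_int F g + surf_int F h"
proof -
  obtain k \<nu> c where eq: "\<And>g. surf_int F g = chart_int k \<nu> c F g" using surf_int_chart[of F] by blast
  show ?thesis unfolding eq chart_int_def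
    using Bochner_Integration.integral_add[OF integrable_chart[OF assms(1,2), of k \<nu> c "\<bar>\<nu>$k\<bar>"]
        integrable_chart[OF assms(1,3), of k \<nu> c "\<bar>\<nu>$k\<bar>"]]
    by (simp add: distrib_left add_divide_distrib)
qed

lemma surf_int_cmult: "surf_int F (\<lambda>x. c * g x) = c * surf_int F g"
proof -
  obtain k \<nu> b where eq: "\<And>g. surf_int F g = chart_int k \<nu> b F g" using surf_int_chart[of F] by blast
  have "indicator F (emb k \<nu> b y) * (c * g (emb k \<nu> b y)) / \<bar>\<nu>$k\<bar>
      = c * (indicator F (emb k \<nu> b y) * g (emb k \<nu> b y) / \<bar>\<nu>$k\<bar>)" for y by simp
  then show ?thesis unfolding eq chart_int_def by (metis (no_types, lifting) Bochner_Integration.integral_cong integral_mult_right_zero)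
qed

lemma surf_int_nonneg: "(\<And>x. x \<in> F \<Longrightarrow> 0 \<le> g x) \<Longrightarrow> 0 \<le> surf_int F g"
proof -
  assume nn: "\<And>x. x \<in> F \<Longrightarrow> 0 \<le> g x"
  obtain k \<nu> b where eq: "\<And>g. surf_int F g = chart_int k \<nu> b F g" using surf_int_chart[of F] by blast
  show ?thesis unfolding eq chart_int_def
    using nn by (intro Bochner_Integration.integral_nonneg) (auto simp: indicator_def)
qed

lemma bddmeas_add: "bddmeas F g \<Longrightarrow> bddmeas F h \<Longrightarrow> bddmeas F (\<lambda>x. g x + h x)"
  unfolding bddmeas_def by (auto intro!: bounded_plus_comp)

lemma bddmeas_cmult: "bddmeas F g \<Longrightarrow> bddmeas F (\<lambda>x. c * g x)"
proof -
  assume g: "bddmeas F g"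
  then obtain B where "\<And>x. x \<in> F \<Longrightarrow> \<bar>g x\<bar> \<le> B" by (auto simp: bddmeas_def bounded_iff)
  then have "\<bar>c * g x\<bar> \<le> \<bar>c\<bar> * B" if "x \<in> F" for x
    using that by (simp add: abs_mult mult_left_mono)
  then show ?thesis using g unfolding bddmeas_def bounded_iff by auto
qed

section \<open>Sums over elements and faces, and the broken divergence theorem\<close>

context mesh
begin

text \<open>Together with \<open>IS\<close> and \<open>BS\<close>, this lets every discrete form be
  handled as a linear functional of its integrand.\<close>

definition VS :: "((real^'n) set \<Rightarrow> real^'n \<Rightarrow> real) \<Rightarrow> real" where
  "VS h = (\<Sum>K\<in>\<K>. integral K (h K))"

definition IS :: "((real^'n) set \<Rightarrow> (real^'n) set \<Rightarrow> real^'n \<Rightarrow> real) \<Rightarrow> real" where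
  "IS h = (1/2) * (\<Sum>(K1,K2)\<in>int_faces \<K>. surf_int (fc K1 K2) (h K1 K2))"

definition BS :: "((real^'n) set \<Rightarrow> (real^'n) set \<Rightarrow> real^'n \<Rightarrow> real) \<Rightarrow> real" where
  "BS h = (\<Sum>(K,F)\<in>bnd_faces Om \<K>. surf_int F (h K F))"

definition igood :: "((real^'n) set \<Rightarrow> (real^'n) set \<Rightarrow> real^'n \<Rightarrow> real) \<Rightarrow> bool" where
  "igood h \<longleftrightarrow> (\<forall>K1 K2. (K1, K2) \<in> int_faces \<K> \<longrightarrow> bddmeas (fc K1 K2) (h K1 K2))"

definition bgood :: "((real^'n) set \<Rightarrow> (real^'n) set \<Rightarrow> real^'n \<Rightarrow> real) \<Rightarrow> bool" where
  "bgood h \<longleftrightarrow> (\<forall>K F. (K, F) \<in> bnd_faces Om \<K> \<longrightarrow> bddmeas F (h K F))"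

lemma compact_faces:
  "(K1, K2) \<in> int_faces \<K> \<Longrightarrow> compact (fc K1 K2)" "(K, F) \<in> bnd_faces Om \<K> \<Longrightarrow> compact F"
  using int_face(1) bnd_face(1) by (auto simp: is_face_def)

lemma igoodI: "(\<And>K1 K2. continuous_on UNIV (h K1 K2)) \<Longrightarrow> igood h"
  unfolding igood_def using continuous_imp_bddmeas compact_faces by blast

lemma bgoodI: "(\<And>K F. continuous_on UNIV (h K F)) \<Longrightarrow> bgood h"
  unfolding bgood_def using continuous_imp_bddmeas compact_faces by blast

lemma VS_cong: "(\<And>K x. K \<in> \<K> \<Longrightarrow> h K x = h' K x) \<Longrightarrow> VS h = VS h'"
  unfolding VS_def by (intro sum.cong integral_cong) auto

lemma VS_add:
  assumes "\<And>K. continuous_on UNIV (h K)" "\<And>K. continuous_on UNIV (h' K)"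
  shows "VS (\<lambda>K x. h K x + h' K x) = VS h + VS h'"
  unfolding VS_def sum.distrib[symmetric]
  using assms element(5,7) by (intro sum.cong refl Henstock_Kurzweil_Integration.integral_add set_integrable_continuous(2)) auto

lemma VS_cmult: "VS (\<lambda>K x. c * h K x) = c * VS h"
  unfolding VS_def sum_distrib_left by simp

lemma VS_nonneg:
  assumes "\<And>K. continuous_on UNIV (h K)" "\<And>K x. 0 \<le> h K x" shows "0 \<le> VS h"
  unfolding VS_def using assms element(5,7)
  by (intro sum_nonneg Henstock_Kurzweil_Integration.integral_nonneg set_integrable_continuous(2)) auto

lemma VS_mono:
  assumes "\<And>K. continuous_on UNIV (h K)" "\<And>K. continuous_on UNIV (h' K)" "\<And>K x. h K x \<le> h' K x"
  shows "VS h \<le> VS h'"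
  unfolding VS_def using assms element(5,7)
  by (intro sum_mono integral_le set_integrable_continuous(2)) auto

lemma IS_cong: "(\<And>K1 K2 x. h K1 K2 x = h' K1 K2 x) \<Longrightarrow> IS h = IS h'"
proof -
  assume "\<And>K1 K2 x. h K1 K2 x = h' K1 K2 x"
  then have "h = h'" by (intro ext)
  then show ?thesis by simp
qed

lemma IS_add: "igood h \<Longrightarrow> igood h' \<Longrightarrow> IS (\<lambda>K1 K2 x. h K1 K2 x + h' K1 K2 x) = IS h + IS h'"
  unfolding IS_def distrib_left[symmetric] sum.distrib[symmetric]
  by (intro arg_cong[where f="\<lambda>s. 1/2 * s"] sum.cong refl)
     (auto simp: igood_def intro!: surf_int_add compact_faces(1))

lemma IS_cmult: "IS (\<lambda>K1 K2 x. c * h K1 K2 x) = c * IS h"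
  unfolding IS_def by (simp add: surf_int_cmult sum_distrib_left split_def mult_ac)

lemma IS_nonneg: "(\<And>K1 K2 x. 0 \<le> h K1 K2 x) \<Longrightarrow> 0 \<le> IS h"
  unfolding IS_def by (auto intro!: sum_nonneg surf_int_nonneg)

lemma BS_add: "bgood h \<Longrightarrow> bgood h' \<Longrightarrow> BS (\<lambda>K F x. h K F x + h' K F x) = BS h + BS h'"
  unfolding BS_def sum.distrib[symmetric]
  by (intro sum.cong refl) (auto simp: bgood_def intro!: surf_int_add compact_faces(2))

lemma BS_cmult: "BS (\<lambda>K F x. c * h K F x) = c * BS h"
  unfolding BS_def by (simp add: surf_int_cmult sum_distrib_left split_def)

lemma BS_nonneg: "(\<And>K F x. 0 \<le> h K F x) \<Longrightarrow> 0 \<le> BS h"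
  unfolding BS_def by (auto intro!: sum_nonneg surf_int_nonneg)

lemma IS_swap: "IS h = IS (\<lambda>K1 K2. h K2 K1)"
proof -
  have "(\<Sum>(K1,K2)\<in>int_faces \<K>. surf_int (fc K1 K2) (h K1 K2))
      = (\<Sum>(K1,K2)\<in>int_faces \<K>. surf_int (fc K1 K2) (h K2 K1))"
    by (rule sum.reindex_bij_witness[of _ prod.swap prod.swap])
       (auto simp: int_faces_sym fc_def Int_commute prod.swap_def)
  then show ?thesis by (simp add: IS_def)
qed

text \<open>Only the sum over the two orderings of a face matters. The energy integrand of the
  convective form has no sign for one ordering alone.\<close>

lemma IS_nonneg_sym:
  assumes "igood h" "\<And>K1 K2 x. (K1, K2) \<in> int_faces \<K> \<Longrightarrow> 0 \<le> h K1 K2 x + h K2 K1 x"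
  shows "0 \<le> IS h"
proof -
  have good: "igood (\<lambda>K1 K2. h K2 K1)"
    using assms(1) unfolding igood_def by (metis fc_def inf_commute int_faces_sym)
  have "2 * IS h = IS h + IS (\<lambda>K1 K2. h K2 K1)" using IS_swap[of h] by simp
  also have "\<dots> = IS (\<lambda>K1 K2 x. h K1 K2 x + h K2 K1 x)" by (rule IS_add[OF assms(1) good, symmetric])
  also have "\<dots> \<ge> 0" unfolding IS_def using assms(2) by (auto intro!: sum_nonneg surf_int_nonneg)
  finally show ?thesis by simp
qed

text \<open>Summation over the elements meets each interior face from both sides, and the opposite
  normals combine the two traces into a jump.\<close>

lemma broken_divergence:
  assumes d: "\<And>K j y t. ((\<lambda>t. \<psi> K j (pt j y t)) has_real_derivative d\<psi> K j (pt j y t)) (at t)"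
    and cont: "\<And>K j. continuous_on UNIV (\<psi> K j)" "\<And>K j. continuous_on UNIV (d\<psi> K j)"
  shows "VS (\<lambda>K x. \<Sum>j\<in>UNIV. d\<psi> K j x) =
    IS (\<lambda>K1 K2 x. \<Sum>j\<in>UNIV. (\<psi> K1 j x - \<psi> K2 j x) * onormal K1 (fc K1 K2) $ j)
    + BS (\<lambda>K F x. \<Sum>j\<in>UNIV. \<psi> K j x * onormal K F $ j)"
proof -
  let ?h = "\<lambda>K1 K2 x. \<Sum>j\<in>UNIV. \<psi> K1 j x * onormal K1 (fc K1 K2) $ j"
  let ?b = "\<lambda>K F x. \<Sum>j\<in>UNIV. \<psi> K j x * onormal K F $ j"
  have surf_sum: "surf_int F (\<lambda>x. \<Sum>j\<in>J. \<psi> K j x * n $ j) = (\<Sum>j\<in>J. surf_int F (\<psi> K j) * n $ j)"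
    if "compact F" "finite J" for F K n J
    using that(2)
  proof (induction J)
    case empty
    then show ?case using surf_int_cmult[of F 0 "\<lambda>_. 0"] by simp
  next
    case (insert i J)
    have "surf_int F (\<lambda>x. \<psi> K i x * n $ i + (\<Sum>j\<in>J. \<psi> K j x * n $ j))
        = surf_int F (\<lambda>x. \<psi> K i x * n $ i) + surf_int F (\<lambda>x. \<Sum>j\<in>J. \<psi> K j x * n $ j)"
      using that(1) cont(1) by (intro surf_int_add continuous_imp_bddmeas continuous_intros) auto
    then show ?case using insert surf_int_cmult[of F "n $ i" "\<psi> K i"] by (simp add: mult.commute)
  qed
  have el: "integral K (\<lambda>x. \<Sum>j\<in>UNIV. d\<psi> K j x) =
      (\<Sum>K'\<in>{K'. (K, K') \<in> int_faces \<K>}. surf_int (fc K K') (?h K K'))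
      + (\<Sum>F\<in>{F. (K, F) \<in> bnd_faces Om \<K>}. surf_int F (?b K F))" if K: "K \<in> \<K>" for K
  proof -
    have "integral K (\<lambda>x. \<Sum>j\<in>UNIV. d\<psi> K j x) = (\<Sum>j\<in>UNIV. integral K (d\<psi> K j))"
      using cont(2) element(5,7)[OF K] by (intro integral_sum set_integrable_continuous(2)) auto
    also have "\<dots> = (\<Sum>j\<in>UNIV. (\<Sum>K'\<in>{K'. (K, K') \<in> int_faces \<K>}. surf_int (fc K K') (\<psi> K j) * onormal K (fc K K') $ j)
      + (\<Sum>F\<in>{F. (K, F) \<in> bnd_faces Om \<K>}. surf_int F (\<psi> K j) * onormal K F $ j))"
      by (intro sum.cong refl divergence[OF K d cont])
    also have "\<dots> = (\<Sum>K'\<in>{K'. (K, K') \<in> int_faces \<K>}. \<Sum>j\<in>UNIV. surf_int (fc K K') (\<psi> K j) * onormal K (fc K K') $ j)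
      + (\<Sum>F\<in>{F. (K, F) \<in> bnd_faces Om \<K>}. \<Sum>j\<in>UNIV. surf_int F (\<psi> K j) * onormal K F $ j)"
      unfolding sum.distrib
      by (intro arg_cong2[where f="(+)"]) (rule sum.swap)+
    also have "\<dots> = (\<Sum>K'\<in>{K'. (K, K') \<in> int_faces \<K>}. surf_int (fc K K') (?h K K'))
      + (\<Sum>F\<in>{F. (K, F) \<in> bnd_faces Om \<K>}. surf_int F (?b K F))"
      by (intro arg_cong2[where f="(+)"] sum.cong refl surf_sum[symmetric]) (auto intro: compact_faces)
    finally show ?thesis .
  qed
  have sig1: "(\<Sum>K\<in>\<K>. \<Sum>K'\<in>{K'. (K, K') \<in> int_faces \<K>}. f K K') = (\<Sum>(K,K')\<in>int_faces \<K>. f K K')" for f :: "_ \<Rightarrow> _ \<Rightarrow> real"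
  proof -
    have "int_faces \<K> = Sigma \<K> (\<lambda>K. {K'. (K, K') \<in> int_faces \<K>})" by (auto simp: int_faces_def)
    then show ?thesis using finite_mesh finite_faces(3) by (subst sum.Sigma) auto
  qed
  have sig2: "(\<Sum>K\<in>\<K>. \<Sum>F\<in>{F. (K, F) \<in> bnd_faces Om \<K>}. f K F) = (\<Sum>(K,F)\<in>bnd_faces Om \<K>. f K F)" for f :: "_ \<Rightarrow> _ \<Rightarrow> real"
  proof -
    have "bnd_faces Om \<K> = Sigma \<K> (\<lambda>K. {F. (K, F) \<in> bnd_faces Om \<K>})" by (auto simp: bnd_faces_def)
    then show ?thesis using finite_mesh finite_faces(4) by (subst sum.Sigma) auto
  qed
  have good: "igood ?h" "igood (\<lambda>K1 K2. ?h K2 K1)" using cont(1) by (auto intro!: igoodI continuous_intros)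
  \<comment> \<open>The elementwise sums run over ordered pairs without a weight, while
    \<open>IS\<close> carries one half; the factor 2 is then used up by pairing each face with its
    reverse.\<close>
  have "VS (\<lambda>K x. \<Sum>j\<in>UNIV. d\<psi> K j x) = 2 * IS ?h + BS ?b"
    unfolding VS_def IS_def BS_def using el by (simp add: sum.distrib sig1 sig2)
  also have "2 * IS ?h = IS ?h + IS (\<lambda>K1 K2. ?h K2 K1)"
    using IS_swap[of ?h] by simp
  also have "\<dots> = IS (\<lambda>K1 K2 x. ?h K1 K2 x + ?h K2 K1 x)"
    by (rule IS_add[OF good, symmetric])
  also have "\<dots> = IS (\<lambda>K1 K2 x. \<Sum>j\<in>UNIV. (\<psi> K1 j x - \<psi> K2 j x) * onormal K1 (fc K1 K2) $ j)"
  proof -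
    have "?h K1 K2 x + ?h K2 K1 x = (\<Sum>j\<in>UNIV. (\<psi> K1 j x - \<psi> K2 j x) * onormal K1 (fc K1 K2) $ j)"
      if "(K1, K2) \<in> int_faces \<K>" for K1 K2 x
    proof -
      have "onormal K2 (fc K2 K1) = - onormal K1 (fc K1 K2)"
        using int_face(2)[OF that] by (simp add: fc_def Int_commute)
      then show ?thesis by (simp add: sum.distrib[symmetric] left_diff_distrib)
    qed
    then show ?thesis unfolding IS_def by (intro arg_cong[where f="\<lambda>s. 1/2 * s"] sum.cong refl) auto
  qed
  finally show ?thesis .
qed

end

lemma Mh_pd_add:
  assumes "w \<in> Mh \<K> r" "z \<in> Mh \<K> r"
  shows "pd ((w + z) K) j x = pd (w K) j x + pd (z K) j x"
  using pd_add[OF vpolyfun_differentiable[OF Mh_vpolyfun[OF assms(1)]] vpolyfun_differentiable[OF Mh_vpolyfun[OF assms(2)]]]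
  by (simp add: plus_fun_def)

lemma Mh_pd_scaleR:
  assumes "w \<in> Mh \<K> r"
  shows "pd ((c *\<^sub>R w) K) j x = c *\<^sub>R pd (w K) j x"
  using pd_scaleR[OF vpolyfun_differentiable[OF Mh_vpolyfun[OF assms]]]
  by (simp add: scaleR_fun_def)

lemma Ph_sgrad_add:
  assumes "w \<in> Ph \<K> r" "z \<in> Ph \<K> r"
  shows "sgrad ((w + z) K) x = sgrad (w K) x + sgrad (z K) x"
  using pd_add[OF polyfun_differentiable[OF Ph_polyfun[OF assms(1)]] polyfun_differentiable[OF Ph_polyfun[OF assms(2)]]]
  by (simp add: plus_fun_def sgrad_def vec_eq_iff)

lemma Ph_sgrad_scaleR:
  assumes "w \<in> Ph \<K> r"
  shows "sgrad ((c *\<^sub>R w) K) x = c *\<^sub>R sgrad (w K) x"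
  using pd_scaleR[OF polyfun_differentiable[OF Ph_polyfun[OF assms]]]
  by (simp add: scaleR_fun_def sgrad_def vec_eq_iff)

text \<open>Cauchy-Schwarz over the diagonal entries of the gradient.\<close>

lemma vdiv_sq_le: "(vdiv (w :: real^'n::finite \<Rightarrow> real^'n) x)\<^sup>2 \<le> real CARD('n) * gradip w w x"
proof -
  have "(vdiv w x)\<^sup>2 = (\<Sum>j\<in>UNIV. 1 * (pd w j x $ j))\<^sup>2" by (simp add: vdiv_def)
  also have "\<dots> \<le> (\<Sum>j\<in>(UNIV::'n set). 1\<^sup>2) * (\<Sum>j\<in>UNIV. (pd w j x $ j)\<^sup>2)"
    by (rule Cauchy_Schwarz_ineq_sum)
  also have "\<dots> \<le> real CARD('n) * (\<Sum>j\<in>UNIV. pd w j x \<bullet> pd w j x)"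
  proof -
    have "(\<Sum>j\<in>UNIV. (pd w j x $ j)\<^sup>2) \<le> (\<Sum>j\<in>UNIV. pd w j x \<bullet> pd w j x)"
    proof (rule sum_mono)
      fix j
      have "\<bar>pd w j x $ j\<bar> \<le> norm (pd w j x)" by (rule component_le_norm_cart)
      then have "(pd w j x $ j)\<^sup>2 \<le> (norm (pd w j x))\<^sup>2" by (metis abs_ge_zero power2_abs power_mono)
      then show "(pd w j x $ j)\<^sup>2 \<le> pd w j x \<bullet> pd w j x" by (simp add: power2_norm_eq_inner)
    qed
    then show ?thesis by (simp add: mult_left_mono)
  qed
  finally show ?thesis by (simp add: gradip_def)
qed

lemma pd_component_sq_le: "(pd (w :: real^'n::finite \<Rightarrow> real^'n) l x $ i)\<^sup>2 \<le> gradip w w x"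
proof -
  have "\<bar>pd w l x $ i\<bar> \<le> norm (pd w l x)" by (rule component_le_norm_cart)
  then have "(pd w l x $ i)\<^sup>2 \<le> (norm (pd w l x))\<^sup>2" by (metis abs_ge_zero power2_abs power_mono)
  also have "\<dots> = pd w l x \<bullet> pd w l x" by (simp add: power2_norm_eq_inner)
  also have "\<dots> \<le> (\<Sum>j\<in>UNIV. pd w j x \<bullet> pd w j x)" by (rule member_le_sum) auto
  finally show ?thesis by (simp add: gradip_def)
qed

lemma sum_flux_jump:
  fixes p q n :: "real^'n::finite"
  shows "(\<Sum>j\<in>UNIV. (p $ j * \<alpha> - q $ j * \<beta>) * n $ j) = (p \<bullet> n) * \<alpha> - (q \<bullet> n) * \<beta>"
  unfolding inner_vec_def sum_distrib_right sum_subtractf[symmetric]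
  by (rule sum.cong) (auto simp: algebra_simps)

lemma hF_nonneg: "0 \<le> 1 / hF F"
  by (simp add: hF_def)

section \<open>Broken polynomial spaces, integration by parts and the convective form\<close>

locale dg_space = mesh Om \<K> for Om :: "(real^'n::finite) set" and \<K> +
  fixes r1 r2 :: nat
  assumes r1: "r1 \<ge> 1" and r12: "r1 \<le> r2 + 1" and r21: "r2 \<le> r1 + 1"
begin

abbreviation "M \<equiv> Mh \<K> r1"
abbreviation "P \<equiv> Ph \<K> r2"

lemma vip_VS: "vip \<K> u w = VS (\<lambda>K x. u K x \<bullet> w K x)"
  by (simp add: vip_def VS_def)

lemma sip_VS: "sip \<K> u w = VS (\<lambda>K x. u K x * w K x)"
  by (simp add: sip_def VS_def)

sublocale V: semi_inner M "vip \<K>"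
proof
  show "subspace M" by (rule subspace_Mh)
  show "vip \<K> (x + y) z = vip \<K> x z + vip \<K> y z" if "x \<in> M" "y \<in> M" "z \<in> M" for x y z
    unfolding vip_VS using that
    by (subst VS_add[symmetric])
       (auto simp: inner_add_left intro!: continuous_intros Mh_continuous(1)[OF that(1)] Mh_continuous(1)[OF that(2)]
          Mh_continuous(1)[OF that(3)])
  show "vip \<K> (c *\<^sub>R x) z = c * vip \<K> x z" for x z c
    unfolding vip_VS by (subst VS_cmult[symmetric]) simp
  show "vip \<K> x y = vip \<K> y x" for x y
    unfolding vip_VS by (simp add: inner_commute)
  show "0 \<le> vip \<K> x x" if "x \<in> M" for x
    unfolding vip_VS by (auto intro!: VS_nonneg continuous_intros Mh_continuous(1)[OF that])
qed

sublocale S: semi_inner P "sip \<K>"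
proof
  show "subspace P" by (rule subspace_Ph)
  show "sip \<K> (x + y) z = sip \<K> x z + sip \<K> y z" if "x \<in> P" "y \<in> P" "z \<in> P" for x y z
    unfolding sip_VS using that
    by (subst VS_add[symmetric])
       (auto simp: distrib_right intro!: continuous_intros Ph_continuous(1)[OF that(1)] Ph_continuous(1)[OF that(2)]
          Ph_continuous(1)[OF that(3)])
  show "sip \<K> (c *\<^sub>R x) z = c * sip \<K> x z" for x z c
    unfolding sip_VS by (subst VS_cmult[symmetric]) (simp add: mult.assoc)
  show "sip \<K> x y = sip \<K> y x" for x y
    unfolding sip_VS by (simp add: mult.commute)
  show "0 \<le> sip \<K> x x" if "x \<in> P" for x
    unfolding sip_VS by (auto intro!: VS_nonneg continuous_intros Ph_continuous(1)[OF that])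
qed

text \<open>By continuity the function vanishes on each element, and then everywhere because it is a
  polynomial there. Definiteness later turns the variational pressure update into an equation
  between functions.\<close>

lemma sip_definite:
  assumes g: "g \<in> P" and z: "sip \<K> g g = 0"
  shows "g = 0"
proof -
  have c: "continuous_on S (\<lambda>x. g K x * g K x)" for S K
    by (intro continuous_intros Ph_continuous(1)[OF g])
  have int: "(\<lambda>x. g K x * g K x) integrable_on K" if "K \<in> \<K>" for K
    using c element(5,7)[OF that] by (intro set_integrable_continuous(2)) auto
  have "g K = (\<lambda>x. 0)" for K
  proof (cases "K \<in> \<K>")
    case True
    have "\<forall>K\<in>\<K>. integral K (\<lambda>x. g K x * g K x) = 0"
      using z finite_mesh int unfolding sip_def
      by (subst (asm) sum_nonneg_eq_0_iff) (auto intro!: Henstock_Kurzweil_Integration.integral_nonneg)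
    then have K0: "integral K (\<lambda>x. g K x * g K x) = 0" using True by blast
    have "g K x = 0" if x: "x \<in> K" for x
    proof -
      obtain a b where ab: "x \<in> box a b" "cbox a b \<subseteq> K"
        using open_contains_cbox[of K] element(5)[OF True] x by (metis)
      have ic: "(\<lambda>x. g K x * g K x) integrable_on cbox a b" by (intro integrable_continuous c)
      have "integral (cbox a b) (\<lambda>x. g K x * g K x) \<le> integral K (\<lambda>x. g K x * g K x)"
        using ab ic int[OF True] by (intro integral_subset_le) auto
      moreover have "0 \<le> integral (cbox a b) (\<lambda>x. g K x * g K x)"
        using ic by (intro Henstock_Kurzweil_Integration.integral_nonneg) auto
      ultimately have "integral (cbox a b) (\<lambda>x. g K x * g K x) = 0" using K0 by simp
      then have "((\<lambda>x. g K x * g K x) has_integral 0) (cbox a b)" using ic integrable_integral by metis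
      then have "g K x * g K x = 0"
        using has_integral_0_cbox_imp_0[OF c, of a b K x] ab(1) box_subset_cbox by fastforce
      then show ?thesis by simp
    qed
    then show ?thesis using polyfun_eq_0_if_open[OF Ph_polyfun[OF g]] element(1,5)[OF True] by blast
  next
    case False
    then show ?thesis using g by (simp add: Ph_def)
  qed
  then show ?thesis by (simp add: fun_eq_iff)
qed

definition gradf :: "'n sfam \<Rightarrow> 'n vfam" where "gradf g = (\<lambda>K x. sgrad (g K) x)"

text \<open>Here and in \<open>div_in\<close> and \<open>pd_component_in\<close> the coupling of the
  degrees is used: pressure gradients are admissible velocities, and first derivatives of velocities
  are admissible pressures. Lifts may thus be tested with them.\<close>

lemma gradf_in: "g \<in> P \<Longrightarrow> gradf g \<in> M"
proof -
  assume g: "g \<in> P"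
  have "polyfun r1 (pd (g K) i)" for K i
    using polyfun_mono[OF polyfun_pd(1)[OF Ph_polyfun[OF g]]] r21 by simp
  then have "vpolyfun r1 (sgrad (g K))" for K by (simp add: vpolyfun_def sgrad_def)
  moreover have "sgrad (g K) = (\<lambda>x. 0)" if "K \<notin> \<K>" for K
  proof -
    have "g K = (\<lambda>_. 0)" using g that by (simp add: Ph_def)
    then show ?thesis by (intro ext) (simp add: sgrad_def vec_eq_iff)
  qed
  ultimately show ?thesis by (auto simp: gradf_def Mh_def)
qed

lemma div_in: "w \<in> M \<Longrightarrow> (\<lambda>K x. vdiv (w K) x) \<in> P"
proof -
  assume w: "w \<in> M"
  have "polyfun r2 (\<lambda>x. pd (w K) i x $ i)" for K i
    using polyfun_mono[OF vpolyfun_polyfun_pd[OF Mh_vpolyfun[OF w]]] r12 by simp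
  then have "polyfun r2 (\<lambda>x. vdiv (w K) x)" for K unfolding vdiv_def by (intro polyfun_sum)
  moreover have "vdiv (w K) = (\<lambda>x. 0)" if "K \<notin> \<K>" for K
  proof -
    have "w K = (\<lambda>_. 0)" using w that by (simp add: Mh_def)
    then show ?thesis by (intro ext) (simp add: vdiv_def)
  qed
  ultimately show ?thesis by (auto simp: Ph_def)
qed

lemma pd_component_in: "w \<in> M \<Longrightarrow> (\<lambda>K x. pd (w K) l x $ i) \<in> P"
proof -
  assume w: "w \<in> M"
  have "polyfun r2 (\<lambda>x. pd (w K) l x $ i)" for K
    using polyfun_mono[OF vpolyfun_polyfun_pd[OF Mh_vpolyfun[OF w]]] r12 by simp
  moreover have "(\<lambda>x. pd (w K) l x $ i) = (\<lambda>x. 0)" if "K \<notin> \<K>" for K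
  proof -
    have "w K = (\<lambda>_. 0)" using w that by (simp add: Mh_def)
    then show ?thesis by simp
  qed
  ultimately show ?thesis by (auto simp: Ph_def)
qed

text \<open>The normal flux of this field is \<open>w $ i\<close> times the l-th entry of the
  normal, so its lift isolates one entry of the tensor product of jump and normal.\<close>

lemma component_in: "w \<in> M \<Longrightarrow> (\<lambda>K x. (w K x $ i) *\<^sub>R axis l 1) \<in> M"
proof -
  assume w: "w \<in> M"
  have "polyfun r1 (\<lambda>x. w K x $ i)" for K using Mh_vpolyfun[OF w] by (simp add: vpolyfun_def)
  then have "polyfun r1 (\<lambda>x. ((w K x $ i) *\<^sub>R axis l 1) $ k)" for K k
    using polyfun_cmult[of r1 "\<lambda>x. w K x $ i" "axis l 1 $ k"] by (simp add: mult.commute)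
  then show ?thesis using w by (auto simp: Mh_def vpolyfun_def)
qed

lemma liftR_rhs_eq: "liftR_rhs Om \<K> w g =
    IS (\<lambda>K1 K2 x. ((1/2) * (g K1 x + g K2 x)) * ((w K1 x - w K2 x) \<bullet> onormal K1 (fc K1 K2)))
  + BS (\<lambda>K F x. g K x * (w K x \<bullet> onormal K F))"
  by (simp add: liftR_rhs_def IS_def BS_def Let_def)

lemma liftG_rhs_eq: "liftG_rhs \<K> g w =
    IS (\<lambda>K1 K2 x. (((1/2) *\<^sub>R (w K1 x + w K2 x)) \<bullet> onormal K1 (fc K1 K2)) * (g K1 x - g K2 x))"
  by (simp add: liftG_rhs_def IS_def Let_def)

lemma bform_eq_liftG: "bform \<K> w g = - vip \<K> (gradf g) w + liftG_rhs \<K> g w"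
  by (simp add: bform_def liftG_rhs_def vip_def gradf_def inner_commute)

text \<open>Broken divergence theorem for the flux of g times w, moving the derivative from g to
  w.\<close>

lemma bform_eq_liftR:
  assumes w: "w \<in> M" and g: "g \<in> P"
  shows "bform \<K> w g = sip \<K> (\<lambda>K x. vdiv (w K) x) g - liftR_rhs Om \<K> w g"
proof -
  note cw = Mh_continuous[OF w] note cg = Ph_continuous[OF g]
  let ?\<psi> = "\<lambda>K j x. g K x * w K x $ j"
  let ?d = "\<lambda>K j x. pd (g K) j x * w K x $ j + g K x * pd (w K) j x $ j"
  let ?n = "\<lambda>K1 K2. onormal K1 (fc K1 K2)"
  have "VS (\<lambda>K x. \<Sum>j\<in>UNIV. ?d K j x) =
    IS (\<lambda>K1 K2 x. \<Sum>j\<in>UNIV. (?\<psi> K1 j x - ?\<psi> K2 j x) * ?n K1 K2 $ j)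
    + BS (\<lambda>K F x. \<Sum>j\<in>UNIV. ?\<psi> K j x * onormal K F $ j)"
  proof (rule broken_divergence)
    fix K j y t
    have wj: "polyfun r1 (\<lambda>x. w K x $ j)" using Mh_vpolyfun[OF w] by (simp add: vpolyfun_def)
    show "((\<lambda>t. ?\<psi> K j (pt j y t)) has_real_derivative ?d K j (pt j y t)) (at t)"
      using DERIV_mult[OF polyfun_DERIV_pt[OF Ph_polyfun[OF g], of K j y t] polyfun_DERIV_pt[OF wj, of j y t]]
      by (simp add: vpolyfun_pd_nth[OF Mh_vpolyfun[OF w]] add.commute mult.commute)
  qed (intro continuous_intros cw cg)+
  moreover have "VS (\<lambda>K x. \<Sum>j\<in>UNIV. ?d K j x) = vip \<K> (gradf g) w + sip \<K> (\<lambda>K x. vdiv (w K) x) g"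
  proof -
    have "VS (\<lambda>K x. \<Sum>j\<in>UNIV. ?d K j x) = VS (\<lambda>K x. (sgrad (g K) x \<bullet> w K x) + (vdiv (w K) x * g K x))"
      by (rule VS_cong) (simp add: sum.distrib inner_vec_def sgrad_def vdiv_def sum_distrib_left mult.commute)
    also have "\<dots> = VS (\<lambda>K x. sgrad (g K) x \<bullet> w K x) + VS (\<lambda>K x. vdiv (w K) x * g K x)"
      by (rule VS_add) (intro continuous_intros cw cg)+
    finally show ?thesis by (simp add: vip_VS sip_VS gradf_def)
  qed
  \<comment> \<open>Jump of a product: averaged flux times jump of g, plus averaged g times jump of
    the flux.\<close>
  moreover have "IS (\<lambda>K1 K2 x. \<Sum>j\<in>UNIV. (?\<psi> K1 j x - ?\<psi> K2 j x) * ?n K1 K2 $ j)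
     = IS (\<lambda>K1 K2 x. (((1/2) *\<^sub>R (w K1 x + w K2 x)) \<bullet> ?n K1 K2) * (g K1 x - g K2 x)
        + ((1/2) * (g K1 x + g K2 x)) * ((w K1 x - w K2 x) \<bullet> ?n K1 K2))"
  proof (rule IS_cong)
    fix K1 K2 x
    have "(\<Sum>j\<in>UNIV. (?\<psi> K1 j x - ?\<psi> K2 j x) * ?n K1 K2 $ j)
      = g K1 x * (w K1 x \<bullet> ?n K1 K2) - g K2 x * (w K2 x \<bullet> ?n K1 K2)"
      by (simp add: inner_vec_def sum_distrib_left sum_subtractf left_diff_distrib mult.assoc)
    also have "\<dots> = (((1/2) *\<^sub>R (w K1 x + w K2 x)) \<bullet> ?n K1 K2) * (g K1 x - g K2 x)
        + ((1/2) * (g K1 x + g K2 x)) * ((w K1 x - w K2 x) \<bullet> ?n K1 K2)"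
      by (simp add: inner_add_left inner_diff_left field_simps)
    finally show "(\<Sum>j\<in>UNIV. (?\<psi> K1 j x - ?\<psi> K2 j x) * ?n K1 K2 $ j) = \<dots>" .
  qed
  moreover have "\<dots> = IS (\<lambda>K1 K2 x. (((1/2) *\<^sub>R (w K1 x + w K2 x)) \<bullet> ?n K1 K2) * (g K1 x - g K2 x))
     + IS (\<lambda>K1 K2 x. ((1/2) * (g K1 x + g K2 x)) * ((w K1 x - w K2 x) \<bullet> ?n K1 K2))"
    by (rule IS_add) (intro igoodI continuous_intros cw cg)+
  moreover have "BS (\<lambda>K F x. \<Sum>j\<in>UNIV. ?\<psi> K j x * onormal K F $ j) = BS (\<lambda>K F x. g K x * (w K x \<bullet> onormal K F))"
    by (simp add: inner_vec_def sum_distrib_left mult.assoc)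
  ultimately show ?thesis
    unfolding bform_eq_liftG liftG_rhs_eq liftR_rhs_eq by simp
qed

text \<open>With the inflow normal flux \<open>s = {z} \<bullet> n < 0\<close>, an interior face contributes
  \<open>\<bar>s\<bar> / 2\<close> times the squared jump of \<open>\<phi>\<close> after integration by parts.\<close>

lemma Ac_nonneg:
  assumes z: "z \<in> M" and \<phi>: "\<phi> \<in> M"
  shows "0 \<le> Ac Om \<K> z z \<phi> \<phi>"
proof -
  note cz = Mh_continuous[OF z] note cp = Mh_continuous[OF \<phi>]
  let ?\<psi> = "\<lambda>K j x. z K x $ j * (\<phi> K x \<bullet> \<phi> K x)"
  let ?d = "\<lambda>K j x. pd (z K) j x $ j * (\<phi> K x \<bullet> \<phi> K x) + z K x $ j * (2 * (\<phi> K x \<bullet> pd (\<phi> K) j x))"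
  let ?n = "\<lambda>K1 K2. onormal K1 (fc K1 K2)"
  let ?s = "\<lambda>K1 K2 x. ((1/2) *\<^sub>R (z K1 x + z K2 x)) \<bullet> ?n K1 K2"
  let ?I1 = "\<lambda>K1 K2 x. \<Sum>j\<in>UNIV. (?\<psi> K1 j x - ?\<psi> K2 j x) * ?n K1 K2 $ j"
  let ?B1 = "\<lambda>K F x. (z K x \<bullet> onormal K F) * (\<phi> K x \<bullet> \<phi> K x)"
  let ?I2 = "\<lambda>K1 K2 x. ((z K1 x - z K2 x) \<bullet> ?n K1 K2) * ((1/2) * (\<phi> K1 x \<bullet> \<phi> K1 x + \<phi> K2 x \<bullet> \<phi> K2 x))"
  let ?I3 = "\<lambda>K1 K2 x. if ?s K1 K2 x < 0 then \<bar>?s K1 K2 x\<bar> * ((\<phi> K1 x - \<phi> K2 x) \<bullet> \<phi> K1 x) else 0"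
  let ?B3 = "\<lambda>K F x. if z K x \<bullet> onormal K F < 0 then \<bar>z K x \<bullet> onormal K F\<bar> * (\<phi> K x \<bullet> \<phi> K x) else 0"
  have "VS (\<lambda>K x. \<Sum>j\<in>UNIV. ?d K j x) = IS ?I1 + BS (\<lambda>K F x. \<Sum>j\<in>UNIV. ?\<psi> K j x * onormal K F $ j)"
  proof (rule broken_divergence)
    fix K j y t
    have zj: "polyfun r1 (\<lambda>x. z K x $ i)" and pj: "polyfun r1 (\<lambda>x. \<phi> K x $ i)" for i
      using Mh_vpolyfun[OF z] Mh_vpolyfun[OF \<phi>] by (simp_all add: vpolyfun_def)
    have "((\<lambda>t. \<Sum>i\<in>UNIV. \<phi> K (pt j y t) $ i * \<phi> K (pt j y t) $ i) has_real_derivative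
       (\<Sum>i\<in>UNIV. pd (\<lambda>x. \<phi> K x $ i) j (pt j y t) * \<phi> K (pt j y t) $ i + pd (\<lambda>x. \<phi> K x $ i) j (pt j y t) * \<phi> K (pt j y t) $ i)) (at t)"
      by (intro DERIV_sum DERIV_mult polyfun_DERIV_pt[OF pj])
    then have "((\<lambda>t. \<phi> K (pt j y t) \<bullet> \<phi> K (pt j y t)) has_real_derivative
        2 * (\<phi> K (pt j y t) \<bullet> pd (\<phi> K) j (pt j y t))) (at t)"
      by (simp add: inner_vec_def vpolyfun_pd_nth[OF Mh_vpolyfun[OF \<phi>]] sum.distrib sum_distrib_left mult.commute)
    from DERIV_mult[OF polyfun_DERIV_pt[OF zj[of j], of j y t] this]
    show "((\<lambda>t. ?\<psi> K j (pt j y t)) has_real_derivative ?d K j (pt j y t)) (at t)"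
      by (simp add: vpolyfun_pd_nth[OF Mh_vpolyfun[OF z]] mult.commute)
  qed (intro continuous_intros cz cp)+
  moreover have "BS (\<lambda>K F x. \<Sum>j\<in>UNIV. ?\<psi> K j x * onormal K F $ j) = BS ?B1"
    by (simp add: inner_vec_def sum_distrib_right mult_ac)
  moreover have "VS (\<lambda>K x. convd (z K) (\<phi> K) x \<bullet> \<phi> K x + (1/2) * vdiv (z K) x * (\<phi> K x \<bullet> \<phi> K x))
      = 1/2 * VS (\<lambda>K x. \<Sum>j\<in>UNIV. ?d K j x)"
  proof -
    have e: "convd (z K) (\<phi> K) x \<bullet> \<phi> K x + (1/2) * vdiv (z K) x * (\<phi> K x \<bullet> \<phi> K x) = 1/2 * (\<Sum>j\<in>UNIV. ?d K j x)" for K x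
      by (simp add: convd_def vdiv_def inner_sum_left inner_sum_right sum.distrib sum_distrib_left sum_distrib_right
          algebra_simps inner_commute)
    show ?thesis unfolding VS_cmult[symmetric] by (rule VS_cong) (rule e)
  qed
  ultimately have vol: "VS (\<lambda>K x. convd (z K) (\<phi> K) x \<bullet> \<phi> K x + (1/2) * vdiv (z K) x * (\<phi> K x \<bullet> \<phi> K x))
      = 1/2 * IS ?I1 + 1/2 * BS ?B1" by simp
  \<comment> \<open>The upwind sum of \<open>Ac\<close> runs over both orderings with full weight,
    whence \<open>2 * IS\<close>. The subtracted half of \<open>BS ?B1\<close> cancels the boundary
    part of the volume term.\<close>
  have Ac: "Ac Om \<K> z z \<phi> \<phi> = VS (\<lambda>K x. convd (z K) (\<phi> K) x \<bullet> \<phi> K x + (1/2) * vdiv (z K) x * (\<phi> K x \<bullet> \<phi> K x))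
     - 1/2 * (IS ?I2 + BS ?B1) + 2 * IS ?I3 + BS ?B3"
    by (simp add: Ac_def VS_def IS_def BS_def Let_def)
  have B3: "0 \<le> BS ?B3" by (rule BS_nonneg) (auto intro: mult_nonpos_nonneg)
  have bm3: "bddmeas F (?I3 K1 K2)" if "compact F" for F K1 K2
  proof -
    have cs: "continuous_on S (?s K1 K2)" for S by (intro continuous_intros cz)
    have ch: "continuous_on S (\<lambda>x. \<bar>?s K1 K2 x\<bar> * ((\<phi> K1 x - \<phi> K2 x) \<bullet> \<phi> K1 x))" for S
      by (intro continuous_intros cz cp)
    have "bounded ((\<lambda>x. \<bar>?s K1 K2 x\<bar> * ((\<phi> K1 x - \<phi> K2 x) \<bullet> \<phi> K1 x)) ` F)"
      using that ch by (intro compact_imp_bounded compact_continuous_image)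
    then obtain b where b: "\<And>x. x \<in> F \<Longrightarrow> \<bar>\<bar>?s K1 K2 x\<bar> * ((\<phi> K1 x - \<phi> K2 x) \<bullet> \<phi> K1 x)\<bar> \<le> b"
      unfolding bounded_iff by auto
    have "norm (?I3 K1 K2 x) \<le> \<bar>b\<bar>" if "x \<in> F" for x
      using b[OF that] by (cases "?s K1 K2 x < 0") auto
    then have "bounded (?I3 K1 K2 ` F)" unfolding bounded_iff by (intro exI[of _ "\<bar>b\<bar>"]) blast
    moreover have "?I3 K1 K2 \<in> borel_measurable borel"
    proof (rule measurable_If)
      show "{x \<in> space borel. ?s K1 K2 x < 0} \<in> sets borel"
        using borel_measurable_continuous_onI[OF cs] by measurable
    qed (use borel_measurable_continuous_onI[OF ch] in auto)
    ultimately show ?thesis unfolding bddmeas_def by blast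
  qed
  have g3: "igood ?I3" unfolding igood_def using bm3 compact_faces(1) by blast
  have g1: "igood ?I1" by (intro igoodI continuous_intros cz cp)
  have g2: "igood ?I2" by (intro igoodI continuous_intros cz cp)
  have ig_cmult: "igood (\<lambda>K1 K2 x. c * h K1 K2 x)" if "igood h" for c h
    using that unfolding igood_def by (blast intro: bddmeas_cmult)
  have ig_add: "igood (\<lambda>K1 K2 x. h K1 K2 x + h' K1 K2 x)" if "igood h" "igood h'" for h h'
    using that unfolding igood_def by (blast intro: bddmeas_add)
  have "0 \<le> IS (\<lambda>K1 K2 x. (1/2 * ?I1 K1 K2 x + (-1/2) * ?I2 K1 K2 x) + 2 * ?I3 K1 K2 x)"
  proof (rule IS_nonneg_sym)
    show "igood (\<lambda>K1 K2 x. (1/2 * ?I1 K1 K2 x + (-1/2) * ?I2 K1 K2 x) + 2 * ?I3 K1 K2 x)"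
      by (intro ig_add ig_cmult g1 g2 g3)
    fix K1 K2 x assume K: "(K1, K2) \<in> int_faces \<K>"
    have n: "?n K2 K1 = - ?n K1 K2" using int_face(2)[OF K] by (simp add: fc_def Int_commute)
    define a where "a = \<phi> K1 x" define b where "b = \<phi> K2 x"
    define s where "s = ?s K1 K2 x"
    have s2: "?s K2 K1 x = - s" unfolding s_def n by (simp add: add.commute)
    have I12: "1/2 * ?I1 K1 K2 x + (-1/2) * ?I2 K1 K2 x = 1/2 * (s * (a \<bullet> a - b \<bullet> b))"
    proof -
      have "?I1 K1 K2 x = (z K1 x \<bullet> ?n K1 K2) * (a \<bullet> a) - (z K2 x \<bullet> ?n K1 K2) * (b \<bullet> b)"
        unfolding a_def b_def by (rule sum_flux_jump)
      then show ?thesis unfolding s_def a_def b_def by (simp add: inner_add_left inner_diff_left field_simps)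
    qed
    have I21: "1/2 * ?I1 K2 K1 x + (-1/2) * ?I2 K2 K1 x = 1/2 * (s * (a \<bullet> a - b \<bullet> b))"
    proof -
      have "?I1 K2 K1 x = (z K1 x \<bullet> ?n K1 K2) * (a \<bullet> a) - (z K2 x \<bullet> ?n K1 K2) * (b \<bullet> b)"
        unfolding a_def b_def n sum_flux_jump by simp
      then show ?thesis unfolding s_def a_def b_def n by (simp add: inner_add_left inner_diff_left field_simps)
    qed
    have I3: "?I3 K1 K2 x = (if s < 0 then \<bar>s\<bar> * ((a - b) \<bullet> a) else 0)"
      by (simp add: s_def a_def b_def)
    have I3': "?I3 K2 K1 x = (if s > 0 then \<bar>s\<bar> * ((b - a) \<bullet> b) else 0)"
      unfolding s2 by (simp add: a_def b_def)
    have sq: "0 \<le> (a - b) \<bullet> (a - b)" by simp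
    have e: "(a - b) \<bullet> (a - b) = a \<bullet> a - 2 * (a \<bullet> b) + b \<bullet> b"
      by (simp add: inner_diff_left inner_diff_right inner_commute)
    \<comment> \<open>Whichever ordering is the inflow one, its upwind term completes the difference
      of squared traces to the squared jump.\<close>
    have "((1/2) * (s * (a \<bullet> a - b \<bullet> b)) + 2 * (if s < 0 then \<bar>s\<bar> * ((a - b) \<bullet> a) else 0))
        + ((1/2) * (s * (a \<bullet> a - b \<bullet> b)) + 2 * (if s > 0 then \<bar>s\<bar> * ((b - a) \<bullet> b) else 0))
        = \<bar>s\<bar> * ((a - b) \<bullet> (a - b))"
      unfolding e by (cases s "0::real" rule: linorder_cases)
        (simp_all add: inner_diff_left inner_commute algebra_simps)
    then show "0 \<le> ((1/2 * ?I1 K1 K2 x + (-1/2) * ?I2 K1 K2 x) + 2 * ?I3 K1 K2 x)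
       + ((1/2 * ?I1 K2 K1 x + (-1/2) * ?I2 K2 K1 x) + 2 * ?I3 K2 K1 x)"
      unfolding I12 I21 I3 I3' using sq by simp
  qed
  also have "\<dots> = 1/2 * IS ?I1 + (-1/2) * IS ?I2 + 2 * IS ?I3"
    by (subst IS_add, (intro ig_add ig_cmult g1 g2 g3)+, subst IS_add, (intro ig_cmult g1 g2)+, simp only: IS_cmult)
  finally have "0 \<le> 1/2 * IS ?I1 + (-1/2) * IS ?I2 + 2 * IS ?I3" .
  moreover have "0 \<le> (1/2 * a + 1/2 * d) - 1/2 * (b + d) + 2 * c + e"
    if "0 \<le> 1/2 * a + (-1/2) * b + 2 * c" "0 \<le> e" for a b c d e :: real
    using that by (simp add: add_divide_distrib)
  ultimately show ?thesis unfolding Ac vol using B3 by blast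
qed

end

context mesh
begin

text \<open>Admissibility of the partial sums is carried along because additivity of
  \<open>IS\<close> requires it in the induction.\<close>

lemma IS_sum:
  assumes "finite I" "\<And>i. i \<in> I \<Longrightarrow> igood (h i)"
  shows "IS (\<lambda>K1 K2 x. \<Sum>i\<in>I. h i K1 K2 x) = (\<Sum>i\<in>I. IS (h i)) \<and> igood (\<lambda>K1 K2 x. \<Sum>i\<in>I. h i K1 K2 x)"
  using assms
proof (induction I)
  case empty
  have "igood (\<lambda>K1 K2 x. 0)" by (intro igoodI continuous_intros)
  moreover have "IS (\<lambda>K1 K2 x. 0) = 0" using IS_cmult[of 0 "\<lambda>_ _ _. 0"] by simp
  ultimately show ?case by simp
next
  case (insert i I)
  have g: "igood (h i)" "igood (\<lambda>K1 K2 x. \<Sum>i\<in>I. h i K1 K2 x)"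
    and eq: "IS (\<lambda>K1 K2 x. \<Sum>i\<in>I. h i K1 K2 x) = (\<Sum>i\<in>I. IS (h i))" using insert by auto
  have "igood (\<lambda>K1 K2 x. h i K1 K2 x + (\<Sum>i\<in>I. h i K1 K2 x))"
    using g unfolding igood_def by (intro allI impI bddmeas_add) auto
  then show ?case using insert.hyps IS_add[OF g] eq by simp
qed

lemma BS_sum:
  assumes "finite I" "\<And>i. i \<in> I \<Longrightarrow> bgood (h i)"
  shows "BS (\<lambda>K F x. \<Sum>i\<in>I. h i K F x) = (\<Sum>i\<in>I. BS (h i)) \<and> bgood (\<lambda>K F x. \<Sum>i\<in>I. h i K F x)"
  using assms
proof (induction I)
  case empty
  have "bgood (\<lambda>K F x. 0)" by (intro bgoodI continuous_intros)
  moreover have "BS (\<lambda>K F x. 0) = 0" using BS_cmult[of 0 "\<lambda>_ _ _. 0"] by simp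
  ultimately show ?case by simp
next
  case (insert i I)
  have g: "bgood (h i)" "bgood (\<lambda>K F x. \<Sum>i\<in>I. h i K F x)"
    and eq: "BS (\<lambda>K F x. \<Sum>i\<in>I. h i K F x) = (\<Sum>i\<in>I. BS (h i))" using insert by auto
  have "bgood (\<lambda>K F x. h i K F x + (\<Sum>i\<in>I. h i K F x))"
    using g unfolding bgood_def by (intro allI impI bddmeas_add) auto
  then show ?case using insert.hyps BS_add[OF g] eq by simp
qed

lemma IS_mono:
  assumes "igood h" "igood h'" "\<And>K1 K2 x. h K1 K2 x \<le> h' K1 K2 x" shows "IS h \<le> IS h'"
proof -
  have g': "igood (\<lambda>K1 K2 x. (-1) * h K1 K2 x)"
    using assms(1) unfolding igood_def by (blast intro: bddmeas_cmult)
  have "0 \<le> IS (\<lambda>K1 K2 x. h' K1 K2 x + (-1) * h K1 K2 x)" using assms(3) by (intro IS_nonneg) simp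
  also have "\<dots> = IS h' + (-1) * IS h" unfolding IS_add[OF assms(2) g'] IS_cmult ..
  finally show ?thesis by simp
qed

lemma BS_mono:
  assumes "bgood h" "bgood h'" "\<And>K F x. h K F x \<le> h' K F x" shows "BS h \<le> BS h'"
proof -
  have g': "bgood (\<lambda>K F x. (-1) * h K F x)"
    using assms(1) unfolding bgood_def by (blast intro: bddmeas_cmult)
  have "0 \<le> BS (\<lambda>K F x. h' K F x + (-1) * h K F x)" using assms(3) by (intro BS_nonneg) simp
  also have "\<dots> = BS h' + (-1) * BS h" unfolding BS_add[OF assms(2) g'] BS_cmult ..
  finally show ?thesis by simp
qed

end

section \<open>Viscous and pressure forms expressed by lifts\<close>

context dg_space
begin

definition jip :: "'n vfam \<Rightarrow> 'n vfam \<Rightarrow> real" where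
  "jip u w = IS (\<lambda>K1 K2 x. 1 / hF (fc K1 K2) * ((u K1 x - u K2 x) \<bullet> (w K1 x - w K2 x)))
    + BS (\<lambda>K F x. 1 / hF F * (u K x \<bullet> w K x))"

definition sjip :: "'n sfam \<Rightarrow> 'n sfam \<Rightarrow> real" where
  "sjip v g = IS (\<lambda>K1 K2 x. 1 / hF (fc K1 K2) * ((v K1 x - v K2 x) * (g K1 x - g K2 x)))"

lemma vjump_h_eq: "vjump_h Om \<K> w = jip w w"
  by (simp add: vjump_h_def jip_def IS_def BS_def Let_def surf_int_cmult power2_norm_eq_inner del: times_divide_eq_left)

lemma sjump_h_eq: "sjump_h \<K> g = sjip g g"
  by (simp add: sjump_h_def sjip_def IS_def Let_def surf_int_cmult power2_eq_square del: times_divide_eq_left)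

sublocale J: semi_inner M jip
proof
  show "subspace M" by (rule subspace_Mh)
  show "jip (x + y) z = jip x z + jip y z" if h: "x \<in> M" "y \<in> M" "z \<in> M" for x y z
  proof -
    note c = Mh_continuous(1)[OF h(1)] Mh_continuous(1)[OF h(2)] Mh_continuous(1)[OF h(3)]
    have "IS (\<lambda>K1 K2 t. 1 / hF (fc K1 K2) * (((x + y) K1 t - (x + y) K2 t) \<bullet> (z K1 t - z K2 t)))
      = IS (\<lambda>K1 K2 t. 1 / hF (fc K1 K2) * ((x K1 t - x K2 t) \<bullet> (z K1 t - z K2 t))
        + 1 / hF (fc K1 K2) * ((y K1 t - y K2 t) \<bullet> (z K1 t - z K2 t)))"
      by (rule IS_cong) (simp add: inner_add_left inner_diff_left add_divide_distrib diff_divide_distrib)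
    also have "\<dots> = IS (\<lambda>K1 K2 t. 1 / hF (fc K1 K2) * ((x K1 t - x K2 t) \<bullet> (z K1 t - z K2 t)))
        + IS (\<lambda>K1 K2 t. 1 / hF (fc K1 K2) * ((y K1 t - y K2 t) \<bullet> (z K1 t - z K2 t)))"
      by (rule IS_add) (intro igoodI continuous_intros c)+
    finally have 1: "IS (\<lambda>K1 K2 t. 1 / hF (fc K1 K2) * (((x + y) K1 t - (x + y) K2 t) \<bullet> (z K1 t - z K2 t))) = \<dots>" .
    have "BS (\<lambda>K F t. 1 / hF F * ((x + y) K t \<bullet> z K t)) = BS (\<lambda>K F t. 1 / hF F * (x K t \<bullet> z K t) + 1 / hF F * (y K t \<bullet> z K t))"
      by (simp add: inner_add_left add_divide_distrib)
    also have "\<dots> = BS (\<lambda>K F t. 1 / hF F * (x K t \<bullet> z K t)) + BS (\<lambda>K F t. 1 / hF F * (y K t \<bullet> z K t))"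
      by (rule BS_add) (intro bgoodI continuous_intros c)+
    finally have 2: "BS (\<lambda>K F t. 1 / hF F * ((x + y) K t \<bullet> z K t)) = \<dots>" .
    show ?thesis unfolding jip_def 1 2 by simp
  qed
  show "jip (c *\<^sub>R x) z = c * jip x z" for x z c
  proof -
    have 1: "IS (\<lambda>K1 K2 t. 1 / hF (fc K1 K2) * (((c *\<^sub>R x) K1 t - (c *\<^sub>R x) K2 t) \<bullet> (z K1 t - z K2 t)))
      = IS (\<lambda>K1 K2 t. c * (1 / hF (fc K1 K2) * ((x K1 t - x K2 t) \<bullet> (z K1 t - z K2 t))))"
      by (rule IS_cong) (simp add: scaleR_right_diff_distrib[symmetric])
    have 2: "BS (\<lambda>K F t. 1 / hF F * ((c *\<^sub>R x) K t \<bullet> z K t)) = BS (\<lambda>K F t. c * (1 / hF F * (x K t \<bullet> z K t)))"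
      by simp
    show ?thesis unfolding jip_def 1 2 IS_cmult BS_cmult by (simp add: distrib_left)
  qed
  show "jip x y = jip y x" for x y unfolding jip_def by (simp add: inner_commute)
  show "0 \<le> jip x x" for x
    unfolding jip_def using hF_nonneg by (intro add_nonneg_nonneg IS_nonneg BS_nonneg mult_nonneg_nonneg) auto
qed

definition gip :: "'n vfam \<Rightarrow> 'n vfam \<Rightarrow> real" where
  "gip u w = VS (\<lambda>K x. gradip (u K) (w K) x)"

sublocale G: semi_inner M gip
proof
  show "subspace M" by (rule subspace_Mh)
  show "gip (x + y) z = gip x z + gip y z" if h: "x \<in> M" "y \<in> M" "z \<in> M" for x y z
  proof -
    have "gip (x + y) z = VS (\<lambda>K t. gradip (x K) (z K) t + gradip (y K) (z K) t)"
      unfolding gip_def by (rule VS_cong) (simp only: gradip_def Mh_pd_add[OF h(1,2)] inner_add_left sum.distrib)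
    also have "\<dots> = gip x z + gip y z" unfolding gip_def
      by (rule VS_add) (rule Mh_continuous2(1)[OF h(1,3)] Mh_continuous2(1)[OF h(2,3)])+
    finally show ?thesis .
  qed
  show "gip (c *\<^sub>R x) z = c * gip x z" if h: "x \<in> M" for x z c
    unfolding gip_def VS_cmult[symmetric]
    by (rule VS_cong) (simp only: gradip_def Mh_pd_scaleR[OF h] inner_scaleR_left sum_distrib_left)
  show "gip x y = gip y x" for x y unfolding gip_def gradip_def by (simp add: inner_commute)
  show "0 \<le> gip x x" if "x \<in> M" for x
    unfolding gip_def by (rule VS_nonneg[OF Mh_continuous2(1)[OF that that]]) (auto simp: gradip_def intro: sum_nonneg)
qed

text \<open>The consistency term of \<open>Aeps\<close>; with its arguments exchanged it is the term
  weighted by \<open>\<epsilon>\<close>.\<close>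

definition fluxf :: "'n vfam \<Rightarrow> 'n vfam \<Rightarrow> real" where
  "fluxf u w = IS (\<lambda>K1 K2 x. ((1/2) *\<^sub>R (gradn (u K1) (onormal K1 (fc K1 K2)) x + gradn (u K2) (onormal K1 (fc K1 K2)) x))
      \<bullet> (w K1 x - w K2 x)) + BS (\<lambda>K F x. gradn (u K) (onormal K F) x \<bullet> w K x)"

lemma Aeps_eq:
  assumes u: "u \<in> M" and w: "w \<in> M"
  shows "Aeps Om \<K> \<sigma> \<epsilon> u w = gip u w + \<sigma> * jip u w - fluxf u w + \<epsilon> * fluxf w u"
proof -
  note c = Mh_continuous[OF u] Mh_continuous[OF w]
  let ?n = "\<lambda>K1 K2. onormal K1 (fc K1 K2)"
  let ?f = "\<lambda>u w K1 K2 x. ((1/2) *\<^sub>R (gradn (u K1) (?n K1 K2) x + gradn (u K2) (?n K1 K2) x)) \<bullet> (w K1 x - w K2 x)"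
  let ?j = "\<lambda>K1 K2 x. 1 / hF (fc K1 K2) * ((u K1 x - u K2 x) \<bullet> (w K1 x - w K2 x))"
  have good: "igood (?f u w)" "igood (?f w u)" "igood ?j" "igood (\<lambda>K1 K2 x. (-1) * ?f u w K1 K2 x)"
    "igood (\<lambda>K1 K2 x. \<epsilon> * ?f w u K1 K2 x)" "igood (\<lambda>K1 K2 x. \<sigma> * ?j K1 K2 x)"
    "igood (\<lambda>K1 K2 x. (-1) * ?f u w K1 K2 x + \<epsilon> * ?f w u K1 K2 x)"
    by (intro igoodI continuous_intros c)+
  let ?g = "\<lambda>u w K F x. gradn (u K) (onormal K F) x \<bullet> w K x"
  let ?k = "\<lambda>K F x. 1 / hF F * (u K x \<bullet> w K x)"
  have goodb: "bgood (?g u w)" "bgood (?g w u)" "bgood ?k" "bgood (\<lambda>K1 K2 x. (-1) * ?g u w K1 K2 x)"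
    "bgood (\<lambda>K1 K2 x. \<epsilon> * ?g w u K1 K2 x)" "bgood (\<lambda>K1 K2 x. \<sigma> * ?k K1 K2 x)"
    "bgood (\<lambda>K1 K2 x. (-1) * ?g u w K1 K2 x + \<epsilon> * ?g w u K1 K2 x)"
    by (intro bgoodI continuous_intros c)+
  have "Aeps Om \<K> \<sigma> \<epsilon> u w = gip u w + IS (\<lambda>K1 K2 x. ((-1) * ?f u w K1 K2 x + \<epsilon> * ?f w u K1 K2 x) + \<sigma> * ?j K1 K2 x)
     + BS (\<lambda>K F x. ((-1) * ?g u w K F x + \<epsilon> * ?g w u K F x) + \<sigma> * ?k K F x)"
    by (simp add: Aeps_def gip_def VS_def IS_def BS_def Let_def)
  also have "\<dots> = gip u w + ((-1) * IS (?f u w) + \<epsilon> * IS (?f w u) + \<sigma> * IS ?j)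
      + ((-1) * BS (?g u w) + \<epsilon> * BS (?g w u) + \<sigma> * BS ?k)"
    unfolding IS_add[OF good(7,6)] IS_add[OF good(4,5)] BS_add[OF goodb(7,6)] BS_add[OF goodb(4,5)] IS_cmult BS_cmult ..
  also have "\<dots> = gip u w + \<sigma> * jip u w - fluxf u w + \<epsilon> * fluxf w u"
    by (simp add: jip_def fluxf_def algebra_simps)
  finally show ?thesis .
qed

lemma dGsq_eq: "dGsq Om \<K> \<sigma> w = gip w w + \<sigma> * jip w w"
proof -
  have "\<sigma> * jip w w = IS (\<lambda>K1 K2 x. \<sigma> * (1 / hF (fc K1 K2) * ((w K1 x - w K2 x) \<bullet> (w K1 x - w K2 x))))
    + BS (\<lambda>K F x. \<sigma> * (1 / hF F * (w K x \<bullet> w K x)))"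
    unfolding IS_cmult BS_cmult jip_def by (simp add: distrib_left)
  also have "\<dots> = (1/2) * (\<Sum>(K1,K2)\<in>int_faces \<K>. (let F = fc K1 K2 in
        \<sigma> / hF F * surf_int F (\<lambda>x. (norm (w K1 x - w K2 x))\<^sup>2)))
   + (\<Sum>(K,F)\<in>bnd_faces Om \<K>. \<sigma> / hF F * surf_int F (\<lambda>x. (norm (w K x))\<^sup>2))"
    unfolding IS_def BS_def Let_def surf_int_cmult power2_norm_eq_inner by simp
  finally show ?thesis by (simp add: dGsq_def gip_def VS_def)
qed

lemma jip_component_le:
  assumes w: "w \<in> M"
  shows "jip (\<lambda>K x. (w K x $ i) *\<^sub>R axis l (1::real)) (\<lambda>K x. (w K x $ i) *\<^sub>R axis l (1::real)) \<le> jip w w"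
proof -
  note c = Mh_continuous(1)[OF w]
  have ax: "((a $ i) *\<^sub>R axis l (1::real)) \<bullet> ((a $ i) *\<^sub>R axis l (1::real)) \<le> a \<bullet> a" for a :: "real^'n"
  proof -
    have "((a $ i) *\<^sub>R axis l (1::real)) \<bullet> ((a $ i) *\<^sub>R axis l (1::real)) = (a $ i)\<^sup>2"
      by (simp add: power2_eq_square inner_axis_axis)
    also have "\<dots> \<le> (norm a)\<^sup>2"
      using component_le_norm_cart[of a i] by (metis abs_ge_zero power2_abs power_mono)
    finally show ?thesis by (simp add: power2_norm_eq_inner)
  qed
  have df: "(w K1 x $ i) *\<^sub>R axis l (1::real) - (w K2 x $ i) *\<^sub>R axis l (1::real) = ((w K1 x - w K2 x) $ i) *\<^sub>R axis l (1::real)" for K1 K2 x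
    by (simp add: scaleR_left_diff_distrib)
  show ?thesis unfolding jip_def df
  proof (rule add_mono)
    show "IS (\<lambda>K1 K2 x. 1 / hF (fc K1 K2) * (((w K1 x - w K2 x) $ i) *\<^sub>R axis l (1::real) \<bullet> ((w K1 x - w K2 x) $ i) *\<^sub>R axis l (1::real)))
      \<le> IS (\<lambda>K1 K2 x. 1 / hF (fc K1 K2) * ((w K1 x - w K2 x) \<bullet> (w K1 x - w K2 x)))"
    proof (rule IS_mono)
      fix K1 K2 x
      show "1 / hF (fc K1 K2) * (((w K1 x - w K2 x) $ i) *\<^sub>R axis l (1::real) \<bullet> ((w K1 x - w K2 x) $ i) *\<^sub>R axis l (1::real))
        \<le> 1 / hF (fc K1 K2) * ((w K1 x - w K2 x) \<bullet> (w K1 x - w K2 x))"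
        using ax[of "w K1 x - w K2 x"] hF_nonneg by (rule mult_left_mono)
    qed (intro igoodI continuous_intros c)+
    show "BS (\<lambda>K F x. 1 / hF F * ((w K x $ i) *\<^sub>R axis l (1::real) \<bullet> (w K x $ i) *\<^sub>R axis l (1::real))) \<le> BS (\<lambda>K F x. 1 / hF F * (w K x \<bullet> w K x))"
    proof (rule BS_mono)
      fix K F x
      show "1 / hF F * ((w K x $ i) *\<^sub>R axis l (1::real) \<bullet> (w K x $ i) *\<^sub>R axis l (1::real)) \<le> 1 / hF F * (w K x \<bullet> w K x)"
        using ax[of "w K x"] hF_nonneg by (rule mult_left_mono)
    qed (intro bgoodI continuous_intros c)+
  qed
qed

text \<open>Entrywise, the integrand is a sum of averaged partial derivatives of u, each times one
  component of the jump of w and one entry of the normal. Each summand is the functional that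
  defines the lift of a field as in \<open>component_in\<close>.\<close>

lemma fluxf_eq_liftR:
  assumes u: "u \<in> M" and w: "w \<in> M"
  shows "fluxf u w = (\<Sum>(i,l)\<in>UNIV. liftR_rhs Om \<K> (\<lambda>K x. (w K x $ i) *\<^sub>R axis l 1) (\<lambda>K x. pd (u K) l x $ i))"
proof -
  note c = Mh_continuous[OF u] Mh_continuous[OF w]
  let ?n = "\<lambda>K1 K2. onormal K1 (fc K1 K2)"
  let ?h = "\<lambda>p K1 K2 x. ((1/2) * (pd (u K1) (snd p) x $ fst p + pd (u K2) (snd p) x $ fst p))
     * (((w K1 x $ fst p) *\<^sub>R axis (snd p) 1 - (w K2 x $ fst p) *\<^sub>R axis (snd p) 1) \<bullet> ?n K1 K2)"
  let ?b = "\<lambda>p K F x. pd (u K) (snd p) x $ fst p * (((w K x $ fst p) *\<^sub>R axis (snd p) 1) \<bullet> onormal K F)"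
  have df: "(a $ i) *\<^sub>R axis l (1::real) - (b $ i) *\<^sub>R axis l 1 = ((a - b) $ i) *\<^sub>R axis l 1" for a b :: "real^'n" and i l :: 'n
    by (simp add: scaleR_left_diff_distrib)
  have expand: "gradn v n x \<bullet> a = (\<Sum>(i,l)\<in>UNIV. pd v l x $ i * (((a $ i) *\<^sub>R axis l 1) \<bullet> n))"
    for v and n x a :: "real^'n"
  proof -
    have "gradn v n x \<bullet> a = (\<Sum>i\<in>UNIV. \<Sum>l\<in>UNIV. pd v l x $ i * (a $ i * n $ l))"
      by (simp add: gradn_def inner_vec_def sum_distrib_left mult_ac)
    also have "\<dots> = (\<Sum>(i,l)\<in>UNIV \<times> UNIV. pd v l x $ i * (a $ i * n $ l))" by (rule sum.cartesian_product)
    finally show ?thesis by (simp add: inner_commute[of "axis _ _"] inner_axis)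
  qed
  have "IS (\<lambda>K1 K2 x. ((1/2) *\<^sub>R (gradn (u K1) (?n K1 K2) x + gradn (u K2) (?n K1 K2) x)) \<bullet> (w K1 x - w K2 x))
     = IS (\<lambda>K1 K2 x. \<Sum>p\<in>UNIV. ?h p K1 K2 x)"
  proof (rule IS_cong)
    fix K1 K2 x
    show "((1/2) *\<^sub>R (gradn (u K1) (?n K1 K2) x + gradn (u K2) (?n K1 K2) x)) \<bullet> (w K1 x - w K2 x) = (\<Sum>p\<in>UNIV. ?h p K1 K2 x)"
      unfolding inner_scaleR_left[of "1/2"] inner_add_left expand sum.distrib[symmetric] sum_distrib_left
      by (rule sum.cong[OF refl])
         (simp only: split_def df, simp only: distrib_left distrib_right mult.assoc)
  qed
  also have "\<dots> = (\<Sum>p\<in>UNIV. IS (?h p))"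
    by (rule IS_sum[THEN conjunct1]) (auto intro!: igoodI continuous_intros c)
  finally have 1: "IS (\<lambda>K1 K2 x. ((1/2) *\<^sub>R (gradn (u K1) (?n K1 K2) x + gradn (u K2) (?n K1 K2) x)) \<bullet> (w K1 x - w K2 x)) = \<dots>" .
  have "BS (\<lambda>K F x. gradn (u K) (onormal K F) x \<bullet> w K x) = BS (\<lambda>K F x. \<Sum>p\<in>UNIV. ?b p K F x)"
    unfolding expand by (simp add: split_def)
  also have "\<dots> = (\<Sum>p\<in>UNIV. BS (?b p))"
    by (rule BS_sum[THEN conjunct1]) (auto intro!: bgoodI continuous_intros c)
  finally have 2: "BS (\<lambda>K F x. gradn (u K) (onormal K F) x \<bullet> w K x) = \<dots>" .
  show ?thesis unfolding fluxf_def 1 2 liftR_rhs_eq by (simp add: sum.distrib[symmetric] split_def)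
qed

lemma Asip_eq: 
  assumes v: "v \<in> P" and g: "g \<in> P"
  shows "Asip \<K> \<sigma>t v g = vip \<K> (gradf v) (gradf g) - liftG_rhs \<K> g (gradf v) - liftG_rhs \<K> v (gradf g) + \<sigma>t * sjip v g"
proof -
  note c = Ph_continuous[OF v] Ph_continuous[OF g]
  let ?f = "\<lambda>v g K1 K2 x. (((1/2) *\<^sub>R (sgrad (v K1) x + sgrad (v K2) x)) \<bullet> onormal K1 (fc K1 K2)) * (g K1 x - g K2 x)"
  have "\<sigma>t * sjip v g = IS (\<lambda>K1 K2 x. \<sigma>t * (1 / hF (fc K1 K2) * ((v K1 x - v K2 x) * (g K1 x - g K2 x))))"
    unfolding IS_cmult sjip_def ..
  also have "\<dots> = (1/2) * (\<Sum>(K1,K2)\<in>int_faces \<K>. (let F = fc K1 K2 in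
        \<sigma>t / hF F * surf_int F (\<lambda>x. (v K1 x - v K2 x) * (g K1 x - g K2 x))))"
    unfolding IS_def Let_def surf_int_cmult by simp
  finally have "Asip \<K> \<sigma>t v g = vip \<K> (gradf v) (gradf g) - IS (\<lambda>K1 K2 x. ?f v g K1 K2 x + ?f g v K1 K2 x)
      + \<sigma>t * sjip v g"
    by (simp add: Asip_def vip_def gradf_def IS_def Let_def)
  also have "IS (\<lambda>K1 K2 x. ?f v g K1 K2 x + ?f g v K1 K2 x) = IS (?f v g) + IS (?f g v)"
    by (rule IS_add) (intro igoodI continuous_intros c)+
  finally show ?thesis by (simp add: liftG_rhs_eq gradf_def)
qed

lemma gradf_add: "v \<in> P \<Longrightarrow> g \<in> P \<Longrightarrow> gradf (v + g) = gradf v + gradf g"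
  by (intro ext) (simp add: gradf_def Ph_sgrad_add[simplified])

lemma gradf_scaleR: "v \<in> P \<Longrightarrow> gradf (c *\<^sub>R v) = c *\<^sub>R gradf v"
  by (intro ext) (simp add: gradf_def Ph_sgrad_scaleR[simplified])

lemma liftG_rhs_add_left:
  assumes v: "v \<in> P" and g: "g \<in> P" and w: "w \<in> M"
  shows "liftG_rhs \<K> (v + g) w = liftG_rhs \<K> v w + liftG_rhs \<K> g w"
proof -
  note c = Ph_continuous[OF v] Ph_continuous[OF g] Mh_continuous[OF w]
  have e: "A * (a + b - (c + d)) = A * (a - c) + A * (b - d)" for A a b c d :: real
    by (simp add: algebra_simps)
  show ?thesis unfolding liftG_rhs_eq
    by (subst IS_add[symmetric]) ((intro igoodI continuous_intros c)+, rule IS_cong, simp only: plus_fun_apply e)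
qed

lemma liftG_rhs_scaleR_left: "liftG_rhs \<K> (c *\<^sub>R v) w = c * liftG_rhs \<K> v w"
proof -
  have e: "A * (c * a - c * b) = c * (A * (a - b))" for A a b :: real
    by (simp add: algebra_simps)
  show ?thesis unfolding liftG_rhs_eq
    by (subst IS_cmult[symmetric], rule IS_cong) (simp only: scaleR_fun_apply real_scaleR_def e)
qed

lemma liftG_rhs_add_right:
  assumes v: "v \<in> P" and z: "z \<in> M" and w: "w \<in> M"
  shows "liftG_rhs \<K> v (z + w) = liftG_rhs \<K> v z + liftG_rhs \<K> v w"
proof -
  note c = Ph_continuous[OF v] Mh_continuous[OF z] Mh_continuous[OF w]
  show ?thesis unfolding liftG_rhs_eq
    by (subst IS_add[symmetric]) ((intro igoodI continuous_intros c)+, rule IS_cong,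
        simp add: inner_add_left algebra_simps add_divide_distrib)
qed

lemma liftG_rhs_scaleR_right: "liftG_rhs \<K> v (c *\<^sub>R w) = c * liftG_rhs \<K> v w"
  unfolding liftG_rhs_eq by (subst IS_cmult[symmetric], rule IS_cong) (simp add: inner_add_left field_simps)

lemma sjip_props:
  shows "v \<in> P \<Longrightarrow> g \<in> P \<Longrightarrow> q \<in> P \<Longrightarrow> sjip (v + g) q = sjip v q + sjip g q"
    and "sjip (c *\<^sub>R v) g = c * sjip v g" and "sjip v g = sjip g v" and "0 \<le> sjip v v"
proof -
  assume h: "v \<in> P" "g \<in> P" "q \<in> P"
  note c = Ph_continuous[OF h(1)] Ph_continuous[OF h(2)] Ph_continuous[OF h(3)]
  have e: "A * ((a + b - (c + d)) * q) = A * ((a - c) * q) + A * ((b - d) * q)" for A a b c d q :: real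
    by (simp add: algebra_simps)
  show "sjip (v + g) q = sjip v q + sjip g q" unfolding sjip_def
    by (subst IS_add[symmetric]) ((intro igoodI continuous_intros c)+, rule IS_cong, simp only: plus_fun_apply e)
next
  have e: "A * ((c * a - c * b) * q) = c * (A * ((a - b) * q))" for A a b q :: real
    by (simp add: algebra_simps)
  show "sjip (c *\<^sub>R v) g = c * sjip v g" unfolding sjip_def
    by (subst IS_cmult[symmetric], rule IS_cong) (simp only: scaleR_fun_apply real_scaleR_def e)
  show "sjip v g = sjip g v" unfolding sjip_def by (simp add: mult.commute)
  show "0 \<le> sjip v v" unfolding sjip_def by (intro IS_nonneg mult_nonneg_nonneg[OF hF_nonneg]) simp
qed

end

lemma mult_scaled_bound:
  fixes a b c x y :: real
  assumes "0 \<le> a" "a\<^sup>2 \<le> c * x\<^sup>2" "0 \<le> b" "b \<le> y" "0 \<le> x" "0 \<le> c"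
  shows "a * b \<le> sqrt c * (y * x)"
proof -
  have "a \<le> sqrt (c * x\<^sup>2)" using assms(1,2) by (simp add: real_le_rsqrt)
  also have "\<dots> = sqrt c * x" using assms(5) by (simp add: real_sqrt_mult)
  finally have "a * b \<le> (sqrt c * x) * y" using assms by (intro mult_mono) auto
  then show ?thesis by (simp add: mult_ac)
qed

section \<open>Consequences of the penalty assumptions\<close>

locale dg_setting = dg_space Om \<K> r1 r2 for Om :: "(real^'n::finite) set" and \<K> r1 r2 +
  fixes \<epsilon> \<sigma> \<sigma>t B Bt C2 :: real and Rh :: "'n vfam \<Rightarrow> 'n sfam" and Gh :: "'n sfam \<Rightarrow> 'n vfam"
  assumes eps: "\<epsilon> \<in> {-1, 0, 1}" and sigma: "\<sigma> > 0" and sigmat: "\<sigma>t > 0"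
    and coercive: "\<forall>w\<in>Mh \<K> r1. Aeps Om \<K> \<sigma> \<epsilon> w w \<ge> omega \<epsilon> * dGsq Om \<K> \<sigma> w"
    and coercive_sip: "\<forall>g\<in>Ph \<K> r2. Asip \<K> \<sigma>t g g \<ge> (1/2) * sdGsq \<K> \<sigma>t g"
    and Poincare: "\<forall>w\<in>Mh \<K> r1. sqrt (vip \<K> w w) \<le> C2 * sqrt (dGsq Om \<K> \<sigma> w)"
    and is_Rh: "is_Rh Om \<K> r1 r2 Rh" and is_Gh: "is_Gh \<K> r1 r2 Gh"
    and Rh_bound: "\<forall>w\<in>Mh \<K> r1. sip \<K> (Rh w) (Rh w) \<le> B\<^sup>2 * vjump_h Om \<K> w"
    and Gh_bound: "\<forall>g\<in>Ph \<K> r2. vip \<K> (Gh g) (Gh g) \<le> Bt\<^sup>2 * sjump_h \<K> g"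
    and sigma_B: "\<sigma> \<ge> B\<^sup>2 / real CARD('n)" and sigmat_B: "\<sigma>t \<ge> 4 * Bt\<^sup>2"
begin

text \<open>Polarisation of \<open>dGsq\<close>, which makes Cauchy-Schwarz and the triangle
  inequality available for the dG norm.\<close>

definition dip :: "'n vfam \<Rightarrow> 'n vfam \<Rightarrow> real" where "dip u w = gip u w + \<sigma> * jip u w"

lemma dGsq_dip: "dGsq Om \<K> \<sigma> w = dip w w"
  by (simp add: dGsq_eq dip_def)

sublocale DG: semi_inner M dip
proof
  show "subspace M" by (rule subspace_Mh)
  show "dip (x + y) z = dip x z + dip y z" if "x \<in> M" "y \<in> M" "z \<in> M" for x y z
    using that by (simp add: dip_def G.add_left J.add_left distrib_left)
  show "dip (c *\<^sub>R x) z = c * dip x z" if "x \<in> M" "z \<in> M" for x z c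
    using that by (simp add: dip_def G.scale_left J.scale_left distrib_left)
  show "dip x y = dip y x" if "x \<in> M" "y \<in> M" for x y
    using that by (simp add: dip_def G.commute J.commute)
  show "0 \<le> dip x x" if "x \<in> M" for x
    using that sigma by (simp add: dip_def G.nonneg J.nonneg)
qed

text \<open>The lower bound on \<open>\<sigma>\<close> absorbs the lift constant; only the dimension
  survives.\<close>

lemma B_jip_le:
  assumes "w \<in> M" shows "B\<^sup>2 * jip w w \<le> real CARD('n) * dip w w"
proof -
  have "B\<^sup>2 \<le> real CARD('n) * \<sigma>" using sigma_B by (simp add: field_simps)
  then have "B\<^sup>2 * jip w w \<le> (real CARD('n) * \<sigma>) * jip w w"
    using J.nonneg[OF assms] by (rule mult_right_mono)
  also have "\<dots> \<le> real CARD('n) * dip w w"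
    using G.nonneg[OF assms] by (simp add: dip_def distrib_left)
  finally show ?thesis .
qed

lemma Rh_in: "w \<in> M \<Longrightarrow> Rh w \<in> P"
  and Rh_eq: "w \<in> M \<Longrightarrow> g \<in> P \<Longrightarrow> sip \<K> (Rh w) g = liftR_rhs Om \<K> w g"
  using is_Rh by (auto simp: is_Rh_def)

lemma Gh_in: "g \<in> P \<Longrightarrow> Gh g \<in> M"
  and Gh_eq: "g \<in> P \<Longrightarrow> w \<in> M \<Longrightarrow> vip \<K> (Gh g) w = liftG_rhs \<K> g w"
  using is_Gh by (auto simp: is_Gh_def)

text \<open>One unit for each pair of component and derivative index, times the square root left
  over from \<open>B_jip_le\<close>. Neither mesh nor penalty occurs.\<close>

definition flux_const :: real where "flux_const = (real CARD('n))\<^sup>2 * sqrt (real CARD('n))"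

text \<open>The stabilisation of the jumps controls the consistency terms because each component of the
  flux is the lift of a scalar jump, tested with a first derivative lying in the pressure space.\<close>

lemma fluxf_bound:
  assumes u: "u \<in> M" and w: "w \<in> M"
  shows "\<bar>fluxf u w\<bar> \<le> flux_const * (DG.nrm u * DG.nrm w)"
proof -
  let ?W = "\<lambda>i l. (\<lambda>K x. (w K x $ i) *\<^sub>R axis l (1::real)) :: 'n vfam"
  let ?U = "\<lambda>i l. (\<lambda>K x. pd (u K) l x $ i) :: 'n sfam"
  have part: "\<bar>liftR_rhs Om \<K> (?W i l) (?U i l)\<bar> \<le> sqrt (real CARD('n)) * (DG.nrm u * DG.nrm w)" for i l
  proof -
    have W: "?W i l \<in> M" by (rule component_in[OF w])
    have U: "?U i l \<in> P" by (rule pd_component_in[OF u])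
    have "(S.nrm (Rh (?W i l)))\<^sup>2 = sip \<K> (Rh (?W i l)) (Rh (?W i l))" using Rh_in[OF W] by (rule S.nrm_sq)
    also have "\<dots> \<le> B\<^sup>2 * jip (?W i l) (?W i l)" using Rh_bound W by (simp add: vjump_h_eq)
    also have "\<dots> \<le> B\<^sup>2 * jip w w" using jip_component_le[OF w] by (intro mult_left_mono) auto
    also have "\<dots> \<le> real CARD('n) * (DG.nrm w)\<^sup>2" using B_jip_le[OF w] DG.nrm_sq[OF w] by simp
    finally have 1: "(S.nrm (Rh (?W i l)))\<^sup>2 \<le> real CARD('n) * (DG.nrm w)\<^sup>2" .
    have "sip \<K> (?U i l) (?U i l) \<le> gip u u"
      unfolding sip_VS gip_def
    proof (rule VS_mono)
      show "continuous_on UNIV (\<lambda>x. pd (u K) l x $ i * pd (u K) l x $ i)" for K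
        by (intro continuous_intros Mh_continuous[OF u])
      show "continuous_on UNIV (gradip (u K) (u K))" for K by (rule Mh_continuous2(1)[OF u u])
      show "pd (u K) l x $ i * pd (u K) l x $ i \<le> gradip (u K) (u K) x" for K x
        using pd_component_sq_le[of "u K" l x i] by (simp add: power2_eq_square)
    qed
    also have "\<dots> \<le> dip u u" using J.nonneg[OF u] sigma by (simp add: dip_def)
    finally have 2: "S.nrm (?U i l) \<le> DG.nrm u" by (simp add: S.nrm_def DG.nrm_def)
    have "\<bar>liftR_rhs Om \<K> (?W i l) (?U i l)\<bar> \<le> S.nrm (Rh (?W i l)) * S.nrm (?U i l)"
      using S.Cauchy_Schwarz[OF Rh_in[OF W] U] Rh_eq[OF W U] by simp
    also have "\<dots> \<le> sqrt (real CARD('n)) * (DG.nrm u * DG.nrm w)"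
      by (rule mult_scaled_bound[OF S.nrm_nonneg[OF Rh_in[OF W]] 1 S.nrm_nonneg[OF U] 2 DG.nrm_nonneg[OF w]]) simp
    finally show ?thesis .
  qed
  have "\<bar>fluxf u w\<bar> \<le> (\<Sum>(i,l)\<in>UNIV. \<bar>liftR_rhs Om \<K> (?W i l) (?U i l)\<bar>)"
    unfolding fluxf_eq_liftR[OF u w] by (rule order_trans[OF sum_abs]) (simp add: split_def)
  also have "\<dots> \<le> (\<Sum>(i,l)\<in>(UNIV::('n \<times> 'n) set). sqrt (real CARD('n)) * (DG.nrm u * DG.nrm w))"
    using part by (intro sum_mono) auto
  also have "\<dots> = flux_const * (DG.nrm u * DG.nrm w)"
    by (simp add: flux_const_def split_def power2_eq_square card_cartesian_product flip: UNIV_Times_UNIV)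
  finally show ?thesis .
qed

text \<open>Since \<open>\<bar>\<epsilon>\<bar> \<le> 1\<close>, the consistency bound is spent at
  most twice.\<close>

lemma Aeps_bound:
  assumes u: "u \<in> M" and w: "w \<in> M"
  shows "\<bar>Aeps Om \<K> \<sigma> \<epsilon> u w\<bar> \<le> (1 + 2 * flux_const) * (DG.nrm u * DG.nrm w)"
proof -
  have e: "\<bar>\<epsilon>\<bar> \<le> 1" using eps by auto
  have "Aeps Om \<K> \<sigma> \<epsilon> u w = dip u w - fluxf u w + \<epsilon> * fluxf w u"
    by (simp add: Aeps_eq[OF u w] dip_def)
  then have "\<bar>Aeps Om \<K> \<sigma> \<epsilon> u w\<bar> \<le> \<bar>dip u w\<bar> + \<bar>fluxf u w\<bar> + \<bar>\<epsilon>\<bar> * \<bar>fluxf w u\<bar>"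
    by (simp add: abs_mult[symmetric])
  also have "\<bar>\<epsilon>\<bar> * \<bar>fluxf w u\<bar> \<le> 1 * \<bar>fluxf w u\<bar>" using e by (intro mult_right_mono) auto
  finally show ?thesis
    using DG.Cauchy_Schwarz[OF u w] fluxf_bound[OF u w] fluxf_bound[OF w u]
    by (simp add: algebra_simps)
qed

definition Dd :: "'n vfam \<Rightarrow> 'n sfam" where "Dd w = (\<lambda>K x. vdiv (w K) x) - Rh w"

lemma Dd_in: "w \<in> M \<Longrightarrow> Dd w \<in> P"
  unfolding Dd_def by (intro S.closed div_in Rh_in)

lemma bform_Dd:
  assumes "w \<in> M" "g \<in> P" shows "bform \<K> w g = sip \<K> (Dd w) g"
  unfolding Dd_def S.diff_left[OF div_in[OF assms(1)] Rh_in[OF assms(1)] assms(2)]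
  using bform_eq_liftR[OF assms] Rh_eq[OF assms] by simp

text \<open>Divergence and lift are controlled by the gradient part and the jump part of the dG
  norm, each with the dimension as factor; the 2 comes from splitting the square of their
  difference.\<close>

lemma Dd_bound:
  assumes w: "w \<in> M"
  shows "sip \<K> (Dd w) (Dd w) \<le> 2 * real CARD('n) * dip w w"
proof -
  have "sip \<K> (\<lambda>K x. vdiv (w K) x) (\<lambda>K x. vdiv (w K) x) \<le> VS (\<lambda>K x. real CARD('n) * gradip (w K) (w K) x)"
    unfolding sip_VS
  proof (rule VS_mono)
    show "continuous_on UNIV (\<lambda>x. vdiv (w K) x * vdiv (w K) x)" for K
      by (intro continuous_intros Mh_continuous[OF w])
    show "continuous_on UNIV (\<lambda>x. real CARD('n) * gradip (w K) (w K) x)" for K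
      by (intro continuous_intros Mh_continuous2(1)[OF w w])
    show "vdiv (w K) x * vdiv (w K) x \<le> real CARD('n) * gradip (w K) (w K) x" for K x
      using vdiv_sq_le[of "w K" x] by (simp add: power2_eq_square)
  qed
  then have 1: "sip \<K> (\<lambda>K x. vdiv (w K) x) (\<lambda>K x. vdiv (w K) x) \<le> real CARD('n) * gip w w"
    by (simp add: VS_cmult gip_def)
  have "B\<^sup>2 \<le> real CARD('n) * \<sigma>" using sigma_B by (simp add: field_simps)
  then have "B\<^sup>2 * jip w w \<le> (real CARD('n) * \<sigma>) * jip w w"
    using J.nonneg[OF w] by (rule mult_right_mono)
  then have 2: "sip \<K> (Rh w) (Rh w) \<le> real CARD('n) * (\<sigma> * jip w w)"
    using Rh_bound w by (fastforce simp: vjump_h_eq mult.assoc)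
  have "sip \<K> (Dd w) (Dd w) \<le> 2 * sip \<K> (\<lambda>K x. vdiv (w K) x) (\<lambda>K x. vdiv (w K) x) + 2 * sip \<K> (Rh w) (Rh w)"
    unfolding Dd_def by (rule S.ip_diff_self_le[OF div_in[OF w] Rh_in[OF w]])
  then show ?thesis using 1 2 by (simp add: dip_def algebra_simps)
qed

text \<open>The negative discrete gradient: it represents \<open>bform\<close> in the velocity
  argument, so that the correction step reads \<open>u n = ut n + \<tau> *\<^sub>R Bg (v n)\<close>
  when tested.\<close>

definition Bg :: "'n sfam \<Rightarrow> 'n vfam" where "Bg g = Gh g - gradf g"

lemma Bg_in: "g \<in> P \<Longrightarrow> Bg g \<in> M"
  unfolding Bg_def by (intro V.closed Gh_in gradf_in)

lemma bform_Bg: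
  assumes "w \<in> M" "g \<in> P" shows "bform \<K> w g = vip \<K> (Bg g) w"
  unfolding Bg_def V.diff_left[OF Gh_in[OF assms(2)] gradf_in[OF assms(2)] assms(1)]
  by (simp add: bform_eq_liftG Gh_eq[OF assms(2,1)])

text \<open>Expanding the square, volume and mixed terms agree with those of \<open>Asip\<close>,
  and only the squared lift is left to compare with the jump penalty. Positivity of
  \<open>Asip\<close> is a by-product.\<close>

lemma Bg_le_Asip:
  assumes v: "v \<in> P"
  shows "vip \<K> (Bg v) (Bg v) \<le> Asip \<K> \<sigma>t v v"
proof -
  have "vip \<K> (Gh v) (Gh v) \<le> Bt\<^sup>2 * sjip v v" using Gh_bound v by (simp add: sjump_h_eq)
  also have "\<dots> \<le> \<sigma>t * sjip v v"
    using sigmat_B by (intro mult_right_mono sjip_props(4)) (smt (verit) zero_le_power2)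
  finally have "vip \<K> (Gh v) (Gh v) \<le> \<sigma>t * sjip v v" .
  moreover have "vip \<K> (Bg v) (Bg v) = vip \<K> (Gh v) (Gh v) - 2 * liftG_rhs \<K> v (gradf v) + vip \<K> (gradf v) (gradf v)"
    unfolding Bg_def V.ip_diff_self[OF Gh_in[OF v] gradf_in[OF v]] Gh_eq[OF v gradf_in[OF v]] ..
  ultimately show ?thesis by (simp add: Asip_eq[OF v v])
qed

sublocale A: semi_inner P "Asip \<K> \<sigma>t"
proof
  show "subspace P" by (rule subspace_Ph)
  show "Asip \<K> \<sigma>t (x + y) z = Asip \<K> \<sigma>t x z + Asip \<K> \<sigma>t y z" if h: "x \<in> P" "y \<in> P" "z \<in> P" for x y z
    unfolding Asip_eq[OF S.closed(1)[OF h(1,2)] h(3)] Asip_eq[OF h(1,3)] Asip_eq[OF h(2,3)] gradf_add[OF h(1,2)]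
      V.add_left[OF gradf_in[OF h(1)] gradf_in[OF h(2)] gradf_in[OF h(3)]]
      liftG_rhs_add_left[OF h(1,2) gradf_in[OF h(3)]] liftG_rhs_add_right[OF h(3) gradf_in[OF h(1)] gradf_in[OF h(2)]]
      sjip_props(1)[OF h] by (simp add: algebra_simps)
  show "Asip \<K> \<sigma>t (c *\<^sub>R x) z = c * Asip \<K> \<sigma>t x z" if h: "x \<in> P" "z \<in> P" for x z c
    unfolding Asip_eq[OF S.closed(2)[OF h(1)] h(2)] Asip_eq[OF h] gradf_scaleR[OF h(1)]
      V.scale_left[OF gradf_in[OF h(1)] gradf_in[OF h(2)]] liftG_rhs_scaleR_left liftG_rhs_scaleR_right sjip_props(2)
    by (simp add: algebra_simps)
  show "Asip \<K> \<sigma>t x y = Asip \<K> \<sigma>t y x" if h: "x \<in> P" "y \<in> P" for x y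
    unfolding Asip_eq[OF h] Asip_eq[OF h(2,1)] sjip_props(3)[of x y] V.commute[OF gradf_in[OF h(1)] gradf_in[OF h(2)]]
    by simp
  show "0 \<le> Asip \<K> \<sigma>t x x" if h: "x \<in> P" for x
    using order_trans[OF V.nonneg[OF Bg_in[OF h]] Bg_le_Asip[OF h]] .
qed

lemma vip_le_dip:
  assumes w: "w \<in> M" shows "vip \<K> w w \<le> C2\<^sup>2 * dip w w"
proof -
  have "sqrt (vip \<K> w w) \<le> C2 * sqrt (dip w w)" using Poincare w by (simp add: dGsq_dip)
  then have "(sqrt (vip \<K> w w))\<^sup>2 \<le> (C2 * sqrt (dip w w))\<^sup>2"
    using V.nonneg[OF w] by (intro power_mono) auto
  then show ?thesis using V.nonneg[OF w] DG.nonneg[OF w] by (simp add: power_mult_distrib)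
qed

text \<open>Young's inequality on each element. The effort lies in integrability, f being merely
  square integrable. The elements are disjoint subsets of the domain, so the local integrals add up
  to at most \<open>L2sq\<close>.\<close>

lemma fip_le:
  assumes f: "in_L2 Om f" and w: "w \<in> M" and t: "t > 0"
  shows "2 * fip \<K> f w \<le> t * vip \<K> w w + L2sq Om f / t"
proof -
  let ?h = "\<lambda>x. (norm (f x))\<^sup>2"
  have Oml: "Om \<in> sets lebesgue" using fmeasurableD[OF lmeasurable_open[OF domain(4,2)]] .
  have fm: "f \<in> borel_measurable (lebesgue_on Om)"
    using f Oml by (simp add: in_L2_def measurable_on_iff_borel_measurable)
  have hint: "?h integrable_on Om" using f by (simp add: in_L2_def)
  have habs: "?h absolutely_integrable_on Om"
    by (rule nonnegative_absolutely_integrable_1[OF hint]) simp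
  have K: "?h integrable_on K" "(\<lambda>x. f x \<bullet> w K x) integrable_on K" "(\<lambda>x. w K x \<bullet> w K x) integrable_on K" if K: "K \<in> \<K>" for K
  proof -
    have Kl: "K \<in> sets lebesgue" using fmeasurableD[OF lmeasurable_open[OF element(7,5)[OF K]]] .
    have "?h absolutely_integrable_on K"
      by (rule set_integrable_subset[OF habs Kl element(2)[OF K]])
    then show hK: "?h integrable_on K" using set_lebesgue_integral_eq_integral(1) by blast
    show wK: "(\<lambda>x. w K x \<bullet> w K x) integrable_on K"
      using element(5,7)[OF K] by (intro set_integrable_continuous(2) continuous_intros Mh_continuous[OF w])
    have fK: "f \<in> borel_measurable (lebesgue_on K)"
      using fm element(2)[OF K] by (rule measurable_restrict_mono)
    have wm: "w K \<in> borel_measurable (lebesgue_on K)"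
      using Mh_continuous(1)[OF w] Kl by (intro continuous_imp_measurable_on_sets_lebesgue)
    have "(\<lambda>x. f x \<bullet> w K x) absolutely_integrable_on K"
    proof (rule measurable_bounded_by_integrable_imp_absolutely_integrable)
      show "(\<lambda>x. f x \<bullet> w K x) \<in> borel_measurable (lebesgue_on K)"
        using fK wm by (rule borel_measurable_inner)
      show "(\<lambda>x. ?h x + w K x \<bullet> w K x) integrable_on K" using hK wK by (rule integrable_add)
      fix x
      have "\<bar>f x \<bullet> w K x\<bar> \<le> norm (f x) * norm (w K x)" by (rule Cauchy_Schwarz_ineq2)
      also have "\<dots> \<le> (norm (f x))\<^sup>2 + (norm (w K x))\<^sup>2"
        using sum_squares_bound[of "norm (f x)" "norm (w K x)"] mult_nonneg_nonneg[OF norm_ge_zero norm_ge_zero, of "f x" "w K x"]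
        by linarith
      finally show "norm (f x \<bullet> w K x) \<le> ?h x + w K x \<bullet> w K x" by (simp add: power2_norm_eq_inner)
    qed (rule Kl)
    then show "(\<lambda>x. f x \<bullet> w K x) integrable_on K" using set_lebesgue_integral_eq_integral(1) by blast
  qed
  have young: "2 * (f x \<bullet> w K x) \<le> t * (w K x \<bullet> w K x) + (1 / t) * ?h x" for K x
  proof -
    have "0 \<le> (1 / t) * ((f x - t *\<^sub>R w K x) \<bullet> (f x - t *\<^sub>R w K x))" using t by simp
    also have "\<dots> = (1 / t) * ?h x - 2 * (f x \<bullet> w K x) + t * (w K x \<bullet> w K x)"
      using t by (simp add: inner_diff_left inner_diff_right inner_commute power2_norm_eq_inner field_simps)
    finally show ?thesis by simp
  qed
  have "2 * fip \<K> f w = (\<Sum>K\<in>\<K>. integral K (\<lambda>x. 2 * (f x \<bullet> w K x)))"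
    by (simp add: fip_def sum_distrib_left)
  also have "\<dots> \<le> (\<Sum>K\<in>\<K>. integral K (\<lambda>x. t * (w K x \<bullet> w K x) + (1 / t) * ?h x))"
    using K young by (intro sum_mono integral_le integrable_add integrable_on_mult_right) auto
  also have "\<dots> = (\<Sum>K\<in>\<K>. t * integral K (\<lambda>x. w K x \<bullet> w K x) + (1 / t) * integral K ?h)"
  proof (rule sum.cong[OF refl])
    fix k assume k: "k \<in> \<K>"
    show "integral k (\<lambda>x. t * (w k x \<bullet> w k x) + (1 / t) * ?h x) = t * integral k (\<lambda>x. w k x \<bullet> w k x) + (1 / t) * integral k ?h"
      using Henstock_Kurzweil_Integration.integral_add[OF integrable_on_mult_right[OF K(3)[OF k], of t]
          integrable_on_mult_right[OF K(1)[OF k], of "1 / t"]]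
      by (simp only: Henstock_Kurzweil_Integration.integral_mult_right)
  qed
  also have "\<dots> = t * vip \<K> w w + (1 / t) * (\<Sum>K\<in>\<K>. integral K ?h)"
    by (simp add: vip_def sum.distrib sum_distrib_left)
  also have "(\<Sum>K\<in>\<K>. integral K ?h) \<le> L2sq Om f"
  proof -
    have "(?h has_integral (\<Sum>K\<in>\<K>. integral K ?h)) (\<Union>\<K>)"
    proof (rule has_integral_Union[OF finite_mesh])
      show "(?h has_integral integral K ?h) K" if "K \<in> \<K>" for K using K(1)[OF that] by (rule integrable_integral)
      show "pairwise (\<lambda>S S'. negligible (S \<inter> S')) \<K>"
        unfolding pairwise_def using element_disjoint by (metis negligible_empty)
    qed
    then have "integral (\<Union>\<K>) ?h = (\<Sum>K\<in>\<K>. integral K ?h)" "?h integrable_on \<Union>\<K>"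
      by (auto intro: integral_unique)
    moreover have "integral (\<Union>\<K>) ?h \<le> integral Om ?h"
      using hint \<open>?h integrable_on \<Union>\<K>\<close> element(2) by (intro integral_subset_le) auto
    ultimately show ?thesis by (simp add: L2sq_def)
  qed
  finally show ?thesis using t by (simp add: divide_right_mono)
qed

end

section \<open>Discrete Gronwall argument\<close>

text \<open>The sum includes the current index. Its last term is absorbed through
  \<open>\<kappa> \<le> 1/2\<close>, which costs the factor 2 and makes the growth factor
  \<open>1 + 2 * \<kappa>\<close>.\<close>

lemma discrete_Gronwall:
  fixes X a :: "nat \<Rightarrow> real"
  assumes X: "\<And>n. n \<le> N \<Longrightarrow> 0 \<le> X n" and a: "\<And>m n. m \<le> n \<Longrightarrow> n \<le> N \<Longrightarrow> a m \<le> a n" "0 \<le> a 0"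
    and \<kappa>: "0 \<le> \<kappa>" "\<kappa> \<le> 1/2"
    and step: "\<And>m. m \<in> {1..N} \<Longrightarrow> X m \<le> a m + \<kappa> * (\<Sum>n=1..m. X n)"
    and m: "m \<in> {1..N}"
  shows "X m \<le> 2 * a m * exp (2 * \<kappa> * real m)"
proof -
  have a_nonneg: "0 \<le> a n" if "n \<le> N" for n using a(1)[of 0 n] a(2) that by simp
  \<comment> \<open>The induction bounds the accumulated right-hand side and not \<open>X\<close>
    itself, with the datum frozen at its final value \<open>a m\<close> by monotonicity.\<close>
  have *: "X n + 2 * \<kappa> * (\<Sum>i=1..<n. X i) \<ge> 0 \<and>
      a m + \<kappa> * (\<Sum>i=1..<n. X i) \<le> a m * (1 + 2 * \<kappa>) ^ (n - 1)" if "n \<in> {1..m}" for n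
    using that
  proof (induction n)
    case (Suc n)
    have nonneg: "X (Suc n) + 2 * \<kappa> * (\<Sum>i=1..<Suc n. X i) \<ge> 0"
      using X Suc.prems m \<kappa>(1) by (intro add_nonneg_nonneg mult_nonneg_nonneg sum_nonneg) auto
    show ?case
    proof (cases "n = 0")
      case True
      then show ?thesis using nonneg by simp
    next
      case False
      then have n: "n \<in> {1..m}" "n \<in> {1..N}" using Suc.prems m by auto
      have split: "(\<Sum>i=1..n. X i) = X n + (\<Sum>i=1..<n. X i)"
        using False by (simp add: atLeastLessThanSuc_atLeastAtMost[symmetric])
      have "X n \<le> a n + \<kappa> * (\<Sum>i=1..n. X i)" by (rule step[OF n(2)])
      then have "X n \<le> a m + \<kappa> * X n + \<kappa> * (\<Sum>i=1..<n. X i)"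
        unfolding split using a(1)[of n m] n(1) m by (simp add: algebra_simps)
      moreover have "\<kappa> * X n \<le> 1/2 * X n" using \<kappa>(2) X[of n] n(2) by (intro mult_right_mono) auto
      ultimately have Xn: "X n \<le> 2 * (a m + \<kappa> * (\<Sum>i=1..<n. X i))" by simp
      have "a m + \<kappa> * (\<Sum>i=1..<Suc n. X i) = (a m + \<kappa> * (\<Sum>i=1..<n. X i)) + \<kappa> * X n"
        using False by (simp add: algebra_simps)
      also have "\<dots> \<le> (a m + \<kappa> * (\<Sum>i=1..<n. X i)) + \<kappa> * (2 * (a m + \<kappa> * (\<Sum>i=1..<n. X i)))"
        using Xn \<kappa>(1) by (intro add_left_mono mult_left_mono)
      also have "\<dots> = (a m + \<kappa> * (\<Sum>i=1..<n. X i)) * (1 + 2 * \<kappa>)" by (simp add: algebra_simps)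
      also have "\<dots> \<le> (a m * (1 + 2 * \<kappa>) ^ (n - 1)) * (1 + 2 * \<kappa>)"
        using Suc.IH n(1) \<kappa>(1) by (intro mult_right_mono) auto
      also have "\<dots> = a m * (1 + 2 * \<kappa>) ^ (Suc n - 1)" using False by (cases n) (auto simp: mult_ac)
      finally show ?thesis using nonneg by blast
    qed
  qed simp
  have split: "(\<Sum>i=1..m. X i) = X m + (\<Sum>i=1..<m. X i)"
    using m by (simp add: atLeastLessThanSuc_atLeastAtMost[symmetric])
  have "X m \<le> a m + \<kappa> * (\<Sum>i=1..m. X i)" by (rule step[OF m])
  moreover have "\<kappa> * X m \<le> 1/2 * X m" using \<kappa>(2) X[of m] m by (intro mult_right_mono) auto
  ultimately have "X m \<le> 2 * (a m + \<kappa> * (\<Sum>i=1..<m. X i))" unfolding split by (simp add: algebra_simps)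
  also have "\<dots> \<le> 2 * (a m * (1 + 2 * \<kappa>) ^ (m - 1))" using *[of m] m by simp
  also have "(1 + 2 * \<kappa>) ^ (m - 1) \<le> exp (2 * \<kappa>) ^ (m - 1)" using \<kappa>(1) by (intro power_mono) (auto simp: exp_ge_add_one_self)
  also have "\<dots> \<le> exp (2 * \<kappa>) ^ m" using \<kappa>(1) by (intro power_increasing) auto
  also have "\<dots> = exp (2 * \<kappa> * real m)" by (simp add: exp_of_nat_mult[symmetric] mult_ac)
  finally show ?thesis using a_nonneg[of m] m by (simp add: mult_left_mono mult.assoc)
qed

lemma sum_sum_le:
  fixes x :: "nat \<Rightarrow> real"
  assumes "\<And>i. i \<in> {1..m} \<Longrightarrow> 0 \<le> x i"
  shows "(\<Sum>n=1..m. \<Sum>i=1..n. x i) \<le> real m * (\<Sum>i=1..m. x i)"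
proof -
  have "(\<Sum>n=1..m. \<Sum>i=1..n. x i) \<le> (\<Sum>n=1..m. \<Sum>i=1..m. x i)"
    using assms by (intro sum_mono sum_mono2) auto
  then show ?thesis by simp
qed

lemma sum_shift_le:
  fixes x :: "nat \<Rightarrow> real"
  assumes "x 0 = 0" "0 \<le> x m"
  shows "(\<Sum>n=1..m. x (n - 1)) \<le> (\<Sum>n=1..m. x n)"
proof (cases m)
  case (Suc k)
  have "(\<Sum>n=1..Suc k. x (n - 1)) = (\<Sum>n=0..k. x n)"
    by (rule sum.reindex_bij_witness[of _ Suc "\<lambda>n. n - 1"]) auto
  also have "\<dots> = (\<Sum>n=1..k. x n)" using assms(1) by (simp add: sum.atLeast_Suc_atMost[of 0 k])
  also have "\<dots> \<le> (\<Sum>n=1..Suc k. x n)" using assms(2) Suc by simp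
  finally show ?thesis using Suc by simp
qed simp

lemma sum_sq_le:
  fixes x :: "nat \<Rightarrow> real"
  shows "(\<Sum>j=1..n. x j)\<^sup>2 \<le> real n * (\<Sum>j=1..n. (x j)\<^sup>2)"
  using Cauchy_Schwarz_ineq_sum[of "\<lambda>_. 1" x "{1..n}"] by simp

text \<open>\<open>d\<close> stands for the dissipation and \<open>s\<close> for the part of the energy \<open>E\<close> that drives the memory terms.\<close>

lemma energy_Gronwall:
  fixes E d s F :: "nat \<Rightarrow> real"
  assumes T: "0 < \<tau>" "\<tau> * real N = T" and pos: "0 < \<kappa>" "0 \<le> c" "0 \<le> g" "0 \<le> h" "0 \<le> \<phi>"
    and d: "\<And>n. n \<in> {1..N} \<Longrightarrow> 0 \<le> d n" and s: "\<And>n. n \<le> N \<Longrightarrow> 0 \<le> s n" "\<And>n. n \<le> N \<Longrightarrow> s n \<le> E n" "s 0 = 0"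
    and F: "\<And>n. n \<in> {1..N} \<Longrightarrow> 0 \<le> F n"
    and step: "\<And>n. n \<in> {1..N} \<Longrightarrow> E n - E (n - 1) + \<kappa> * \<tau> * d n \<le> \<tau> * \<phi> * F n + \<tau> * c * (\<tau> * (\<Sum>j=1..n. d j))
        + \<tau> * (g * (s n + s (n - 1)) + h * (T * s (n - 1) + \<tau> * (\<Sum>i=1..n. s i)))"
    and K: "2 * c / \<kappa> + 2 * g + 2 * h * T \<le> K" "\<tau> * K \<le> 1/2"
    and m: "m \<in> {1..N}"
  shows "E m + \<kappa> / 2 * \<tau> * (\<Sum>j=1..m. d j) \<le> 2 * exp (2 * K * T) * (E 0 + \<phi> * \<tau> * (\<Sum>n=1..m. F n))"
proof -
  have Tpos: "0 \<le> T" using T by (metis less_eq_real_def of_nat_0_le_iff mult_nonneg_nonneg)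
  \<comment> \<open>Only half of the dissipation is placed in \<open>X\<close>. It pays for the
    accumulated dissipation on the right at the price \<open>2 / \<kappa>\<close>, which explains
    the summand \<open>2 * c / \<kappa>\<close> in the bound on K.\<close>
  define X where "X n = E n + \<kappa> / 2 * \<tau> * (\<Sum>j=1..n. d j)" for n
  define a where "a n = E 0 + \<phi> * \<tau> * (\<Sum>i=1..n. F i)" for n
  have En: "0 \<le> E n" if "n \<le> N" for n using s(1,2)[OF that] by simp
  have dn: "0 \<le> (\<Sum>j=1..n. d j)" if "n \<le> N" for n using d that by (intro sum_nonneg) auto
  have Xs: "s n \<le> X n" "\<tau> * (\<Sum>j=1..n. d j) \<le> 2 / \<kappa> * X n" "0 \<le> X n" if n: "n \<le> N" for n
  proof -
    have p: "0 \<le> \<kappa> / 2 * \<tau> * (\<Sum>j=1..n. d j)" using pos(1) T(1) dn[OF n] by simp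
    show "s n \<le> X n" using s(2)[OF n] p by (simp add: X_def)
    show "0 \<le> X n" using En[OF n] p by (simp add: X_def)
    have "\<kappa> / 2 * (\<tau> * (\<Sum>j=1..n. d j)) \<le> X n" using En[OF n] by (simp add: X_def mult.assoc)
    then show "\<tau> * (\<Sum>j=1..n. d j) \<le> 2 / \<kappa> * X n" using pos(1) by (simp add: field_simps)
  qed
  have K0: "0 \<le> K"
  proof -
    have "0 \<le> 2 * c / \<kappa> + 2 * g + 2 * h * T" using pos Tpos by (intro add_nonneg_nonneg) auto
    then show ?thesis using K(1) by linarith
  qed
  have main: "X m \<le> a m + \<tau> * K * (\<Sum>n=1..m. X n)" if m: "m \<in> {1..N}" for m
  proof -
    have tel: "(\<Sum>n=1..m. E n - E (n - 1)) = E m - E 0"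
      by (induction m) auto
    have "(\<Sum>n=1..m. E n - E (n - 1) + \<kappa> * \<tau> * d n) \<le> (\<Sum>n=1..m. \<tau> * \<phi> * F n + \<tau> * c * (\<tau> * (\<Sum>j=1..n. d j))
        + \<tau> * (g * (s n + s (n - 1)) + h * (T * s (n - 1) + \<tau> * (\<Sum>i=1..n. s i))))"
      using m by (intro sum_mono step) auto
    then have 1: "E m - E 0 + \<kappa> * \<tau> * (\<Sum>n=1..m. d n) \<le> \<tau> * \<phi> * (\<Sum>n=1..m. F n)
        + \<tau> * c * (\<Sum>n=1..m. \<tau> * (\<Sum>j=1..n. d j))
        + \<tau> * (g * ((\<Sum>n=1..m. s n) + (\<Sum>n=1..m. s (n - 1))) + h * (T * (\<Sum>n=1..m. s (n - 1)) + \<tau> * (\<Sum>n=1..m. \<Sum>i=1..n. s i)))"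
      unfolding sum.distrib tel sum_distrib_left[symmetric] by simp
    have sh: "(\<Sum>n=1..m. s (n - 1)) \<le> (\<Sum>n=1..m. s n)"
      using s m by (intro sum_shift_le) auto
    have sn: "0 \<le> (\<Sum>n=1..m. s n)" using s(1) m by (intro sum_nonneg) auto
    \<comment> \<open>The second summation in time costs no more than
      \<open>\<tau> * real m \<le> T\<close>.\<close>
    have "\<tau> * (\<Sum>n=1..m. \<Sum>i=1..n. s i) \<le> \<tau> * (real m * (\<Sum>i=1..m. s i))"
      using s(1) m T(1) by (intro mult_left_mono sum_sum_le) auto
    also have "\<dots> = (\<tau> * real m) * (\<Sum>i=1..m. s i)" by simp
    also have "\<dots> \<le> T * (\<Sum>i=1..m. s i)"
      using T m sn by (intro mult_right_mono) (auto simp: T(2)[symmetric])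
    finally have ss: "\<tau> * (\<Sum>n=1..m. \<Sum>i=1..n. s i) \<le> T * (\<Sum>i=1..m. s i)" .
    have sX: "(\<Sum>n=1..m. s n) \<le> (\<Sum>n=1..m. X n)" using Xs(1) m by (intro sum_mono) auto
    have dX: "(\<Sum>n=1..m. \<tau> * (\<Sum>j=1..n. d j)) \<le> 2 / \<kappa> * (\<Sum>n=1..m. X n)"
      unfolding sum_distrib_left using Xs(2) m by (intro sum_mono) (auto simp: sum_distrib_left)
    have XX: "0 \<le> (\<Sum>n=1..m. X n)" using Xs(3) m by (intro sum_nonneg) auto
    have g1: "g * ((\<Sum>n=1..m. s n) + (\<Sum>n=1..m. s (n - 1))) \<le> g * (2 * (\<Sum>n=1..m. X n))"
      using sh sX pos(3) by (intro mult_left_mono) auto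
    have "T * (\<Sum>n=1..m. s (n - 1)) \<le> T * (\<Sum>n=1..m. X n)" using sh sX Tpos by (intro mult_left_mono) auto
    moreover have "T * (\<Sum>n=1..m. s n) \<le> T * (\<Sum>n=1..m. X n)" using sX Tpos by (intro mult_left_mono) auto
    ultimately have h1: "h * (T * (\<Sum>n=1..m. s (n - 1)) + \<tau> * (\<Sum>n=1..m. \<Sum>i=1..n. s i)) \<le> h * (2 * T * (\<Sum>n=1..m. X n))"
      using ss pos(4) by (intro mult_left_mono) auto
    have c1: "c * (\<Sum>n=1..m. \<tau> * (\<Sum>j=1..n. d j)) \<le> c * (2 / \<kappa> * (\<Sum>n=1..m. X n))"
      using dX pos(2) by (rule mult_left_mono)
    have "c * (\<Sum>n=1..m. \<tau> * (\<Sum>j=1..n. d j))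
        + (g * ((\<Sum>n=1..m. s n) + (\<Sum>n=1..m. s (n - 1))) + h * (T * (\<Sum>n=1..m. s (n - 1)) + \<tau> * (\<Sum>n=1..m. \<Sum>i=1..n. s i)))
       \<le> c * (2 / \<kappa> * (\<Sum>n=1..m. X n)) + (g * (2 * (\<Sum>n=1..m. X n)) + h * (2 * T * (\<Sum>n=1..m. X n)))"
      using g1 h1 c1 by (intro add_mono)
    also have "\<dots> = (2 * c / \<kappa> + 2 * g + 2 * h * T) * (\<Sum>n=1..m. X n)" by (simp add: algebra_simps)
    also have "\<dots> \<le> K * (\<Sum>n=1..m. X n)" using K(1) XX by (rule mult_right_mono)
    finally have 2: "\<tau> * (c * (\<Sum>n=1..m. \<tau> * (\<Sum>j=1..n. d j))
        + (g * ((\<Sum>n=1..m. s n) + (\<Sum>n=1..m. s (n - 1))) + h * (T * (\<Sum>n=1..m. s (n - 1)) + \<tau> * (\<Sum>n=1..m. \<Sum>i=1..n. s i))))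
       \<le> \<tau> * (K * (\<Sum>n=1..m. X n))" using T(1) by (intro mult_left_mono) auto
    have half: "\<kappa> / 2 * \<tau> * (\<Sum>n=1..m. d n) \<le> \<kappa> * \<tau> * (\<Sum>n=1..m. d n)"
      using pos(1) T(1) dn[of m] m by (intro mult_right_mono) auto
    have gen: "e + y \<le> (e0 + fi * t * SF) + t * k * XS"
      if "e - e0 + z \<le> t * fi * SF + t * c0 * W + t * (G + H)" "t * (c0 * W + (G + H)) \<le> t * (k * XS)" "y \<le> z"
      for e e0 y z t fi SF c0 W G H k XS :: real
      using that by (simp add: algebra_simps)
    show ?thesis unfolding X_def[of m] a_def by (rule gen[OF 1 2 half])
  qed
  have mono: "a i \<le> a n" if "i \<le> n" "n \<le> N" for i n
    unfolding a_def using that F pos(5) T(1) by (intro add_left_mono mult_left_mono sum_mono2) auto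
  have a0: "0 \<le> a 0" using En[of 0] by (simp add: a_def)
  have "X m \<le> 2 * a m * exp (2 * (\<tau> * K) * real m)"
    using Xs(3) mono a0 K(2) K0 T(1) main m by (intro discrete_Gronwall[of N]) auto
  also have "\<dots> \<le> 2 * a m * exp (2 * K * T)"
  proof (intro mult_left_mono)
    have "\<tau> * real m \<le> T" using T m by (auto simp: T(2)[symmetric])
    then have "2 * K * (\<tau> * real m) \<le> 2 * K * T" using K0 by (intro mult_left_mono) auto
    then show "exp (2 * (\<tau> * K) * real m) \<le> exp (2 * K * T)" by (simp add: mult_ac)
    show "0 \<le> 2 * a m" using mono[of 0 m] a0 m by simp
  qed
  also have "\<dots> = 2 * exp (2 * K * T) * a m" by simp
  finally show ?thesis unfolding X_def a_def .
qed

section \<open>Energy estimate for the scheme\<close>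

lemma xi_update:
  fixes a :: "'z::ab_group_add"
  assumes "a - (b + w) + x = 0" shows "a + (s + x) = b + s + w"
proof -
  have "a + (s + x) = (a - (b + w) + x) + (b + s + w)" by (simp add: algebra_simps)
  then show ?thesis using assms by simp
qed

text \<open>\<open>I\<close> is eliminated in favour of \<open>S\<close> and the new sum
  \<open>J'\<close>; the share of \<open>J'\<close> moves to the left, where it merely enlarges the
  coefficient.\<close>

lemma memory_recursion:
  fixes J J' I S :: "'z::real_vector"
  assumes "J' = a *\<^sub>R J + I" "I = k *\<^sub>R ((1 / d) *\<^sub>R S - J')"
  shows "(1 + k) *\<^sub>R J' = a *\<^sub>R J + (k / d) *\<^sub>R S"
proof -
  have "J' + k *\<^sub>R J' = a *\<^sub>R J + (I + k *\<^sub>R J')" using assms(1) by simp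
  also have "I + k *\<^sub>R J' = (k / d) *\<^sub>R S" unfolding assms(2) by (simp add: scaleR_diff_right)
  finally show ?thesis by (simp add: scaleR_add_left)
qed

locale dg_run = dg_setting Om \<K> r1 r2 \<epsilon> \<sigma> \<sigma>t B Bt C2 Rh Gh
  for Om :: "(real^'n::finite) set" and \<K> r1 r2 \<epsilon> \<sigma> \<sigma>t B Bt C2 Rh Gh +
  fixes \<delta> \<mu> \<gamma> \<eta> T :: real and N :: nat and u0 f and ut u :: "nat \<Rightarrow> 'n vfam" and v p :: "nat \<Rightarrow> 'n sfam"
  assumes pos: "\<mu> > 0" "\<gamma> > 0" "\<eta> > 0" "T > 0" "\<delta> > 0" "N \<ge> 1"
    and delta: "\<delta> \<le> min (omega \<epsilon> / (8 * real CARD('n))) (omega \<epsilon> * \<mu>\<^sup>2 / (16 * \<gamma>\<^sup>2 * real CARD('n)))"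
    and L2: "in_L2 Om u0" "\<forall>n. in_L2 Om (f n)"
    and scheme: "dg_scheme Om \<K> r1 r2 \<epsilon> \<sigma> \<sigma>t \<delta> \<mu> \<gamma> \<eta> T N u0 f ut u v p"
begin

definition \<tau> :: real where "\<tau> = T / real N"

lemma tau: "\<tau> > 0" "\<tau> * real N = T"
  using pos by (auto simp: \<tau>_def)

abbreviation "\<omega> \<equiv> omega \<epsilon>"

lemma omega: "\<omega> \<ge> 1/2" "\<omega> > 0"
  by (auto simp: omega_def)

lemma p0: "p 0 = 0" and u0_in: "u 0 \<in> M"
  and u0_proj: "K \<in> \<K> \<Longrightarrow> vpolyfun r1 q \<Longrightarrow> integral K (\<lambda>x. u0 x \<bullet> q x) = integral K (\<lambda>x. u 0 K x \<bullet> q x)"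
  using scheme by (auto simp: dg_scheme_def Let_def zero_fun_def)

lemma step:
  assumes "n \<in> {1..N}"
  shows ut_in: "ut n \<in> M" and v_in: "v n \<in> Ph0 \<K> r2" and p_in: "p n \<in> P" and u_in: "u n \<in> M"
    and momentum: "w \<in> M \<Longrightarrow> vip \<K> (ut n) w + \<tau> * Ac Om \<K> (u (n-1)) (u (n-1)) (ut n) w
            + \<tau> * \<mu> * Aeps Om \<K> \<sigma> \<epsilon> (ut n) w + \<tau> * Aeps Om \<K> \<sigma> \<epsilon> (qr \<tau> \<gamma> \<eta> n ut) w
          = vip \<K> (u (n-1)) w + \<tau> * bform \<K> w (p (n-1)) + \<tau> * fip \<K> (f n) w"
    and pressure: "g \<in> Ph0 \<K> r2 \<Longrightarrow> Asip \<K> \<sigma>t (v n) g = - (1/\<tau>) * bform \<K> (ut n) g"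
    and update: "g \<in> P \<Longrightarrow> sip \<K> (p n) g = sip \<K> (p (n-1)) g + sip \<K> (v n) g
            - \<delta> * \<mu> * bform \<K> (ut n) g - \<delta> * bform \<K> (qr \<tau> \<gamma> \<eta> n ut) g"
    and correction: "w \<in> M \<Longrightarrow> vip \<K> (u n) w = vip \<K> (ut n) w + \<tau> * bform \<K> w (v n)"
  using scheme assms unfolding dg_scheme_def Let_def \<tau>_def[symmetric] by blast+

lemma p_in': "n \<le> N \<Longrightarrow> p n \<in> P" and u_in': "n \<le> N \<Longrightarrow> u n \<in> M"
proof -
  assume n: "n \<le> N"
  show "p n \<in> P" using p_in[of n] p0 S.closed(3) n by (cases "n = 0") auto
  show "u n \<in> M" using u_in[of n] u0_in n by (cases "n = 0") auto
qed

lemma v_in_P: "n \<in> {1..N} \<Longrightarrow> v n \<in> P"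
  using v_in by (auto simp: Ph0_def)

lemma subspace_Ph0: "subspace (Ph0 \<K> r2)"
proof -
  have int: "integral K (\<lambda>x. g K x + h K x) = integral K (g K) + integral K (h K)"
    if "g \<in> P" "h \<in> P" "K \<in> \<K>" for g h K
    using element(5,7)[OF that(3)]
    by (intro Henstock_Kurzweil_Integration.integral_add set_integrable_continuous(2) Ph_continuous[OF that(1)] Ph_continuous[OF that(2)])
  show ?thesis unfolding subspace_def Ph0_def
    using S.closed(1,2,3)
    by (auto simp: plus_fun_def scaleR_fun_def zero_fun_def int sum.distrib sum_distrib_left[symmetric])
qed

definition bt :: "nat \<Rightarrow> nat \<Rightarrow> real" where "bt n j = \<tau> * beta \<gamma> \<eta> (real n * \<tau> - real j * \<tau>)"

lemma bt_bounds: "j \<le> n \<Longrightarrow> 0 \<le> bt n j" "j \<le> n \<Longrightarrow> bt n j \<le> \<tau> * \<gamma>"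
proof -
  assume "j \<le> n"
  then have "0 \<le> real n * \<tau> - real j * \<tau>" using tau by simp
  then have "exp (- \<eta> * (real n * \<tau> - real j * \<tau>)) \<le> 1" using pos by simp
  then show "0 \<le> bt n j" "bt n j \<le> \<tau> * \<gamma>"
    using tau pos by (auto simp: bt_def beta_def mult_le_cancel_left1)
qed

text \<open>The semigroup property of the exponential kernel, from which all one-step recursions of
  the memory sums derive.\<close>

lemma bt_Suc: "bt (Suc n) j = exp (- \<eta> * \<tau>) * bt n j"
  by (simp add: bt_def beta_def algebra_simps exp_diff exp_add exp_minus divide_inverse)

lemma bt_diag: "bt n n = \<tau> * \<gamma>"
  by (simp add: bt_def beta_def)

lemma qr_eq: "qr \<tau> \<gamma> \<eta> n ut = (\<Sum>j=1..n. bt n j *\<^sub>R ut j)"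
  by (intro ext) (simp add: qr_def sum_fun_apply scaleR_sum_right bt_def)

definition Dn :: "nat \<Rightarrow> 'n sfam" where "Dn n = Dd (ut n)"
text \<open>Plays the role of the discrete divergence of \<open>qr\<close>, as
  \<open>bform_qr\<close> confirms.\<close>

definition Qn :: "nat \<Rightarrow> 'n sfam" where "Qn n = (\<Sum>j=1..n. bt n j *\<^sub>R Dn j)"
definition In :: "nat \<Rightarrow> 'n sfam" where "In n = (\<Sum>i=1..n. Dn i)"
definition Jn :: "nat \<Rightarrow> 'n sfam" where "Jn n = (\<Sum>i=1..n. Qn i)"
definition Sn :: "nat \<Rightarrow> 'n sfam" where "Sn n = Sh \<delta> \<mu> \<tau> \<gamma> \<eta> Rh ut n"
definition xi :: "nat \<Rightarrow> 'n sfam" where "xi n = \<xi>h \<delta> \<mu> \<tau> \<gamma> \<eta> Rh ut p n"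

lemma Dn_in: "n \<in> {1..N} \<Longrightarrow> Dn n \<in> P"
  unfolding Dn_def by (intro Dd_in ut_in)

lemma QIJ_in: "n \<le> N \<Longrightarrow> Qn n \<in> P" "n \<le> N \<Longrightarrow> In n \<in> P" "n \<le> N \<Longrightarrow> Jn n \<in> P"
proof -
  show Q: "Qn n \<in> P" if "n \<le> N" for n
    unfolding Qn_def using that by (intro S.closed Dn_in) auto
  show "In n \<in> P" if "n \<le> N" unfolding In_def using that by (intro S.closed Dn_in) auto
  show "Jn n \<in> P" if "n \<le> N" unfolding Jn_def using that by (intro S.closed Q) auto
qed

lemma Sn_eq: "Sn n = (\<delta> * \<mu>) *\<^sub>R In n + \<delta> *\<^sub>R Jn n"
proof (intro ext)
  fix K x
  have "Sn n K x = \<delta> * \<mu> * (\<Sum>i=1..n. Dn i K x) + \<delta> * (\<Sum>i=1..n. \<Sum>j=1..i. bt i j * Dn j K x)"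
    unfolding Sn_def Sh_def Dn_def Dd_def bt_def by (simp add: sum_distrib_left mult.assoc)
  then show "Sn n K x = ((\<delta> * \<mu>) *\<^sub>R In n + \<delta> *\<^sub>R Jn n) K x"
    by (simp add: In_def Jn_def Qn_def sum_fun_apply)
qed

lemma Sn_in: "n \<le> N \<Longrightarrow> Sn n \<in> P"
  unfolding Sn_eq by (intro S.closed QIJ_in)

lemma Sn_0: "Sn 0 = 0"
  by (simp add: Sn_eq In_def Jn_def)

lemma Sn_Suc: "Sn (Suc n) = Sn n + ((\<delta> * \<mu>) *\<^sub>R Dn (Suc n) + \<delta> *\<^sub>R Qn (Suc n))"
  by (simp add: Sn_eq In_def Jn_def scaleR_add_right add_ac)

lemma Qn_Suc: "Qn (Suc n) = exp (- \<eta> * \<tau>) *\<^sub>R Qn n + (\<tau> * \<gamma>) *\<^sub>R Dn (Suc n)"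
proof -
  have "Qn (Suc n) = (\<Sum>j=1..n. bt (Suc n) j *\<^sub>R Dn j) + bt (Suc n) (Suc n) *\<^sub>R Dn (Suc n)"
    by (simp add: Qn_def)
  also have "(\<Sum>j=1..n. bt (Suc n) j *\<^sub>R Dn j) = exp (- \<eta> * \<tau>) *\<^sub>R Qn n"
    by (simp only: Qn_def bt_Suc scaleR_sum_right scaleR_scaleR)
  finally show ?thesis by (simp only: bt_diag)
qed

text \<open>Summing the recursion of \<open>Qn\<close> preserves its shape, with \<open>Dn\<close>
  replaced by its running sum.\<close>

lemma Jn_Suc: "Jn (Suc n) = exp (- \<eta> * \<tau>) *\<^sub>R Jn n + (\<tau> * \<gamma>) *\<^sub>R In (Suc n)"
proof (induction n)
  case 0
  show ?case by (simp add: Jn_def In_def Qn_def bt_diag)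
next
  case (Suc n)
  have "Jn (Suc (Suc n)) = Jn (Suc n) + Qn (Suc (Suc n))" by (simp add: Jn_def)
  also have "\<dots> = exp (- \<eta> * \<tau>) *\<^sub>R (Jn n + Qn (Suc n)) + (\<tau> * \<gamma>) *\<^sub>R (In (Suc n) + Dn (Suc (Suc n)))"
    unfolding Suc Qn_Suc[of "Suc n"] by (simp only: scaleR_add_right add_ac)
  also have "Jn n + Qn (Suc n) = Jn (Suc n)" by (simp add: Jn_def)
  also have "In (Suc n) + Dn (Suc (Suc n)) = In (Suc (Suc n))" by (simp add: In_def)
  finally show ?case .
qed

lemma xi_eq: "xi n = p n + Sn n"
  by (intro ext) (simp add: xi_def \<xi>h_def Sn_def)

text \<open>\<open>Rh\<close> is known only through its defining property, so linearity in the
  velocity is obtained from the representation by \<open>Bg g\<close>.\<close>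

lemma bform_qr:
  assumes n: "n \<le> N" and g: "g \<in> P"
  shows "bform \<K> (qr \<tau> \<gamma> \<eta> n ut) g = sip \<K> (Qn n) g"
proof -
  have utM: "ut j \<in> M" if "j \<in> {1..n}" for j using that n ut_in[of j] by auto
  have inM: "bt n j *\<^sub>R ut j \<in> M" if "j \<in> {1..n}" for j using utM[OF that] by (rule V.closed(2))
  have qM: "(\<Sum>j=1..n. bt n j *\<^sub>R ut j) \<in> M" using inM by (rule V.closed(5))
  have DP: "bt n j *\<^sub>R Dn j \<in> P" if "j \<in> {1..n}" for j using that n by (intro S.closed Dn_in) auto
  have "bform \<K> (qr \<tau> \<gamma> \<eta> n ut) g = vip \<K> (\<Sum>j=1..n. bt n j *\<^sub>R ut j) (Bg g)"
    unfolding qr_eq bform_Bg[OF qM g] by (rule V.commute[OF Bg_in[OF g] qM])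
  also have "\<dots> = (\<Sum>j=1..n. vip \<K> (bt n j *\<^sub>R ut j) (Bg g))" by (rule V.sum_left[OF Bg_in[OF g] inM])
  also have "\<dots> = (\<Sum>j=1..n. sip \<K> (bt n j *\<^sub>R Dn j) g)"
  proof (rule sum.cong[OF refl])
    fix j assume j: "j \<in> {1..n}"
    have "vip \<K> (ut j) (Bg g) = sip \<K> (Dn j) g"
      using V.commute[OF utM[OF j] Bg_in[OF g]] bform_Bg[OF utM[OF j] g] bform_Dd[OF utM[OF j] g] by (simp add: Dn_def)
    then show "vip \<K> (bt n j *\<^sub>R ut j) (Bg g) = sip \<K> (bt n j *\<^sub>R Dn j) g"
      using V.scale_left[OF utM[OF j] Bg_in[OF g]] S.scale_left[of "Dn j" g] Dn_in[of j] j n g by simp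
  qed
  also have "\<dots> = sip \<K> (Qn n) g" unfolding Qn_def by (rule S.sum_left[OF g DP, symmetric])
  finally show ?thesis .
qed

text \<open>The residual g of the pressure update is an admissible test function, hence orthogonal
  to itself and zero. The increment of \<open>Sn\<close> is precisely what cancels the divergence
  terms of the update.\<close>

lemma xi_Suc:
  assumes n: "Suc n \<le> N" shows "xi (Suc n) = xi n + v (Suc n)"
proof -
  have n1: "Suc n \<in> {1..N}" using n by simp
  note P = p_in[OF n1] p_in'[of n] v_in_P[OF n1] Dn_in[OF n1] QIJ_in(1)[OF n]
  have pn: "p n \<in> P" using p_in'[of n] n by simp
  define g where "g = p (Suc n) - (p n + v (Suc n)) + ((\<delta> * \<mu>) *\<^sub>R Dn (Suc n) + \<delta> *\<^sub>R Qn (Suc n))"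
  have gP: "g \<in> P" unfolding g_def by (intro S.closed P(1,3-) pn)
  have "sip \<K> (p (Suc n)) g = sip \<K> (p n) g + sip \<K> (v (Suc n)) g
            - \<delta> * \<mu> * sip \<K> (Dn (Suc n)) g - \<delta> * sip \<K> (Qn (Suc n)) g"
    using update[OF n1 gP] bform_Dd[OF ut_in[OF n1] gP] bform_qr[OF n gP] by (simp add: Dn_def)
  moreover have "sip \<K> g g = sip \<K> (p (Suc n)) g - (sip \<K> (p n) g + sip \<K> (v (Suc n)) g)
      + (\<delta> * \<mu> * sip \<K> (Dn (Suc n)) g + \<delta> * sip \<K> (Qn (Suc n)) g)"
  proof -
    have "sip \<K> g g = sip \<K> (p (Suc n) - (p n + v (Suc n))) g + sip \<K> ((\<delta> * \<mu>) *\<^sub>R Dn (Suc n) + \<delta> *\<^sub>R Qn (Suc n)) g"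
      by (subst (1) g_def, rule S.add_left) (intro S.closed P(1,3-) pn gP)+
    also have "sip \<K> (p (Suc n) - (p n + v (Suc n))) g = sip \<K> (p (Suc n)) g - sip \<K> (p n + v (Suc n)) g"
      by (rule S.diff_left) (intro S.closed P(1,3-) pn gP)+
    also have "sip \<K> (p n + v (Suc n)) g = sip \<K> (p n) g + sip \<K> (v (Suc n)) g"
      by (rule S.add_left) (rule P(1,3-) pn gP)+
    also have "sip \<K> ((\<delta> * \<mu>) *\<^sub>R Dn (Suc n) + \<delta> *\<^sub>R Qn (Suc n)) g = sip \<K> ((\<delta> * \<mu>) *\<^sub>R Dn (Suc n)) g + sip \<K> (\<delta> *\<^sub>R Qn (Suc n)) g"
      by (rule S.add_left) (intro S.closed P(1,3-) gP)+
    also have "\<dots> = \<delta> * \<mu> * sip \<K> (Dn (Suc n)) g + \<delta> * sip \<K> (Qn (Suc n)) g"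
      by (simp only: S.scale_left[OF P(4) gP] S.scale_left[OF P(5) gP])
    finally show ?thesis .
  qed
  ultimately have "sip \<K> g g = 0" by simp
  then have "g = 0" by (rule sip_definite[OF gP])
  then show ?thesis unfolding xi_eq Sn_Suc by (intro xi_update) (simp only: g_def)
qed

text \<open>\<open>xi\<close> starts at zero and collects mean-free increments. It can therefore be
  used as test function in the equation for \<open>v\<close>, which is posed on the mean-free space
  only.\<close>

lemma xi_in: "n \<le> N \<Longrightarrow> xi n \<in> Ph0 \<K> r2"
proof (induction n)
  case 0
  have "xi 0 = 0" unfolding xi_eq p0 Sn_0 by (rule add_0_left)
  then show ?case using subspace_0[OF subspace_Ph0] by (simp only:)
next
  case (Suc n)
  then show ?case unfolding xi_Suc[OF Suc.prems]
    by (intro subspace_add[OF subspace_Ph0] v_in) auto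
qed

lemma xi_in_P: "n \<le> N \<Longrightarrow> xi n \<in> P"
  using xi_in by (auto simp: Ph0_def)

definition nS :: "nat \<Rightarrow> real" where "nS n = S.nrm (Sn n)"

lemma mu_In: "\<mu> *\<^sub>R In n = (1 / \<delta>) *\<^sub>R Sn n - Jn n"
  using pos unfolding Sn_eq by (simp add: scaleR_add_right)

text \<open>After elimination of \<open>In\<close>, the new sum has coefficient \<open>1 + k\<close>
  with \<open>k = \<tau> * \<gamma> / \<mu>\<close>, and the old one is damped by a factor at most
  1. Each step thus adds no more than \<open>k / \<delta>\<close> times the norm of
  \<open>Sn\<close>.\<close>

lemma Jn_bound: "n \<le> N \<Longrightarrow> S.nrm (Jn n) \<le> \<tau> * \<gamma> / (\<delta> * \<mu>) * (\<Sum>i=1..n. nS i)"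
proof (induction n)
  case 0
  have "Jn 0 = 0" by (simp add: Jn_def)
  then have "S.nrm (Jn 0) = 0" using S.nrm_zero by (simp only:)
  then show ?case by simp
next
  case (Suc n)
  have P: "Jn n \<in> P" "Jn (Suc n) \<in> P" "Sn (Suc n) \<in> P" "In (Suc n) \<in> P"
    using Suc.prems QIJ_in Sn_in by auto
  define k where "k = \<tau> * \<gamma> / \<mu>"
  have k: "k \<ge> 0" using tau pos by (simp add: k_def)
  define a where "a = exp (- \<eta> * \<tau>)"
  have a: "0 \<le> a" "a \<le> 1" using tau pos by (auto simp: a_def)
  have "(\<tau> * \<gamma>) *\<^sub>R In (Suc n) = k *\<^sub>R (\<mu> *\<^sub>R In (Suc n))" using pos by (simp add: k_def)
  then have "(1 + k) *\<^sub>R Jn (Suc n) = a *\<^sub>R Jn n + (k / \<delta>) *\<^sub>R Sn (Suc n)"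
    unfolding a_def mu_In by (intro memory_recursion[OF Jn_Suc])
  then have "(1 + k) * S.nrm (Jn (Suc n)) = S.nrm (a *\<^sub>R Jn n + (k / \<delta>) *\<^sub>R Sn (Suc n))"
    using S.nrm_scale[OF P(2), of "1 + k"] k by simp
  also have "\<dots> \<le> S.nrm (a *\<^sub>R Jn n) + S.nrm ((k / \<delta>) *\<^sub>R Sn (Suc n))"
    using P by (intro S.nrm_triangle S.closed)
  also have "\<dots> = a * S.nrm (Jn n) + k / \<delta> * nS (Suc n)"
    using P a k pos by (simp add: S.nrm_scale nS_def)
  also have "\<dots> \<le> 1 * S.nrm (Jn n) + k / \<delta> * nS (Suc n)"
    using a S.nrm_nonneg[OF P(1)] by (intro add_right_mono mult_right_mono) auto
  finally have "(1 + k) * S.nrm (Jn (Suc n)) \<le> S.nrm (Jn n) + k / \<delta> * nS (Suc n)" by simp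
  moreover have "1 * S.nrm (Jn (Suc n)) \<le> (1 + k) * S.nrm (Jn (Suc n))"
    using k S.nrm_nonneg[OF P(2)] by (intro mult_right_mono) auto
  ultimately have "S.nrm (Jn (Suc n)) \<le> S.nrm (Jn n) + k / \<delta> * nS (Suc n)" by simp
  also have "k / \<delta> = \<tau> * \<gamma> / (\<delta> * \<mu>)" by (simp add: k_def mult.commute)
  also have "S.nrm (Jn n) + \<tau> * \<gamma> / (\<delta> * \<mu>) * nS (Suc n) \<le> \<tau> * \<gamma> / (\<delta> * \<mu>) * (\<Sum>i=1..n. nS i) + \<tau> * \<gamma> / (\<delta> * \<mu>) * nS (Suc n)"
    using Suc by simp
  also have "\<dots> = \<tau> * \<gamma> / (\<delta> * \<mu>) * (\<Sum>i=1..Suc n. nS i)" by (simp add: distrib_left)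
  finally show ?case .
qed

text \<open>The memory increment \<open>Qn\<close> is a difference of \<open>Jn\<close>, hence smaller by a factor \<open>\<tau>\<close> than the
  trivial bound; this is what makes the cross term with \<open>Sn\<close> accessible to Gronwall's argument.\<close>

lemma Qn_bound:
  assumes n: "n \<in> {1..N}"
  shows "S.nrm (Qn n) \<le> \<tau> / \<delta> * (\<gamma> / \<mu> * nS n + (\<gamma> / \<mu> + \<eta>) * (\<gamma> / \<mu>) * (\<tau> * (\<Sum>i=1..n. nS i)))"
proof -
  obtain k where k: "n = Suc k" using n by (cases n) auto
  define a where "a = exp (- \<eta> * \<tau>)"
  have a: "0 \<le> 1 - a" "1 - a \<le> \<eta> * \<tau>" using tau pos exp_ge_add_one_self[of "- \<eta> * \<tau>"] by (auto simp: a_def)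
  have P: "Jn k \<in> P" "Jn n \<in> P" "Sn n \<in> P" "In n \<in> P" using n k QIJ_in Sn_in by auto
  define q where "q = \<tau> * \<gamma> / (\<delta> * \<mu>)"
  define \<Sigma> where "\<Sigma> = (\<Sum>i=1..n. nS i)"
  have nSn: "0 \<le> nS i" if "i \<le> n" for i unfolding nS_def using that n by (intro S.nrm_nonneg Sn_in) auto
  have q: "0 \<le> q" using tau pos by (simp add: q_def)
  have J1: "S.nrm (Jn n) \<le> q * \<Sigma>" unfolding q_def \<Sigma>_def using n by (intro Jn_bound) auto
  have "S.nrm (Jn k) \<le> q * (\<Sum>i=1..k. nS i)" unfolding q_def using n k by (intro Jn_bound) auto
  also have "\<dots> \<le> q * \<Sigma>" unfolding \<Sigma>_def using q k nSn[of n] by (intro mult_left_mono) auto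
  finally have J0: "S.nrm (Jn k) \<le> q * \<Sigma>" .
  have "Jn n = Jn k + Qn n" by (simp add: k Jn_def)
  \<comment> \<open>Both coefficients are of order \<open>\<tau>\<close>, because
    \<open>1 - a \<le> \<eta> * \<tau>\<close>; this is the source of the gain.\<close>
  then have "Qn n = (\<tau> * \<gamma>) *\<^sub>R In n - (1 - a) *\<^sub>R Jn k"
    using Jn_Suc[of k] by (simp add: k a_def scaleR_diff_left algebra_simps)
  also have "(\<tau> * \<gamma>) *\<^sub>R In n = (\<tau> * \<gamma> / \<mu>) *\<^sub>R (\<mu> *\<^sub>R In n)" using pos by simp
  also have "\<dots> = q *\<^sub>R Sn n + (- (\<tau> * \<gamma> / \<mu>)) *\<^sub>R Jn n"
    unfolding mu_In q_def by (simp add: scaleR_diff_right mult.commute)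
  finally have "Qn n = (q *\<^sub>R Sn n + (- (\<tau> * \<gamma> / \<mu>)) *\<^sub>R Jn n) + (- (1 - a)) *\<^sub>R Jn k"
    by (simp only: scaleR_minus_left diff_conv_add_uminus)
  then have "S.nrm (Qn n) = S.nrm ((q *\<^sub>R Sn n + (- (\<tau> * \<gamma> / \<mu>)) *\<^sub>R Jn n) + (- (1 - a)) *\<^sub>R Jn k)"
    by (simp only:)
  also have "\<dots> \<le> S.nrm (q *\<^sub>R Sn n + (- (\<tau> * \<gamma> / \<mu>)) *\<^sub>R Jn n) + S.nrm ((- (1 - a)) *\<^sub>R Jn k)"
    by (rule S.nrm_triangle) (intro S.closed P)+
  also have "\<dots> \<le> (S.nrm (q *\<^sub>R Sn n) + S.nrm ((- (\<tau> * \<gamma> / \<mu>)) *\<^sub>R Jn n)) + S.nrm ((- (1 - a)) *\<^sub>R Jn k)"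
    by (intro add_right_mono S.nrm_triangle S.closed P)
  also have "\<dots> = q * nS n + \<tau> * \<gamma> / \<mu> * S.nrm (Jn n) + (1 - a) * S.nrm (Jn k)"
    unfolding S.nrm_scale[OF P(1)] S.nrm_scale[OF P(2)] S.nrm_scale[OF P(3)] using q a tau pos by (simp add: nS_def)
  also have "\<dots> \<le> q * nS n + \<tau> * \<gamma> / \<mu> * (q * \<Sigma>) + \<eta> * \<tau> * (q * \<Sigma>)"
    using J0 J1 a q tau pos S.nrm_nonneg[OF P(1)] by (intro add_mono mult_left_mono mult_mono) auto
  also have "\<dots> = \<tau> / \<delta> * (\<gamma> / \<mu> * nS n + (\<gamma> / \<mu> + \<eta>) * (\<gamma> / \<mu>) * (\<tau> * \<Sigma>))"
    using pos by (simp add: q_def field_simps)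
  finally show ?thesis unfolding \<Sigma>_def .
qed

end

text \<open>Scalar core of the energy step. \<open>BP\<close> is the pressure term,
  \<open>AVX\<close> and \<open>AV\<close> pair the increment v with the old xi and with itself,
  \<open>DS\<close> and \<open>QS\<close> pair divergence and memory with the old S. The weights
  \<open>t\<^sup>2\<close> and \<open>t / (dl * mu)\<close> are the ones for which the
  \<open>AVX\<close> and \<open>DS\<close> terms cancel; \<open>AV\<close> is paid for by the
  correction step.\<close>

lemma energy_step_arith:
  fixes t :: real
  assumes "UU + t * AC + t * mu * AT + t * AQ = W + t * BP + t * FF" "0 \<le> AC" "om * D \<le> AT" "2 * W \<le> U0 + UU"
    "U1 + t\<^sup>2 * AV \<le> UU" "BP = - t * AVX - DS" "X1 = X0 + 2 * AVX + AV"
    "S1 = S0 + 2 * (dl * mu * DS + dl * QS) + SS" and pos: "t > 0" "mu > 0" "dl > 0"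
  shows "(U1 + t\<^sup>2 * X1 + t / (dl * mu) * S1) - (U0 + t\<^sup>2 * X0 + t / (dl * mu) * S0) + 2 * om * mu * t * D
     \<le> 2 * t * FF - 2 * t * AQ + t / (dl * mu) * SS + 2 * t / mu * QS"
proof -
  have 1: "t / (dl * mu) * S1 = t / (dl * mu) * S0 + 2 * t * DS + 2 * t / mu * QS + t / (dl * mu) * SS"
    using pos unfolding assms(8) by (simp add: field_simps)
  have 2: "t * mu * (om * D) \<le> t * mu * AT" using assms(3) pos by (intro mult_left_mono) auto
  have 3: "0 \<le> t * AC" using assms(2) pos by simp
  have 4: "t * BP = - (t\<^sup>2 * AVX) - t * DS" unfolding assms(6) by (simp add: power2_eq_square algebra_simps)
  have 5: "t\<^sup>2 * X1 = t\<^sup>2 * X0 + 2 * (t\<^sup>2 * AVX) + t\<^sup>2 * AV" unfolding assms(7) by (simp add: algebra_simps)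
  have 6: "2 * om * mu * t * D = 2 * (t * mu * (om * D))" by simp
  have 7: "2 * t * FF = 2 * (t * FF)" "2 * t * AQ = 2 * (t * AQ)" "2 * t * DS = 2 * (t * DS)" by simp_all
  show ?thesis unfolding 1 5 6 7 using assms(1)[unfolded 4] assms(4,5) 2 3 by linarith
qed

lemma young_scaled:
  fixes x y k :: real
  assumes "k > 0" shows "2 * (x * y) \<le> k * x\<^sup>2 + y\<^sup>2 / k"
proof -
  have "0 \<le> (k * x - y)\<^sup>2 / k" using assms by simp
  also have "\<dots> = k * x\<^sup>2 - 2 * (x * y) + y\<^sup>2 / k" using assms by (simp add: power2_diff field_simps power2_eq_square)
  finally show ?thesis by simp
qed

lemma L2sq_nonneg: "in_L2 Om f \<Longrightarrow> 0 \<le> L2sq Om f"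
  unfolding in_L2_def L2sq_def by (intro Henstock_Kurzweil_Integration.integral_nonneg) auto

text \<open>The parameter \<open>k / C2\<^sup>2\<close> trades the velocity norm for the dG norm.
  For \<open>C2 = 0\<close> the velocity norm vanishes, and letting the parameter of
  \<open>fip_le\<close> grow shows that the forcing term is not positive.\<close>

lemma (in dg_setting) fip_le_dip:
  assumes f: "in_L2 Om f" and w: "w \<in> M" and k: "k > 0"
  shows "2 * fip \<K> f w \<le> k * dip w w + C2\<^sup>2 / k * L2sq Om f"
proof (cases "C2 = 0")
  case True
  have v0: "vip \<K> w w = 0" using vip_le_dip[OF w] V.nonneg[OF w] True by simp
  have L: "0 \<le> L2sq Om f" by (rule L2sq_nonneg[OF f])
  have "2 * fip \<K> f w \<le> 0"
  proof (rule ccontr)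
    assume "\<not> ?thesis"
    then have y: "0 < 2 * fip \<K> f w" by simp
    define y' where "y' = 2 * fip \<K> f w"
    have y': "y' > 0" using y by (simp add: y'_def)
    \<comment> \<open>Any parameter above \<open>L2sq Om f / y'\<close> contradicts the bound; the
      added 1 also keeps it positive when f vanishes.\<close>
    have "y' \<le> L2sq Om f / ((L2sq Om f + 1) / y')"
      using fip_le[OF f w, of "(L2sq Om f + 1) / y'"] L y' by (simp add: v0 y'_def)
    then have "y' * (L2sq Om f + 1) \<le> L2sq Om f * y'" using L y' by (simp add: field_simps)
    then show False using y' by (simp add: algebra_simps)
  qed
  then show ?thesis using True k DG.nonneg[OF w] by (smt (verit) mult_nonneg_nonneg divide_eq_0_iff mult_eq_0_iff power_zero_numeral)
next
  case False
  define t where "t = k / C2\<^sup>2"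
  have t: "t > 0" using k False by (simp add: t_def)
  have "2 * fip \<K> f w \<le> t * vip \<K> w w + L2sq Om f / t" by (rule fip_le[OF f w t])
  also have "t * vip \<K> w w \<le> t * (C2\<^sup>2 * dip w w)" using vip_le_dip[OF w] t by (intro mult_left_mono) auto
  also have "t * (C2\<^sup>2 * dip w w) = k * dip w w" using False by (simp add: t_def)
  also have "L2sq Om f / t = C2\<^sup>2 / k * L2sq Om f" using False k by (simp add: t_def)
  finally show ?thesis by simp
qed

context dg_run
begin

definition sn :: "nat \<Rightarrow> real" where "sn n = \<tau> / (\<delta> * \<mu>) * sip \<K> (Sn n) (Sn n)"
definition dn :: "nat \<Rightarrow> real" where "dn n = dip (ut n) (ut n)"
text \<open>\<open>Asip\<close> stands in for the seminorm of the claim because the increments of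
  \<open>xi\<close> telescope exactly in it; coercivity is applied once, at the final index.\<close>

definition En :: "nat \<Rightarrow> real" where
  "En n = vip \<K> (u n) (u n) + \<tau>\<^sup>2 * Asip \<K> \<sigma>t (xi n) (xi n) + sn n"

text \<open>The three tests give the squared norm of \<open>ut n\<close>, minus
  \<open>2 * \<tau>\<^sup>2 * Asip\<close> of v, plus \<open>\<tau>\<^sup>2\<close> times the
  squared norm of its discrete gradient; \<open>Bg_le_Asip\<close> turns this into a net loss of one
  \<open>Asip\<close> term.\<close>

lemma velocity_correction:
  assumes n: "n \<in> {1..N}"
  shows "vip \<K> (u n) (u n) + \<tau>\<^sup>2 * Asip \<K> \<sigma>t (v n) (v n) \<le> vip \<K> (ut n) (ut n)"
proof -
  note M = u_in[OF n] ut_in[OF n] note vP = v_in_P[OF n]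
  have b1: "bform \<K> (ut n) (v n) = - \<tau> * Asip \<K> \<sigma>t (v n) (v n)"
    using pressure[OF n v_in[OF n]] tau(1) by (simp add: field_simps)
  have "bform \<K> (u n) (v n) = vip \<K> (u n) (Bg (v n))"
    unfolding bform_Bg[OF M(1) vP] by (rule V.commute[OF Bg_in[OF vP] M(1)])
  also have "\<dots> = vip \<K> (ut n) (Bg (v n)) + \<tau> * vip \<K> (Bg (v n)) (Bg (v n))"
    using correction[OF n Bg_in[OF vP]] bform_Bg[OF Bg_in[OF vP] vP] by simp
  also have "vip \<K> (ut n) (Bg (v n)) = bform \<K> (ut n) (v n)"
    unfolding bform_Bg[OF M(2) vP] by (rule V.commute[OF M(2) Bg_in[OF vP]])
  finally have b2: "bform \<K> (u n) (v n) = - \<tau> * Asip \<K> \<sigma>t (v n) (v n) + \<tau> * vip \<K> (Bg (v n)) (Bg (v n))"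
    using b1 by simp
  have "\<tau> * bform \<K> (u n) (v n) = - (\<tau>\<^sup>2 * Asip \<K> \<sigma>t (v n) (v n)) + \<tau>\<^sup>2 * vip \<K> (Bg (v n)) (Bg (v n))"
    unfolding b2 by (simp add: power2_eq_square algebra_simps)
  moreover have "\<tau> * bform \<K> (ut n) (v n) = - (\<tau>\<^sup>2 * Asip \<K> \<sigma>t (v n) (v n))"
    unfolding b1 by (simp add: power2_eq_square)
  moreover have "vip \<K> (u n) (u n) = vip \<K> (ut n) (u n) + \<tau> * bform \<K> (u n) (v n)" by (rule correction[OF n M(1)])
  moreover have "vip \<K> (u n) (ut n) = vip \<K> (ut n) (ut n) + \<tau> * bform \<K> (ut n) (v n)" by (rule correction[OF n M(2)])
  moreover have "vip \<K> (ut n) (u n) = vip \<K> (u n) (ut n)" by (rule V.commute[OF M(2,1)])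
  moreover have "\<tau>\<^sup>2 * vip \<K> (Bg (v n)) (Bg (v n)) \<le> \<tau>\<^sup>2 * Asip \<K> \<sigma>t (v n) (v n)"
    using Bg_le_Asip[OF vP] by (intro mult_left_mono) auto
  ultimately show ?thesis by linarith
qed

lemma qr_in: "n \<le> N \<Longrightarrow> qr \<tau> \<gamma> \<eta> n ut \<in> M"
  unfolding qr_eq by (intro V.closed ut_in) auto

definition dS :: "nat \<Rightarrow> 'n sfam" where "dS n = (\<delta> * \<mu>) *\<^sub>R Dn n + \<delta> *\<^sub>R Qn n"

lemma dS_in: "n \<in> {1..N} \<Longrightarrow> dS n \<in> P"
  unfolding dS_def by (intro S.closed Dn_in QIJ_in) auto

lemma energy_step:
  assumes n: "Suc k \<le> N"
  shows "En (Suc k) - En k + 2 * \<omega> * \<mu> * \<tau> * dn (Suc k) \<le> 2 * \<tau> * fip \<K> (f (Suc k)) (ut (Suc k))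
    - 2 * \<tau> * Aeps Om \<K> \<sigma> \<epsilon> (qr \<tau> \<gamma> \<eta> (Suc k) ut) (ut (Suc k)) + \<tau> / (\<delta> * \<mu>) * sip \<K> (dS (Suc k)) (dS (Suc k))
    + 2 * \<tau> / \<mu> * sip \<K> (Qn (Suc k)) (Sn k)"
proof -
  let ?n = "Suc k"
  have n1: "?n \<in> {1..N}" and k: "k \<le> N" using n by auto
  note utM = ut_in[OF n1] note uM = u_in'[OF k]
  have h1: "vip \<K> (ut ?n) (ut ?n) + \<tau> * Ac Om \<K> (u k) (u k) (ut ?n) (ut ?n) + \<tau> * \<mu> * Aeps Om \<K> \<sigma> \<epsilon> (ut ?n) (ut ?n)
      + \<tau> * Aeps Om \<K> \<sigma> \<epsilon> (qr \<tau> \<gamma> \<eta> ?n ut) (ut ?n)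
    = vip \<K> (u k) (ut ?n) + \<tau> * bform \<K> (ut ?n) (p k) + \<tau> * fip \<K> (f ?n) (ut ?n)"
    using momentum[OF n1 utM] unfolding diff_Suc_1 .
  have h2: "0 \<le> Ac Om \<K> (u k) (u k) (ut ?n) (ut ?n)" by (rule Ac_nonneg[OF uM utM])
  have h3: "\<omega> * dn ?n \<le> Aeps Om \<K> \<sigma> \<epsilon> (ut ?n) (ut ?n)" using coercive utM by (simp add: dn_def dGsq_dip)
  have h4: "2 * vip \<K> (u k) (ut ?n) \<le> vip \<K> (u k) (u k) + vip \<K> (ut ?n) (ut ?n)"
    using V.nonneg[OF V.closed(4)[OF uM utM]] V.ip_diff_self[OF uM utM] by simp
  have h5: "vip \<K> (u ?n) (u ?n) + \<tau>\<^sup>2 * Asip \<K> \<sigma>t (v ?n) (v ?n) \<le> vip \<K> (ut ?n) (ut ?n)"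
    by (rule velocity_correction[OF n1])
  \<comment> \<open>The old pressure is \<open>xi k\<close> minus \<open>Sn k\<close>; the first
    part is evaluated by testing the equation for \<open>v\<close> with \<open>xi k\<close>.\<close>
  have h6: "bform \<K> (ut ?n) (p k) = - \<tau> * Asip \<K> \<sigma>t (v ?n) (xi k) - sip \<K> (Dn ?n) (Sn k)"
  proof -
    have "bform \<K> (ut ?n) (xi k) = - \<tau> * Asip \<K> \<sigma>t (v ?n) (xi k)"
      using pressure[OF n1 xi_in[OF k]] tau(1) by (simp add: field_simps)
    moreover have "sip \<K> (Dn ?n) (xi k) = sip \<K> (Dn ?n) (p k) + sip \<K> (Dn ?n) (Sn k)"
      unfolding xi_eq by (rule S.add_right[OF Dn_in[OF n1] p_in'[OF k] Sn_in[OF k]])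
    ultimately show ?thesis
      using bform_Dd[OF utM p_in'[OF k]] bform_Dd[OF utM xi_in_P[OF k]] unfolding Dn_def by linarith
  qed
  have h7: "Asip \<K> \<sigma>t (xi ?n) (xi ?n) = Asip \<K> \<sigma>t (xi k) (xi k) + 2 * Asip \<K> \<sigma>t (v ?n) (xi k) + Asip \<K> \<sigma>t (v ?n) (v ?n)"
    unfolding xi_Suc[OF n] A.ip_add_self[OF xi_in_P[OF k] v_in_P[OF n1]] A.commute[OF xi_in_P[OF k] v_in_P[OF n1]] ..
  have h8: "sip \<K> (Sn ?n) (Sn ?n) = sip \<K> (Sn k) (Sn k) + 2 * (\<delta> * \<mu> * sip \<K> (Dn ?n) (Sn k) + \<delta> * sip \<K> (Qn ?n) (Sn k))
      + sip \<K> (dS ?n) (dS ?n)"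
  proof -
    have "sip \<K> (dS ?n) (Sn k) = sip \<K> ((\<delta> * \<mu>) *\<^sub>R Dn ?n) (Sn k) + sip \<K> (\<delta> *\<^sub>R Qn ?n) (Sn k)"
      unfolding dS_def by (rule S.add_left) (intro S.closed Dn_in[OF n1] QIJ_in(1)[OF n] Sn_in[OF k])+
    also have "\<dots> = \<delta> * \<mu> * sip \<K> (Dn ?n) (Sn k) + \<delta> * sip \<K> (Qn ?n) (Sn k)"
      unfolding S.scale_left[OF Dn_in[OF n1] Sn_in[OF k]] S.scale_left[OF QIJ_in(1)[OF n] Sn_in[OF k]] ..
    finally show ?thesis
      unfolding Sn_Suc dS_def[symmetric] S.ip_add_self[OF Sn_in[OF k] dS_in[OF n1]] S.commute[OF Sn_in[OF k] dS_in[OF n1]]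
      by (simp only:)
  qed
  show ?thesis unfolding En_def sn_def
    by (rule energy_step_arith[OF h1 h2 h3 h4 h5 h6 h7 h8 tau(1) pos(1) pos(5)])
qed

section \<open>Bounds for the memory terms\<close>

lemma dn_nonneg: "n \<in> {1..N} \<Longrightarrow> 0 \<le> dn n"
  unfolding dn_def by (intro DG.nonneg ut_in)

lemma tau_n: "n \<le> N \<Longrightarrow> \<tau> * real n \<le> T"
  using mult_left_mono[of "real n" "real N" \<tau>] tau by simp

text \<open>Cauchy-Schwarz in time. Of the two factors \<open>\<tau>\<close> from the squared
  weights, one joins the number of terms to give T and the other remains as quadrature
  weight.\<close>

lemma weighted_sum_sq:
  assumes n: "n \<in> {1..N}" and y: "0 \<le> y" "y \<le> (\<Sum>j=1..n. bt n j * x j)" and x: "\<And>j. j \<in> {1..n} \<Longrightarrow> 0 \<le> x j"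
    and z: "\<And>j. j \<in> {1..n} \<Longrightarrow> (x j)\<^sup>2 \<le> c * dn j" and c: "0 \<le> c"
  shows "y\<^sup>2 \<le> \<gamma>\<^sup>2 * T * c * (\<tau> * (\<Sum>j=1..n. dn j))"
proof -
  have "y \<le> (\<Sum>j=1..n. \<tau> * \<gamma> * x j)"
    using y(2) by (rule order_trans) (intro sum_mono mult_right_mono bt_bounds x, auto)
  then have "y\<^sup>2 \<le> (\<Sum>j=1..n. \<tau> * \<gamma> * x j)\<^sup>2" using y(1) by (rule power_mono)
  also have "\<dots> \<le> real n * (\<Sum>j=1..n. (\<tau> * \<gamma> * x j)\<^sup>2)" by (rule sum_sq_le)
  also have "\<dots> \<le> real n * (\<Sum>j=1..n. (\<tau> * \<gamma>)\<^sup>2 * (c * dn j))"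
    using z by (intro mult_left_mono sum_mono) (auto simp: power_mult_distrib intro!: mult_left_mono)
  also have "\<dots> = (\<tau> * real n) * (\<gamma>\<^sup>2 * c * (\<tau> * (\<Sum>j=1..n. dn j)))"
    by (simp add: sum_distrib_left power2_eq_square mult_ac)
  also have "\<dots> \<le> T * (\<gamma>\<^sup>2 * c * (\<tau> * (\<Sum>j=1..n. dn j)))"
    using n tau c dn_nonneg by (intro mult_right_mono tau_n mult_nonneg_nonneg sum_nonneg) auto
  finally show ?thesis by (simp add: mult_ac)
qed

lemma qr_bound:
  assumes n: "n \<in> {1..N}"
  shows "(DG.nrm (qr \<tau> \<gamma> \<eta> n ut))\<^sup>2 \<le> \<gamma>\<^sup>2 * T * (\<tau> * (\<Sum>j=1..n. dn j))"
proof -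
  have utM: "ut j \<in> M" if "j \<in> {1..n}" for j using that n ut_in[of j] by auto
  have nn: "0 \<le> DG.nrm (qr \<tau> \<gamma> \<eta> n ut)" using n by (intro DG.nrm_nonneg qr_in) auto
  have "DG.nrm (qr \<tau> \<gamma> \<eta> n ut) \<le> (\<Sum>j=1..n. DG.nrm (bt n j *\<^sub>R ut j))"
    unfolding qr_eq using utM by (intro DG.nrm_sum DG.closed) auto
  also have "\<dots> = (\<Sum>j=1..n. bt n j * DG.nrm (ut j))"
    using utM bt_bounds(1) by (intro sum.cong refl) (simp add: DG.nrm_scale)
  finally have le: "DG.nrm (qr \<tau> \<gamma> \<eta> n ut) \<le> (\<Sum>j=1..n. bt n j * DG.nrm (ut j))" .
  show ?thesis
    using weighted_sum_sq[OF n nn le, of 1] utM by (simp add: DG.nrm_nonneg DG.nrm_sq dn_def)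
qed

lemma Dn_bound: "n \<in> {1..N} \<Longrightarrow> sip \<K> (Dn n) (Dn n) \<le> 2 * real CARD('n) * dn n"
  unfolding Dn_def dn_def by (intro Dd_bound ut_in)

lemma Qn_sq_bound:
  assumes n: "n \<in> {1..N}"
  shows "sip \<K> (Qn n) (Qn n) \<le> \<gamma>\<^sup>2 * T * (2 * real CARD('n)) * (\<tau> * (\<Sum>j=1..n. dn j))"
proof -
  have DP: "Dn j \<in> P" if "j \<in> {1..n}" for j using that n Dn_in[of j] by auto
  have QP: "Qn n \<in> P" using n by (intro QIJ_in) auto
  have "S.nrm (Qn n) \<le> (\<Sum>j=1..n. S.nrm (bt n j *\<^sub>R Dn j))"
    unfolding Qn_def using DP by (intro S.nrm_sum S.closed) auto
  also have "\<dots> = (\<Sum>j=1..n. bt n j * S.nrm (Dn j))"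
    using DP bt_bounds(1) by (intro sum.cong refl) (simp add: S.nrm_scale)
  finally have le: "S.nrm (Qn n) \<le> (\<Sum>j=1..n. bt n j * S.nrm (Dn j))" .
  have sq: "(S.nrm (Dn j))\<^sup>2 \<le> 2 * real CARD('n) * dn j" if "j \<in> {1..n}" for j
    using Dn_bound[of j] that n by (simp add: S.nrm_sq[OF DP[OF that]])
  show ?thesis
    using weighted_sum_sq[OF n S.nrm_nonneg[OF QP] le S.nrm_nonneg[OF DP] sq] by (simp add: S.nrm_sq[OF QP])
qed

lemma memory_bound:
  assumes n: "n \<in> {1..N}"
  shows "- (2 * \<tau> * Aeps Om \<K> \<sigma> \<epsilon> (qr \<tau> \<gamma> \<eta> n ut) (ut n))
    \<le> \<tau> * (\<omega> * \<mu> / 4) * dn n + \<tau> * (4 * (1 + 2 * flux_const)\<^sup>2 / (\<omega> * \<mu>) * (\<gamma>\<^sup>2 * T)) * (\<tau> * (\<Sum>j=1..n. dn j))"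
proof -
  let ?q = "qr \<tau> \<gamma> \<eta> n ut" let ?C = "1 + 2 * flux_const"
  have q: "?q \<in> M" using n by (intro qr_in) auto
  have k: "\<omega> * \<mu> / 4 > 0" using omega pos by simp
  have "- 2 * Aeps Om \<K> \<sigma> \<epsilon> ?q (ut n) \<le> 2 * (DG.nrm (ut n) * (?C * DG.nrm ?q))"
    using Aeps_bound[OF q ut_in[OF n]] by (simp add: mult_ac abs_le_iff)
  also have "\<dots> \<le> \<omega> * \<mu> / 4 * (DG.nrm (ut n))\<^sup>2 + (?C * DG.nrm ?q)\<^sup>2 / (\<omega> * \<mu> / 4)"
    by (rule young_scaled[OF k])
  also have "(DG.nrm (ut n))\<^sup>2 = dn n" using DG.nrm_sq[OF ut_in[OF n]] by (simp add: dn_def)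
  also have "(?C * DG.nrm ?q)\<^sup>2 / (\<omega> * \<mu> / 4) = 4 * ?C\<^sup>2 / (\<omega> * \<mu>) * (DG.nrm ?q)\<^sup>2"
    by (simp add: power_mult_distrib)
  also have "\<dots> \<le> 4 * ?C\<^sup>2 / (\<omega> * \<mu>) * (\<gamma>\<^sup>2 * T * (\<tau> * (\<Sum>j=1..n. dn j)))"
    using qr_bound[OF n] omega pos by (intro mult_left_mono) auto
  finally have "- 2 * Aeps Om \<K> \<sigma> \<epsilon> ?q (ut n) \<le> \<omega> * \<mu> / 4 * dn n + 4 * ?C\<^sup>2 / (\<omega> * \<mu>) * (\<gamma>\<^sup>2 * T * (\<tau> * (\<Sum>j=1..n. dn j)))"
    by simp
  from mult_left_mono[OF this, of \<tau>] show ?thesis using tau(1) by (simp add: distrib_left mult_ac)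
qed

text \<open>The two upper bounds on \<open>\<delta>\<close> in (A1) originate here:
  \<open>8 * CARD('n) * \<delta> \<le> \<omega>\<close> limits the divergence part of the increment,
  and \<open>16 * \<gamma>\<^sup>2 * CARD('n) * \<delta> \<le> \<omega> * \<mu>\<^sup>2\<close> its
  memory part.\<close>

lemma increment_bound:
  assumes n: "n \<in> {1..N}"
  shows "\<tau> / (\<delta> * \<mu>) * sip \<K> (dS n) (dS n) \<le> \<tau> * (\<omega> * \<mu> / 2) * dn n + \<tau> * (\<omega> * \<mu> * T / 4) * (\<tau> * (\<Sum>j=1..n. dn j))"
proof -
  let ?d = "real CARD('n)" let ?s = "\<tau> * (\<Sum>j=1..n. dn j)"
  have P: "Dn n \<in> P" "Qn n \<in> P" using Dn_in[OF n] QIJ_in(1)[of n] n by auto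
  have d: "?d > 0" by simp
  have d1: "\<delta> * (8 * ?d) \<le> \<omega>" using delta d by (simp add: pos_le_divide_eq)
  have d2: "\<delta> * (16 * \<gamma>\<^sup>2 * ?d) \<le> \<omega> * \<mu>\<^sup>2"
  proof -
    have "16 * \<gamma>\<^sup>2 * ?d > 0" using pos by simp
    then show ?thesis using delta by (simp add: pos_le_divide_eq)
  qed
  have s: "0 \<le> ?s" using tau dn_nonneg n by (intro mult_nonneg_nonneg sum_nonneg) auto
  have "sip \<K> (dS n) (dS n) \<le> 2 * sip \<K> ((\<delta> * \<mu>) *\<^sub>R Dn n) ((\<delta> * \<mu>) *\<^sub>R Dn n) + 2 * sip \<K> (\<delta> *\<^sub>R Qn n) (\<delta> *\<^sub>R Qn n)"
    unfolding dS_def by (rule S.ip_add_self_le) (intro S.closed P)+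
  also have "\<dots> = 2 * (\<delta> * \<mu>)\<^sup>2 * sip \<K> (Dn n) (Dn n) + 2 * \<delta>\<^sup>2 * sip \<K> (Qn n) (Qn n)"
    using P by (simp add: S.scale_left S.scale_right S.closed(2) power2_eq_square)
  also have "\<dots> \<le> 2 * (\<delta> * \<mu>)\<^sup>2 * (2 * ?d * dn n) + 2 * \<delta>\<^sup>2 * (\<gamma>\<^sup>2 * T * (2 * ?d) * ?s)"
    using Dn_bound[OF n] Qn_sq_bound[OF n] by (intro add_mono mult_left_mono) auto
  finally have "\<tau> / (\<delta> * \<mu>) * sip \<K> (dS n) (dS n) \<le> \<tau> / (\<delta> * \<mu>) * (2 * (\<delta> * \<mu>)\<^sup>2 * (2 * ?d * dn n) + 2 * \<delta>\<^sup>2 * (\<gamma>\<^sup>2 * T * (2 * ?d) * ?s))"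
    using tau pos by (intro mult_left_mono) auto
  also have "\<dots> = \<tau> * (\<delta> * (8 * ?d)) * (\<mu> / 2) * dn n + \<tau> * (\<delta> * (16 * \<gamma>\<^sup>2 * ?d)) * (T / (4 * \<mu>)) * ?s"
    using pos by (simp add: field_simps power2_eq_square)
  also have "\<dots> \<le> \<tau> * \<omega> * (\<mu> / 2) * dn n + \<tau> * (\<omega> * \<mu>\<^sup>2) * (T / (4 * \<mu>)) * ?s"
    using d1 d2 tau pos s dn_nonneg[OF n] by (intro add_mono mult_right_mono mult_left_mono) auto
  also have "\<dots> = \<tau> * (\<omega> * \<mu> / 2) * dn n + \<tau> * (\<omega> * \<mu> * T / 4) * ?s"
    using pos by (simp add: field_simps power2_eq_square)
  finally show ?thesis .
qed

lemma nS_sq: "n \<le> N \<Longrightarrow> \<tau> / (\<delta> * \<mu>) * (nS n)\<^sup>2 = sn n"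
  by (simp add: nS_def sn_def S.nrm_sq[OF Sn_in])

lemma sn_nonneg: "n \<le> N \<Longrightarrow> 0 \<le> sn n"
  unfolding sn_def using tau pos by (intro mult_nonneg_nonneg S.nonneg Sn_in) auto

text \<open>The factor \<open>\<tau> / \<delta>\<close> of \<open>Qn_bound\<close> together with
  \<open>1 / \<mu>\<close> is exactly the weight in \<open>sn\<close>, so one more
  \<open>\<tau>\<close> stays in front and the remaining constants are free of
  \<open>\<delta>\<close>.\<close>

lemma cross_bound:
  assumes n: "Suc k \<le> N"
  shows "2 * \<tau> / \<mu> * sip \<K> (Qn (Suc k)) (Sn k) \<le> \<tau> * (\<gamma> / \<mu> * (sn (Suc k) + sn k)
     + (\<gamma> / \<mu> + \<eta>) * (\<gamma> / \<mu>) * (T * sn k + \<tau> * (\<Sum>i=1..Suc k. sn i)))"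
proof -
  let ?n = "Suc k"
  define g where "g = \<gamma> / \<mu>" define h where "h = (\<gamma> / \<mu> + \<eta>) * (\<gamma> / \<mu>)"
  have gh: "0 \<le> g" "0 \<le> h" using pos by (auto simp: g_def h_def)
  have n1: "?n \<in> {1..N}" and k: "k \<le> N" using n by auto
  have nSk: "0 \<le> nS k" unfolding nS_def by (rule S.nrm_nonneg[OF Sn_in[OF k]])
  define c where "c = \<tau> / (\<delta> * \<mu>)"
  have c: "c > 0" using tau pos by (simp add: c_def)
  have pair: "c * (2 * (nS i * nS k)) \<le> sn i + sn k" if "i \<le> N" for i
  proof -
    have "2 * (nS i * nS k) \<le> (nS i)\<^sup>2 + (nS k)\<^sup>2" using sum_squares_bound[of "nS i" "nS k"] by simp
    then have "c * (2 * (nS i * nS k)) \<le> c * ((nS i)\<^sup>2 + (nS k)\<^sup>2)" using c by (intro mult_left_mono) auto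
    then show ?thesis using nS_sq[OF that] nS_sq[OF k] by (simp add: c_def distrib_left)
  qed
  have "sip \<K> (Qn ?n) (Sn k) \<le> S.nrm (Qn ?n) * nS k"
    using S.Cauchy_Schwarz[OF QIJ_in(1)[OF n] Sn_in[OF k]] by (simp add: nS_def)
  also have "\<dots> \<le> (\<tau> / \<delta> * (g * nS ?n + h * (\<tau> * (\<Sum>i=1..?n. nS i)))) * nS k"
    unfolding g_def h_def by (rule mult_right_mono[OF Qn_bound[OF n1] nSk])
  finally have "2 * \<tau> / \<mu> * sip \<K> (Qn ?n) (Sn k) \<le> 2 * \<tau> / \<mu> * ((\<tau> / \<delta> * (g * nS ?n + h * (\<tau> * (\<Sum>i=1..?n. nS i)))) * nS k)"
    using tau pos by (intro mult_left_mono) auto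
  also have "\<dots> = \<tau> * (g * (c * (2 * (nS ?n * nS k))) + h * (\<tau> * (c * (2 * ((\<Sum>i=1..?n. nS i) * nS k)))))"
    using pos unfolding c_def by (simp only: times_divide_eq_left times_divide_eq_right) (simp add: field_simps del: sum.cl_ivl_Suc)
  also have "c * (2 * ((\<Sum>i=1..?n. nS i) * nS k)) = (\<Sum>i=1..?n. c * (2 * (nS i * nS k)))"
    unfolding sum_distrib_left sum_distrib_right ..
  also have "\<tau> * (g * (c * (2 * (nS ?n * nS k))) + h * (\<tau> * (\<Sum>i=1..?n. c * (2 * (nS i * nS k)))))
     \<le> \<tau> * (g * (sn ?n + sn k) + h * (\<tau> * (\<Sum>i=1..?n. sn i + sn k)))"
    using tau gh n pair by (intro mult_left_mono add_mono sum_mono) auto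
  \<comment> \<open>\<open>sn k\<close> is repeated once per time level, and \<open>\<tau>\<close>
    times the number of levels is at most T.\<close>
  also have "\<tau> * (\<Sum>i=1..?n. sn i + sn k) = (\<tau> * real ?n) * sn k + \<tau> * (\<Sum>i=1..?n. sn i)"
    unfolding sum.distrib sum_constant card_atLeastAtMost by (simp add: algebra_simps del: sum.cl_ivl_Suc of_nat_Suc)
  also have "\<tau> * (g * (sn ?n + sn k) + h * ((\<tau> * real ?n) * sn k + \<tau> * (\<Sum>i=1..?n. sn i)))
     \<le> \<tau> * (g * (sn ?n + sn k) + h * (T * sn k + \<tau> * (\<Sum>i=1..?n. sn i)))"
    using tau gh tau_n[OF n] sn_nonneg[OF k] by (intro mult_left_mono add_left_mono add_right_mono mult_right_mono) auto
  finally show ?thesis unfolding g_def h_def .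
qed

text \<open>Collects the factors of the accumulated dissipation in \<open>memory_bound\<close> and
  \<open>increment_bound\<close>.\<close>

definition c_mem :: real where
  "c_mem = 4 * (1 + 2 * flux_const)\<^sup>2 / (\<omega> * \<mu>) * (\<gamma>\<^sup>2 * T) + \<omega> * \<mu> * T / 4"

text \<open>Budget for the dissipation \<open>2 * \<omega> * \<mu>\<close>: a quarter of
  \<open>\<omega> * \<mu>\<close> goes to the forcing, a quarter to the memory form, a half to the
  increment of S. One full \<open>\<omega> * \<mu>\<close> is left, of which the Gronwall argument
  keeps half.\<close>

lemma one_step:
  assumes n: "n \<in> {1..N}"
  shows "En n - En (n - 1) + (\<omega> * \<mu>) * \<tau> * dn n \<le> \<tau> * (4 * C2\<^sup>2 / (\<omega> * \<mu>)) * L2sq Om (f n)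
     + \<tau> * c_mem * (\<tau> * (\<Sum>j=1..n. dn j))
     + \<tau> * (\<gamma> / \<mu> * (sn n + sn (n - 1)) + (\<gamma> / \<mu> + \<eta>) * (\<gamma> / \<mu>) * (T * sn (n - 1) + \<tau> * (\<Sum>i=1..n. sn i)))"
proof -
  obtain k where k: "n = Suc k" using n by (cases n) auto
  have n': "Suc k \<le> N" using n k by simp
  have k4: "\<omega> * \<mu> / 4 > 0" using omega pos by simp
  have "2 * fip \<K> (f n) (ut n) \<le> \<omega> * \<mu> / 4 * dn n + C2\<^sup>2 / (\<omega> * \<mu> / 4) * L2sq Om (f n)"
    unfolding dn_def using L2(2) by (intro fip_le_dip ut_in[OF n] k4) auto
  from mult_left_mono[OF this, of \<tau>]
  have F: "2 * \<tau> * fip \<K> (f n) (ut n) \<le> \<tau> * (\<omega> * \<mu> / 4) * dn n + \<tau> * (4 * C2\<^sup>2 / (\<omega> * \<mu>)) * L2sq Om (f n)"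
    using tau(1) by (simp add: distrib_left mult_ac)
  have sp: "\<tau> * c_mem * (\<tau> * (\<Sum>j=1..n. dn j)) =
     \<tau> * (4 * (1 + 2 * flux_const)\<^sup>2 / (\<omega> * \<mu>) * (\<gamma>\<^sup>2 * T)) * (\<tau> * (\<Sum>j=1..n. dn j)) + \<tau> * (\<omega> * \<mu> * T / 4) * (\<tau> * (\<Sum>j=1..n. dn j))"
    unfolding c_mem_def by (simp only: distrib_left distrib_right)
  have dd: "2 * \<omega> * \<mu> * \<tau> * dn n = (\<omega> * \<mu>) * \<tau> * dn n + \<tau> * (\<omega> * \<mu> / 4) * dn n + \<tau> * (\<omega> * \<mu> / 4) * dn n + \<tau> * (\<omega> * \<mu> / 2) * dn n"
    by (simp add: field_simps)
  have nk: "n - 1 = k" using k by simp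
  have gen: "e + x \<le> l + (m1 + m2) + c" if "e + x2 \<le> F' - A + I + C" "- A \<le> d1 + m1" "I \<le> d2 + m2" "C \<le> c"
      "F' \<le> d1 + l" "x2 = x + d1 + d1 + d2" for e x l m1 m2 c x2 F' A I C d1 d2 :: real
    using that by linarith
  show ?thesis unfolding sp nk
    by (rule gen[OF energy_step[OF n', folded k] memory_bound[OF n] increment_bound[OF n] cross_bound[OF n', folded k] F dd])
qed

text \<open>\<open>xi\<close> and \<open>Sn\<close> start at zero. The projection tested with itself
  equals the pairing with the datum, so \<open>fip_le\<close> with parameter 1 gives the bound with
  constant one.\<close>

lemma initial_energy: "En 0 \<le> L2sq Om u0"
proof -
  have "xi 0 = 0" unfolding xi_eq p0 Sn_0 by (rule add_0_left)
  then have "En 0 = vip \<K> (u 0) (u 0)"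
    using A.zero_left[OF A.closed(3)] S.zero_left[OF S.closed(3)] by (simp add: En_def sn_def Sn_0)
  moreover have "fip \<K> u0 (u 0) = vip \<K> (u 0) (u 0)"
    unfolding fip_def vip_def using u0_proj Mh_vpolyfun[OF u0_in] by (intro sum.cong refl) auto
  ultimately show ?thesis using fip_le[OF L2(1) u0_in, of 1] by simp
qed

theorem energy_estimate:
  assumes m: "m \<in> {1..N}"
    and K: "32 * (1 + 2 * flux_const)\<^sup>2 * \<gamma>\<^sup>2 * T / \<mu>\<^sup>2 + T / 2 + 2 * (\<gamma> / \<mu>) + 2 * ((\<gamma> / \<mu> + \<eta>) * (\<gamma> / \<mu>)) * T \<le> Kc"
      "\<tau> * Kc \<le> 1/2"
  shows "vip \<K> (u m) (u m) + \<omega> * \<mu> / 2 * \<tau> * (\<Sum>n=1..m. dGsq Om \<K> \<sigma> (ut n)) + 1/2 * \<tau>\<^sup>2 * sdGsq \<K> \<sigma>t (xi m)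
      + 1 / (\<delta> * \<mu>) * \<tau> * sip \<K> (Sn m) (Sn m)
    \<le> 2 * exp (2 * Kc * T) * (L2sq Om u0 + 4 * C2\<^sup>2 / (\<omega> * \<mu>) * \<tau> * (\<Sum>n=1..m. L2sq Om (f n)))"
proof -
  have om: "\<omega> * \<mu> > 0" using omega pos by simp
  have An: "0 \<le> Asip \<K> \<sigma>t (xi n) (xi n)" "0 \<le> vip \<K> (u n) (u n)" if "n \<le> N" for n
    using that by (intro A.nonneg xi_in_P V.nonneg u_in'; simp)+
  have sE: "sn n \<le> En n" if "n \<le> N" for n using An[OF that] by (simp add: En_def)
  \<comment> \<open>\<open>\<omega> \<ge> 1/2\<close> removes the dependence on
    \<open>\<epsilon>\<close> from the Gronwall constant; 32 is 8 times the bound 4 on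
    \<open>1 / \<omega>\<^sup>2\<close>.\<close>
  have cm: "2 * c_mem / (\<omega> * \<mu>) \<le> 32 * (1 + 2 * flux_const)\<^sup>2 * \<gamma>\<^sup>2 * T / \<mu>\<^sup>2 + T / 2"
  proof -
    have "2 * c_mem / (\<omega> * \<mu>) = 8 * ((1 + 2 * flux_const)\<^sup>2 * \<gamma>\<^sup>2 * T / \<mu>\<^sup>2) * (1 / \<omega>\<^sup>2) + T / 2"
      using om omega pos unfolding c_mem_def by (simp add: field_simps power2_eq_square)
    also have "\<dots> \<le> 8 * ((1 + 2 * flux_const)\<^sup>2 * \<gamma>\<^sup>2 * T / \<mu>\<^sup>2) * 4 + T / 2"
    proof (intro add_right_mono mult_left_mono)
      have "(1/2)\<^sup>2 \<le> \<omega>\<^sup>2" using omega(1) by (intro power_mono) auto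
      then show "1 / \<omega>\<^sup>2 \<le> 4" using omega(2) by (simp add: field_simps power2_eq_square)
    qed (use pos in auto)
    finally show ?thesis by simp
  qed
  have cm0: "0 \<le> c_mem" using om pos by (simp add: c_mem_def)
  have "En m + (\<omega> * \<mu>) / 2 * \<tau> * (\<Sum>j=1..m. dn j)
      \<le> 2 * exp (2 * Kc * T) * (En 0 + (4 * C2\<^sup>2 / (\<omega> * \<mu>)) * \<tau> * (\<Sum>n=1..m. L2sq Om (f n)))"
  proof (rule energy_Gronwall[where N=N and s=sn and c=c_mem and g="\<gamma> / \<mu>" and h="(\<gamma> / \<mu> + \<eta>) * (\<gamma> / \<mu>)"])
    show "2 * c_mem / (\<omega> * \<mu>) + 2 * (\<gamma> / \<mu>) + 2 * ((\<gamma> / \<mu> + \<eta>) * (\<gamma> / \<mu>)) * T \<le> Kc" using cm K(1) by linarith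
    show "sn 0 = 0" using S.zero_left[OF S.closed(3)] by (simp add: sn_def Sn_0)
    show "0 \<le> L2sq Om (f n)" for n using L2(2) by (intro L2sq_nonneg) auto
  qed (use tau om cm0 pos dn_nonneg sn_nonneg sE one_step K(2) m in auto)
  also have "\<dots> \<le> 2 * exp (2 * Kc * T) * (L2sq Om u0 + (4 * C2\<^sup>2 / (\<omega> * \<mu>)) * \<tau> * (\<Sum>n=1..m. L2sq Om (f n)))"
    using initial_energy by (intro mult_left_mono add_right_mono) auto
  finally have main: "En m + (\<omega> * \<mu>) / 2 * \<tau> * (\<Sum>j=1..m. dn j) \<le> \<dots>" .
  have "1/2 * sdGsq \<K> \<sigma>t (xi m) \<le> Asip \<K> \<sigma>t (xi m) (xi m)"
    using coercive_sip xi_in_P[of m] m by auto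
  then have "\<tau>\<^sup>2 * (1/2 * sdGsq \<K> \<sigma>t (xi m)) \<le> \<tau>\<^sup>2 * Asip \<K> \<sigma>t (xi m) (xi m)"
    by (intro mult_left_mono) auto
  then have "vip \<K> (u m) (u m) + 1/2 * \<tau>\<^sup>2 * sdGsq \<K> \<sigma>t (xi m) + 1 / (\<delta> * \<mu>) * \<tau> * sip \<K> (Sn m) (Sn m) \<le> En m"
    by (simp add: En_def sn_def)
  then show ?thesis using main unfolding dn_def dGsq_dip by linarith
qed

end

theorem theorem1:
  fixes \<mu> \<gamma> \<eta> T :: real
  assumes dim: "CARD('n::finite) \<in> {2, 3}"
    and pos: "\<mu> > 0" "\<gamma> > 0" "\<eta> > 0" "T > 0"
  shows "\<exists>\<tau>0 > 0. \<exists>C > 0.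
    \<forall>(Om :: (real^'n) set) \<K> (r1::nat) (r2::nat) (\<epsilon>::real) (\<sigma>::real) (\<sigma>t::real) (\<delta>::real)
      (B::real) (Bt::real) (C2::real) Rh Gh u0 f (N::nat) ut u v p.
      dg_domain Om \<and> dg_mesh Om \<K>
      \<and> r1 \<ge> 1 \<and> r1 \<le> r2 + 1 \<and> r2 \<le> r1 + 1
      \<and> \<epsilon> \<in> {-1, 0, 1} \<and> \<sigma> > 0 \<and> \<sigma>t > 0 \<and> \<delta> > 0
      \<and> (\<forall>w\<in>Mh \<K> r1. Aeps Om \<K> \<sigma> \<epsilon> w w \<ge> omega \<epsilon> * dGsq Om \<K> \<sigma> w)
      \<and> (\<forall>g\<in>Ph \<K> r2. Asip \<K> \<sigma>t g g \<ge> (1/2) * sdGsq \<K> \<sigma>t g)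
      \<and> (\<forall>w\<in>Mh \<K> r1. sqrt (vip \<K> w w) \<le> C2 * sqrt (dGsq Om \<K> \<sigma> w))
      \<and> is_Rh Om \<K> r1 r2 Rh \<and> is_Gh \<K> r1 r2 Gh
      \<and> B > 0 \<and> Bt > 0
      \<and> (\<forall>w\<in>Mh \<K> r1. sip \<K> (Rh w) (Rh w) \<le> B\<^sup>2 * vjump_h Om \<K> w)
      \<and> (\<forall>g\<in>Ph \<K> r2. vip \<K> (Gh g) (Gh g) \<le> Bt\<^sup>2 * sjump_h \<K> g)
      \<and> \<sigma> \<ge> B\<^sup>2 / real CARD('n) \<and> \<sigma>t \<ge> 4 * Bt\<^sup>2
      \<and> \<delta> \<le> min (omega \<epsilon> / (8 * real CARD('n))) (omega \<epsilon> * \<mu>\<^sup>2 / (16 * \<gamma>\<^sup>2 * real CARD('n)))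
      \<and> in_L2 Om u0 \<and> (\<forall>n. in_L2 Om (f n))
      \<and> N \<ge> 1 \<and> T / real N \<le> \<tau>0
      \<and> dg_scheme Om \<K> r1 r2 \<epsilon> \<sigma> \<sigma>t \<delta> \<mu> \<gamma> \<eta> T N u0 f ut u v p
      \<longrightarrow> (\<forall>m\<in>{1..N}.
            vip \<K> (u m) (u m)
            + omega \<epsilon> * \<mu> / 2 * (T / real N) * (\<Sum>n=1..m. dGsq Om \<K> \<sigma> (ut n))
            + 1/2 * (T / real N)\<^sup>2 * sdGsq \<K> \<sigma>t (\<xi>h \<delta> \<mu> (T / real N) \<gamma> \<eta> Rh ut p m)
            + 1 / (\<delta> * \<mu>) * (T / real N) * sip \<K> (Sh \<delta> \<mu> (T / real N) \<gamma> \<eta> Rh ut m) (Sh \<delta> \<mu> (T / real N) \<gamma> \<eta> Rh ut m)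
          \<le> C * (L2sq Om u0 + 4 * C2\<^sup>2 / (omega \<epsilon> * \<mu>) * (T / real N) * (\<Sum>n=1..m. L2sq Om (f n))))"
proof -
  \<comment> \<open>The continuity constant of the viscous form written out without reference to the
    mesh, since it has to be available before the mesh is given.\<close>
  define fl where "fl = 1 + 2 * ((real CARD('n))\<^sup>2 * sqrt (real CARD('n)))"
  define K where "K = 32 * fl\<^sup>2 * \<gamma>\<^sup>2 * T / \<mu>\<^sup>2 + T / 2 + 2 * (\<gamma> / \<mu>) + 2 * ((\<gamma> / \<mu> + \<eta>) * (\<gamma> / \<mu>)) * T"
  have g: "0 < \<gamma> / \<mu>" using pos by simp
  have "0 < 2 * ((\<gamma> / \<mu> + \<eta>) * (\<gamma> / \<mu>)) * T"
    using g pos by (intro mult_pos_pos add_pos_pos) auto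
  moreover have "0 \<le> 32 * fl\<^sup>2 * \<gamma>\<^sup>2 * T / \<mu>\<^sup>2" using pos by simp
  ultimately have K: "K > 0" unfolding K_def using g pos(4) by linarith
  show ?thesis
  \<comment> \<open>The threshold is the largest step size with \<open>\<tau> * K \<le> 1/2\<close>,
    as absorption in the Gronwall inequality demands. Both witnesses depend on the dimension,
    \<open>\<mu>\<close>, \<open>\<gamma>\<close>, \<open>\<eta>\<close> and T only.\<close>
  proof (rule exI[of _ "1 / (2 * K)"], rule conjI, use K in simp,
      rule exI[of _ "2 * exp (2 * K * T)"], rule conjI, simp, intro allI impI ballI)
    fix Om :: "(real^'n) set" and \<K> r1 r2 \<epsilon> \<sigma> \<sigma>t \<delta> B Bt C2 Rh Gh u0 f N ut u v p m
    assume H: "dg_domain Om \<and> dg_mesh Om \<K>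
      \<and> r1 \<ge> 1 \<and> r1 \<le> r2 + 1 \<and> r2 \<le> r1 + 1
      \<and> \<epsilon> \<in> {-1, 0, 1} \<and> \<sigma> > 0 \<and> \<sigma>t > 0 \<and> \<delta> > 0
      \<and> (\<forall>w\<in>Mh \<K> r1. Aeps Om \<K> \<sigma> \<epsilon> w w \<ge> omega \<epsilon> * dGsq Om \<K> \<sigma> w)
      \<and> (\<forall>g\<in>Ph \<K> r2. Asip \<K> \<sigma>t g g \<ge> (1/2) * sdGsq \<K> \<sigma>t g)
      \<and> (\<forall>w\<in>Mh \<K> r1. sqrt (vip \<K> w w) \<le> C2 * sqrt (dGsq Om \<K> \<sigma> w))
      \<and> is_Rh Om \<K> r1 r2 Rh \<and> is_Gh \<K> r1 r2 Gh
      \<and> B > 0 \<and> Bt > 0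
      \<and> (\<forall>w\<in>Mh \<K> r1. sip \<K> (Rh w) (Rh w) \<le> B\<^sup>2 * vjump_h Om \<K> w)
      \<and> (\<forall>g\<in>Ph \<K> r2. vip \<K> (Gh g) (Gh g) \<le> Bt\<^sup>2 * sjump_h \<K> g)
      \<and> \<sigma> \<ge> B\<^sup>2 / real CARD('n) \<and> \<sigma>t \<ge> 4 * Bt\<^sup>2
      \<and> \<delta> \<le> min (omega \<epsilon> / (8 * real CARD('n))) (omega \<epsilon> * \<mu>\<^sup>2 / (16 * \<gamma>\<^sup>2 * real CARD('n)))
      \<and> in_L2 Om u0 \<and> (\<forall>n. in_L2 Om (f n))
      \<and> N \<ge> 1 \<and> T / real N \<le> 1 / (2 * K)
      \<and> dg_scheme Om \<K> r1 r2 \<epsilon> \<sigma> \<sigma>t \<delta> \<mu> \<gamma> \<eta> T N u0 f ut u v p" and m: "m \<in> {1..N}"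
    interpret R: dg_run Om \<K> r1 r2 \<epsilon> \<sigma> \<sigma>t B Bt C2 Rh Gh \<delta> \<mu> \<gamma> \<eta> T N u0 f ut u v p
      by unfold_locales (use H pos in blast)+
    have "T / real N \<le> 1 / (2 * K)" using H by blast
    then have tK: "R.\<tau> * K \<le> 1 / 2" unfolding R.\<tau>_def using K by (simp add: field_simps)
    show "vip \<K> (u m) (u m)
            + omega \<epsilon> * \<mu> / 2 * (T / real N) * (\<Sum>n=1..m. dGsq Om \<K> \<sigma> (ut n))
            + 1/2 * (T / real N)\<^sup>2 * sdGsq \<K> \<sigma>t (\<xi>h \<delta> \<mu> (T / real N) \<gamma> \<eta> Rh ut p m)
            + 1 / (\<delta> * \<mu>) * (T / real N) * sip \<K> (Sh \<delta> \<mu> (T / real N) \<gamma> \<eta> Rh ut m) (Sh \<delta> \<mu> (T / real N) \<gamma> \<eta> Rh ut m)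
          \<le> 2 * exp (2 * K * T) * (L2sq Om u0 + 4 * C2\<^sup>2 / (omega \<epsilon> * \<mu>) * (T / real N) * (\<Sum>n=1..m. L2sq Om (f n)))"
      using R.energy_estimate[OF m _ tK]
      unfolding R.flux_const_def R.xi_def R.Sn_def R.\<tau>_def fl_def[symmetric] K_def[symmetric] by blast
  qed
qed

end
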